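(* Let $M/F$ be a field extension of degree $n$ with non-trivial solvable group $G=\mathrm{Aut}_F(M)$, and let $A$ be a central simple algebra of degree $n$ over $F$ with maximal subfield $M$. Let $$\{1\}=G_0<G_1<\dots<G_k=G$$ be a chain of subgroups such that $G_j$ is normal in $G_{j+1}$ and $G_{j+1}/G_j$ is cyclic of prime order $q_j$, generated by the class of $\sigma_{j+1}\in G_{j+1}$, for all $j\in\{0,\dots,k-1\}$ (such a chain exists since $G$ is solvable). Then there exists a chain of subalgebras $$M=A_0\subset A_1\subset\dots\subset A_k=M(G)\subseteq A$$ of $A$ which are $G_i$-crossed product algebras over $Z_i=\mathrm{Fix}(G_i)$, and where $$A_{i+1}\cong A_i[t_i;\tau_i]/A_i[t_i;\tau_i](t_i^{q_i}-c_i)$$ for all $i\in\{0,\dots,k-1\}$, such that (i) $q_i$ is the prime order of the factor group $G_{i+1}/G_i$, (ii) $\tau_i$ is an $F$-automorphism of $A_i$ of inner order $q_i$ which restricts (on $M$) to $\sigma_{i+1}\in G_{i+1}$, which generates $G_{i+1}/G_i$, and (iii) $c_i\in\mathrm{Fix}(\tau_i)$ is invertible.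
   Context: $\mathrm{Aut}_F(M)$ is the group of field automorphisms of $M$ fixing $F$ pointwise; for a subgroup $H$, $\mathrm{Fix}(H)$ is its fixed field in $M$. A central simple algebra has degree $n$ over $F$ if it has dimension $n^2$. $M(G)=\mathrm{Cent}_A(\mathrm{Fix}(G))$ is the centralizer of $\mathrm{Fix}(G)$ in $A$. An $H$-crossed product algebra over a field $Z$ is a central simple $Z$-algebra of degree $e$ containing a field extension $M/Z$ which is Galois of degree $e$ with Galois group $H$ (here always the given field $M$, which is a maximal subfield). For a ring $B$ and an automorphism $\tau$ of $B$, $B[t;\tau]$ is the twisted polynomial ring with $tb=\tau(b)t$. For monic $f\in B[t;\tau]$ of degree $q$, $B[t;\tau]/B[t;\tau]f$ denotes the set of polynomials of degree $<q$ with multiplication $g\circ h=$ the remainder of $gh$ after right division by $f$ (the unique $r$ with $\deg r<q$ and $gh=q_1f+r$); when $B[t;\tau]f$ is a two-sided ideal this is the quotient ring. $\mathrm{Fix}(\tau)=\{b\in B:\tau(b)=b\}$. The inner order of an automorphism $\tau$ is the smallest positive integer $e$ such that $\tau^e$ is an inner automorphism $x\mapsto uxu^{-1}$ ($u$ a unit). An $F$-automorphism is a ring automorphism fixing $F$ pointwise. *)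

theory Defs
  imports
    "HOL-Computational_Algebra.Primes"
    "HOL-Algebra.Embedded_Algebras"
    "HOL-Algebra.Solvable_Groups"
    "HOL-Algebra.QuotRing"
    "HOL-Algebra.UnivPoly"
    "HOL-Algebra.Bij"
begin

text \<open>
  All rings in sight are subrings \<open>B\<close> of one ambient ring \<open>R\<close>; the ring structure on \<open>B\<close> is
  \<open>R\<lparr>carrier := B\<rparr>\<close>. Ground fields are subsets of the algebra (the identification \<open>F = F \<cdot> 1\<close>).
\<close>

definition centralizer :: "('a, 'b) ring_scheme \<Rightarrow> 'a set \<Rightarrow> 'a set" where
  "centralizer R S = {a \<in> carrier R. \<forall>s \<in> S. a \<otimes>\<^bsub>R\<^esub> s = s \<otimes>\<^bsub>R\<^esub> a}"

definition central_simple_algebra_of_degree ::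
    "('a, 'b) ring_scheme \<Rightarrow> 'a set \<Rightarrow> nat \<Rightarrow> bool" where
  "central_simple_algebra_of_degree R K n \<longleftrightarrow>
     ring R \<and> subfield K R \<and>
     centralizer R (carrier R) = K \<and>
     (\<forall>I. ideal I R \<longrightarrow> I = {\<zero>\<^bsub>R\<^esub>} \<or> I = carrier R) \<and>
     ring.dimension R (n\<^sup>2) K (carrier R)"

definition field_extension_of_degree ::
    "('a, 'b) ring_scheme \<Rightarrow> 'a set \<Rightarrow> 'a set \<Rightarrow> nat \<Rightarrow> bool" where
  "field_extension_of_degree R K L n \<longleftrightarrow>
     subfield K R \<and> subfield L R \<and> K \<subseteq> L \<and> ring.dimension R n K L"

definition maximal_subfield :: "('a, 'b) ring_scheme \<Rightarrow> 'a set \<Rightarrow> bool" where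
  "maximal_subfield R L \<longleftrightarrow>
     subfield L R \<and> (\<forall>L'. subfield L' R \<and> L \<subseteq> L' \<longrightarrow> L' = L)"

text \<open>
  \<open>Aut\<^sub>K(L)\<close> for a subring \<open>L\<close> of \<open>R\<close>. As for \<^const>\<open>AutoGroup\<close>, automorphisms are extensional
  functions (undefined outside \<open>L\<close>), so that each one is represented exactly once.
\<close>

definition aut_group :: "('a, 'b) ring_scheme \<Rightarrow> 'a set \<Rightarrow> 'a set \<Rightarrow> ('a \<Rightarrow> 'a) monoid" where
  "aut_group R K L = BijGroup L
     \<lparr>carrier := {f \<in> Bij L. f \<in> ring_iso (R\<lparr>carrier := L\<rparr>) (R\<lparr>carrier := L\<rparr>) \<and> (\<forall>x \<in> K. f x = x)}\<rparr>"

definition fixed_points :: "('a \<Rightarrow> 'a) set \<Rightarrow> 'a set \<Rightarrow> 'a set" where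
  "fixed_points S L = {x \<in> L. \<forall>f \<in> S. f x = x}"

text \<open>
  The finite extension \<open>L/K\<close> of degree \<open>n\<close> is Galois, i.e. the fixed field of \<open>Aut\<^sub>K(L)\<close> is \<open>K\<close>.
\<close>

definition galois_extension_of_degree ::
    "('a, 'b) ring_scheme \<Rightarrow> 'a set \<Rightarrow> 'a set \<Rightarrow> nat \<Rightarrow> bool" where
  "galois_extension_of_degree R K L n \<longleftrightarrow>
     field_extension_of_degree R K L n \<and> fixed_points (carrier (aut_group R K L)) L = K"

text \<open>\<open>R\<close> is an \<open>H\<close>-crossed product algebra over \<open>Z\<close>, by means of the Galois extension \<open>M/Z\<close>.\<close>

definition crossed_product_algebra ::
    "('a, 'b) ring_scheme \<Rightarrow> 'a set \<Rightarrow> 'a set \<Rightarrow> ('a \<Rightarrow> 'a) set \<Rightarrow> bool" where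
  "crossed_product_algebra R Z M H \<longleftrightarrow>
     (\<exists>e. central_simple_algebra_of_degree R Z e \<and>
          galois_extension_of_degree R Z M e \<and>
          carrier (aut_group R Z M) = H)"

definition inner_automorphism :: "('a, 'b) ring_scheme \<Rightarrow> ('a \<Rightarrow> 'a) \<Rightarrow> bool" where
  "inner_automorphism R f \<longleftrightarrow>
     (\<exists>u \<in> Units R. \<forall>x \<in> carrier R. f x = u \<otimes>\<^bsub>R\<^esub> x \<otimes>\<^bsub>R\<^esub> inv\<^bsub>R\<^esub> u)"

text \<open>A relation rather than a function, since no power of \<open>f\<close> need be inner.\<close>

definition has_inner_order :: "('a, 'b) ring_scheme \<Rightarrow> ('a \<Rightarrow> 'a) \<Rightarrow> nat \<Rightarrow> bool" where
  "has_inner_order R f e \<longleftrightarrow>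
     0 < e \<and> inner_automorphism R (f ^^ e) \<and>
     (\<forall>m. 0 < m \<and> m < e \<longrightarrow> \<not> inner_automorphism R (f ^^ m))"

text \<open>
  \<open>B[t;\<tau>]\<close> differs from \<^term>\<open>UP B\<close> only in the multiplication:
  \<open>(a t\<^sup>i) (b t\<^sup>j) = a \<tau>\<^sup>i(b) t\<^sup>i\<^sup>+\<^sup>j\<close>.
\<close>

definition twisted_poly_ring ::
    "('a, 'b) ring_scheme \<Rightarrow> ('a \<Rightarrow> 'a) \<Rightarrow> ('a, nat \<Rightarrow> 'a) up_ring" where
  "twisted_poly_ring B \<tau> = (UP B)
     \<lparr>mult := (\<lambda>p \<in> up B. \<lambda>q \<in> up B. \<lambda>n. \<Oplus>\<^bsub>B\<^esub>i \<in> {..n}. p i \<otimes>\<^bsub>B\<^esub> (\<tau> ^^ i) (q (n - i)))\<rparr>"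

text \<open>
  Polynomials of degree less than \<open>deg f\<close>, written through coefficients because \<^const>\<open>deg\<close> of the
  zero polynomial is \<open>0\<close>.
\<close>

definition polys_below ::
    "('a, 'b) ring_scheme \<Rightarrow> ('a \<Rightarrow> 'a) \<Rightarrow> (nat \<Rightarrow> 'a) \<Rightarrow> (nat \<Rightarrow> 'a) set" where
  "polys_below B \<tau> f =
     {g \<in> carrier (twisted_poly_ring B \<tau>).
        \<forall>i \<ge> deg B f. coeff (twisted_poly_ring B \<tau>) g i = \<zero>\<^bsub>B\<^esub>}"

definition right_remainder ::
    "('a, 'b) ring_scheme \<Rightarrow> ('a \<Rightarrow> 'a) \<Rightarrow> (nat \<Rightarrow> 'a) \<Rightarrow> (nat \<Rightarrow> 'a) \<Rightarrow> nat \<Rightarrow> 'a" where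
  "right_remainder B \<tau> f g =
     (THE r. r \<in> polys_below B \<tau> f \<and>
        (\<exists>s \<in> carrier (twisted_poly_ring B \<tau>).
           g = s \<otimes>\<^bsub>twisted_poly_ring B \<tau>\<^esub> f \<oplus>\<^bsub>twisted_poly_ring B \<tau>\<^esub> r))"

text \<open>\<open>B[t;\<tau>]/B[t;\<tau>]f\<close>, for monic \<open>f\<close> of positive degree.\<close>

definition twisted_poly_quotient ::
    "('a, 'b) ring_scheme \<Rightarrow> ('a \<Rightarrow> 'a) \<Rightarrow> (nat \<Rightarrow> 'a) \<Rightarrow> (nat \<Rightarrow> 'a) ring" where
  "twisted_poly_quotient B \<tau> f =
     \<lparr>carrier = polys_below B \<tau> f,
      mult = (\<lambda>g h. right_remainder B \<tau> f (g \<otimes>\<^bsub>twisted_poly_ring B \<tau>\<^esub> h)),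
      one = \<one>\<^bsub>twisted_poly_ring B \<tau>\<^esub>,
      zero = \<zero>\<^bsub>twisted_poly_ring B \<tau>\<^esub>,
      add = add (twisted_poly_ring B \<tau>)\<rparr>"

text \<open>The polynomial \<open>t\<^sup>q - c\<close> of \<open>B[t;\<tau>]\<close>.\<close>

definition pure_poly ::
    "('a, 'b) ring_scheme \<Rightarrow> ('a \<Rightarrow> 'a) \<Rightarrow> nat \<Rightarrow> 'a \<Rightarrow> nat \<Rightarrow> 'a" where
  "pure_poly B \<tau> q c =
     monom (twisted_poly_ring B \<tau>) \<one>\<^bsub>B\<^esub> q \<ominus>\<^bsub>twisted_poly_ring B \<tau>\<^esub> monom (twisted_poly_ring B \<tau>) c 0"

text \<open>
  The ring \<open>C\<close> is isomorphic to \<open>B[t;\<tau>]/B[t;\<tau>](t\<^sup>q - c)\<close> as an algebra over \<open>Z \<subseteq> B \<inter> C\<close>; on the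
  right-hand side \<open>Z\<close> acts through the constant polynomials.
\<close>

definition iso_twisted_poly_quotient ::
    "'a set \<Rightarrow> ('a, 'b) ring_scheme \<Rightarrow> ('a, 'b) ring_scheme \<Rightarrow> ('a \<Rightarrow> 'a) \<Rightarrow> nat \<Rightarrow> 'a \<Rightarrow> bool" where
  "iso_twisted_poly_quotient Z C B \<tau> q c \<longleftrightarrow>
     (\<exists>\<phi> \<in> ring_iso C (twisted_poly_quotient B \<tau> (pure_poly B \<tau> q c)).
        \<forall>z \<in> Z. \<phi> z = monom (twisted_poly_ring B \<tau>) z 0)"

text \<open>\<open>N\<close> is normal in \<open>H\<close>, with quotient cyclic of order \<open>q\<close> generated by the class of \<open>s\<close>.\<close>

definition cyclic_step ::
    "('a, 'b) monoid_scheme \<Rightarrow> 'a set \<Rightarrow> 'a set \<Rightarrow> nat \<Rightarrow> 'a \<Rightarrow> bool" where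
  "cyclic_step G N H q s \<longleftrightarrow>
     N \<lhd> G\<lparr>carrier := H\<rparr> \<and>
     order (G\<lparr>carrier := H\<rparr> Mod N) = q \<and>
     s \<in> H \<and>
     generate (G\<lparr>carrier := H\<rparr> Mod N) {N #>\<^bsub>G\<^esub> s} = carrier (G\<lparr>carrier := H\<rparr> Mod N)"

end

theory Submission
  imports Defs
begin

text \<open>
  The algebras of the chain are the centralizers \<open>C(Z\<^sub>i)\<close> in \<open>A\<close> of the fixed fields \<open>Z\<^sub>i\<close> of the groups
  \<open>G\<^sub>i\<close>, so nothing has to be constructed: the proof finds units of \<open>A\<close> that exhibit each centralizer as
  a crossed product and each step as a cyclic extension.

  First, \<open>M\<close> is its own centralizer, and each \<open>\<sigma>\<close> in \<open>Aut\<^sub>F(M)\<close> is induced by conjugation with a unit of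
  \<open>A\<close>. Both facts come from one element \<open>\<Sum> \<mu>\<^sub>i \<otimes> a\<^sub>i\<close> of \<open>M \<otimes> A\<close>, where \<open>\<mu>\<close> is a basis of \<open>M\<close> over \<open>F\<close>. As \<open>A\<close> is
  simple with centre \<open>F\<close>, the map \<open>x \<mapsto> \<Sum> \<mu>\<^sub>i x a\<^sub>i\<close> determines the \<open>a\<^sub>i\<close> (\<open>sandwich_sum_zero_imp_zero\<close>), and
  since \<open>M\<close> has degree \<open>n\<close> a count of dimensions shows that every \<open>M\<close>-linear map \<open>A \<rightarrow> A\<close> has this form.
  The element is chosen so that the map is a coordinate with values in \<open>M\<close>
  (\<open>coordinate_as_sandwich_sum\<close>). It commutes with the centralizer of \<open>M\<close>, which gives \<open>centralizer_M\<close>; and \<open>\<Sum> \<sigma>(\<mu>\<^sub>i) x a\<^sub>i\<close> is an element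
  \<open>v\<close> with \<open>v m = \<sigma>(m) v\<close> (\<open>casimir_element\<close>), which is a unit unless it is zero (\<open>twist_unit\<close>).

  Second, let \<open>H\<close> be a finite group of automorphisms of \<open>M\<close> with fixed field \<open>Z\<close>. There are \<open>x\<^sub>j, y\<^sub>j\<close> in \<open>M\<close>
  with \<open>\<Sum> x\<^sub>j \<sigma>(y\<^sub>j) = 0\<close> for \<open>\<sigma> \<noteq> 1\<close> in \<open>H\<close> and \<open>\<Sum> x\<^sub>j y\<^sub>j = 1\<close> (\<open>ex_separating_pairs\<close>). The map \<open>a \<mapsto> \<Sum> x\<^sub>j a y\<^sub>j\<close> projects
  \<open>C(Z)\<close> onto \<open>C(M) = M\<close>, and with it one reads off that units \<open>v\<^sub>\<sigma>\<close> inducing the elements \<open>\<sigma>\<close> of \<open>H\<close> form a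
  basis of \<open>C(Z)\<close> over \<open>M\<close> (\<open>basis_centralizer\<close>). Dimension, centre and simplicity of \<open>C(Z)\<close> as well as
  \<open>Aut\<^sub>Z(M) = H\<close> follow from this basis and the projection (\<open>centralizer_crossed_product\<close>).

  Third, let \<open>N\<close> be normal in \<open>H\<close> with cyclic quotient of order \<open>q\<close> generated by the class of \<open>\<sigma>\<close>. A unit
  \<open>u\<close> inducing \<open>\<sigma>\<close> normalizes the smaller algebra \<open>B\<close>, and the larger one is the direct sum of the
  \<open>B u\<^sup>j\<close> with \<open>j < q\<close>. Evaluation \<open>t \<mapsto> u\<close> is multiplicative on the twisted polynomials over \<open>B\<close> and kills
  \<open>t\<^sup>q - u\<^sup>q\<close>, so on remainders modulo this polynomial it is an isomorphism (\<open>cyclic_step_extension\<close>).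
\<close>


section \<open>Bases and linear systems over a subfield\<close>

context ring
begin

lemma finsum_mem:
  assumes "\<zero> \<in> E" "\<And>a b. a \<in> E \<Longrightarrow> b \<in> E \<Longrightarrow> a \<oplus> b \<in> E" "E \<subseteq> carrier R"
    and "\<And>i. i \<in> I \<Longrightarrow> f i \<in> E"
  shows "(\<Oplus>i\<in>I. f i) \<in> E"
  using assms(4)
proof (induct I rule: infinite_finite_induct)
  case (insert x I)
  then have "(\<Oplus>i\<in>insert x I. f i) = f x \<oplus> (\<Oplus>i\<in>I. f i)"
    using assms(3) by (subst finsum_insert) auto
  with insert assms(2) show ?case by auto
qed (use assms(1) in auto)

lemma finsum_subring:
  assumes "subring B R" "\<And>i. i \<in> I \<Longrightarrow> f i \<in> B"
  shows "(\<Oplus>i\<in>I. f i) \<in> B"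
  using assms(2) by (intro finsum_mem) (auto simp: subringE[OF assms(1)] dest: subsetD[OF subringE(1)[OF assms(1)]])

lemma foldSetD_cong:
  assumes "(B, y) \<in> foldSetD D f e" "B \<subseteq> A" "\<And>x. x \<in> A \<Longrightarrow> f x = g x"
  shows "(B, y) \<in> foldSetD D g e"
  using assms(1,2)
proof (induct rule: foldSetD.induct)
  case (insertI x B y)
  then have "(insert x B, g x y) \<in> foldSetD D g e"
    using assms(3)[of x] by (intro foldSetD.insertI) auto
  then show ?case using insertI assms(3)[of x] by simp
qed (auto intro: foldSetD.emptyI)

text \<open>Folding evaluates the summands on the index set only, so equality there suffices.\<close>

lemma finsum_eq:
  assumes "\<And>i. i \<in> I \<Longrightarrow> f i = g i"
  shows "(\<Oplus>i\<in>I. f i) = (\<Oplus>i\<in>I. g i)"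
proof -
  have "(I, y) \<in> foldSetD D (mult (add_monoid R) \<circ> f) e \<longleftrightarrow> (I, y) \<in> foldSetD D (mult (add_monoid R) \<circ> g) e"
    for y D e
    using assms foldSetD_cong[of I y D "mult (add_monoid R) \<circ> f" e I "mult (add_monoid R) \<circ> g"]
      foldSetD_cong[of I y D "mult (add_monoid R) \<circ> g" e I "mult (add_monoid R) \<circ> f"] by auto
  then show ?thesis unfolding finsum_def finprod_def foldD_def by simp
qed

lemma finsum_zeroI: "(\<And>i. i \<in> I \<Longrightarrow> f i = \<zero>) \<Longrightarrow> (\<Oplus>i\<in>I. f i) = \<zero>"
  by (rule add.finprod_one_eqI)

lemma finsum_swap:
  assumes "finite I" "finite J" "\<And>i j. i \<in> I \<Longrightarrow> j \<in> J \<Longrightarrow> f i j \<in> carrier R"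
  shows "(\<Oplus>i\<in>I. \<Oplus>j\<in>J. f i j) = (\<Oplus>j\<in>J. \<Oplus>i\<in>I. f i j)"
  using assms(1,3)
proof (induct I)
  case (insert x I)
  have "(\<Oplus>i\<in>insert x I. \<Oplus>j\<in>J. f i j) = (\<Oplus>j\<in>J. f x j) \<oplus> (\<Oplus>j\<in>J. \<Oplus>i\<in>I. f i j)"
    using insert by (subst finsum_insert) (auto simp: Pi_def)
  also have "\<dots> = (\<Oplus>j\<in>J. f x j \<oplus> (\<Oplus>i\<in>I. f i j))"
    using insert by (subst finsum_addf) (auto simp: Pi_def)
  also have "\<dots> = (\<Oplus>j\<in>J. \<Oplus>i\<in>insert x I. f i j)"
    using insert by (intro finsum_eq) (auto simp: Pi_def)
  finally show ?case .
qed (simp add: finsum_zero)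

lemma finsum_cmult:
  assumes "finite I" "a \<in> carrier R" "\<And>i. i \<in> I \<Longrightarrow> f i \<in> carrier R"
  shows "a \<otimes> (\<Oplus>i\<in>I. f i) = (\<Oplus>i\<in>I. a \<otimes> f i)"
    and "(\<Oplus>i\<in>I. f i) \<otimes> a = (\<Oplus>i\<in>I. f i \<otimes> a)"
  using assms finsum_rdistr[of I a f] finsum_ldistr[of I a f] by auto

lemma finsum_uminus:
  assumes "finite I" "\<And>i. i \<in> I \<Longrightarrow> f i \<in> carrier R"
  shows "\<ominus> (\<Oplus>i\<in>I. f i) = (\<Oplus>i\<in>I. \<ominus> f i)"
  using assms
proof (induct I)
  case (insert x I)
  then show ?case by (simp add: Pi_def minus_add)
qed simp

lemma finsum_minus:
  assumes "finite I" "\<And>i. i \<in> I \<Longrightarrow> f i \<in> carrier R" "\<And>i. i \<in> I \<Longrightarrow> g i \<in> carrier R"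
  shows "(\<Oplus>i\<in>I. f i \<ominus> g i) = (\<Oplus>i\<in>I. f i) \<ominus> (\<Oplus>i\<in>I. g i)"
  using assms by (simp add: a_minus_def finsum_uminus finsum_addf Pi_def)

lemma finsum_delta:
  assumes "finite I" "j \<in> I" "\<And>i. i \<in> I \<Longrightarrow> f i \<in> carrier R"
  shows "(\<Oplus>i\<in>I. if i = j then f i else \<zero>) = f j"
  using assms by (intro add.finprod_singleton_swap) auto

lemma finsum_remove:
  assumes "finite I" "j \<in> I" "\<And>i. i \<in> I \<Longrightarrow> f i \<in> carrier R"
  shows "(\<Oplus>i\<in>I. f i) = f j \<oplus> (\<Oplus>i\<in>I - {j}. f i)"
proof -
  have "(\<Oplus>i\<in>insert j (I - {j}). f i) = f j \<oplus> (\<Oplus>i\<in>I - {j}. f i)"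
    using assms by (intro finsum_insert) auto
  then show ?thesis using assms(2) by (simp add: insert_absorb)
qed

lemma minus_eq_zero_iff:
  "\<lbrakk> a \<in> carrier R; b \<in> carrier R \<rbrakk> \<Longrightarrow> a \<ominus> b = \<zero> \<longleftrightarrow> a = b"
  using r_right_minus_eq by blast

lemma Units_intertwine_inv:
  assumes u: "u \<in> Units R" and R: "x \<in> carrier R" "y \<in> carrier R" and eq: "u \<otimes> x = y \<otimes> u"
  shows "inv u \<otimes> y = x \<otimes> inv u"
proof -
  have "inv u \<otimes> (y \<otimes> u) \<otimes> inv u = inv u \<otimes> (u \<otimes> x) \<otimes> inv u" using eq by simp
  moreover have "inv u \<otimes> (y \<otimes> u) \<otimes> inv u = inv u \<otimes> y" using u R by (simp add: m_assoc Units_closed)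
  moreover have "inv u \<otimes> (u \<otimes> x) \<otimes> inv u = x \<otimes> inv u" using u R by (simp add: m_assoc[symmetric] Units_closed)
  ultimately show ?thesis by simp
qed

lemma Units_r_cancel:
  assumes u: "u \<in> Units R" and R: "x \<in> carrier R" "y \<in> carrier R" and eq: "x \<otimes> u = y \<otimes> u"
  shows "x = y"
proof -
  have "x \<otimes> u \<otimes> inv u = y \<otimes> u \<otimes> inv u" using eq by simp
  then show ?thesis using u R by (simp add: m_assoc Units_closed)
qed

text \<open>
  Bases are indexed by arbitrary sets, because the natural basis of a crossed product is indexed by
  a group.
\<close>

definition lin_indep :: "'a set \<Rightarrow> ('i \<Rightarrow> 'a) \<Rightarrow> 'i set \<Rightarrow> bool" where
  "lin_indep K e I \<longleftrightarrow> (\<forall>c. (\<forall>i\<in>I. c i \<in> K) \<longrightarrow> (\<Oplus>i\<in>I. c i \<otimes> e i) = \<zero> \<longrightarrow> (\<forall>i\<in>I. c i = \<zero>))"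

definition is_basis :: "'a set \<Rightarrow> 'a set \<Rightarrow> ('i \<Rightarrow> 'a) \<Rightarrow> 'i set \<Rightarrow> bool" where
  "is_basis K E e I \<longleftrightarrow> finite I \<and> (\<forall>i\<in>I. e i \<in> E) \<and> lin_indep K e I \<and>
     (\<forall>x\<in>E. \<exists>c. (\<forall>i\<in>I. c i \<in> K) \<and> x = (\<Oplus>i\<in>I. c i \<otimes> e i))"

lemma lin_indepD:
  assumes "lin_indep K e I" "\<And>i. i \<in> I \<Longrightarrow> c i \<in> K" "(\<Oplus>i\<in>I. c i \<otimes> e i) = \<zero>" "i \<in> I"
  shows "c i = \<zero>"
  using assms unfolding lin_indep_def by simp

lemma basis_coords:
  assumes "is_basis K E e I" "x \<in> E"
  shows "\<exists>c. (\<forall>i\<in>I. c i \<in> K) \<and> x = (\<Oplus>i\<in>I. c i \<otimes> e i)"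
  using assms unfolding is_basis_def by blast

lemma combine_eq_finsum:
  assumes "length Ks = length Us" "set Ks \<subseteq> carrier R" "set Us \<subseteq> carrier R"
  shows "combine Ks Us = (\<Oplus>i\<in>{..<length Us}. Ks ! i \<otimes> Us ! i)"
  using assms
proof (induct Ks Us rule: list_induct2)
  case (Cons k Ks u Us)
  have m: "Ks ! i \<in> carrier R" "Us ! i \<in> carrier R" if "i < length Us" for i
    using Cons that by (auto simp: subset_iff)
  have "(\<Oplus>i\<in>{..<length (u # Us)}. (k # Ks) ! i \<otimes> (u # Us) ! i)
     = k \<otimes> u \<oplus> (\<Oplus>i\<in>Suc ` {..<length Us}. (k # Ks) ! i \<otimes> (u # Us) ! i)"
    using Cons m by (simp only: list.size add_0_right add_Suc_right lessThan_Suc_eq_insert_0)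
      (subst finsum_insert, auto)
  also have "(\<Oplus>i\<in>Suc ` {..<length Us}. (k # Ks) ! i \<otimes> (u # Us) ! i) = (\<Oplus>i\<in>{..<length Us}. Ks ! i \<otimes> Us ! i)"
    using m by (subst finsum_reindex) auto
  finally show ?case using Cons by auto
qed simp

lemma dimension_imp_basis:
  assumes K: "subfield K R" and "dimension d K E"
  shows "\<exists>e. is_basis K E e {..<d}"
proof -
  obtain Vs where Vs: "set Vs \<subseteq> carrier R" "independent K Vs" "length Vs = d" "Span K Vs = E"
    using exists_base[OF K assms(2)] by auto
  note KR = subfieldE(3)[OF K]
  have "lin_indep K ((!) Vs) {..<d}"
    unfolding lin_indep_def
  proof (intro allI impI ballI)
    fix c i assume c: "\<forall>i\<in>{..<d}. c i \<in> K" "(\<Oplus>i\<in>{..<d}. c i \<otimes> Vs ! i) = \<zero>" and i: "i \<in> {..<d}"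
    let ?Ks = "map c [0..<d]"
    have "combine ?Ks Vs = (\<Oplus>i\<in>{..<d}. ?Ks ! i \<otimes> Vs ! i)"
      using combine_eq_finsum[of ?Ks Vs] c(1) KR Vs by fastforce
    also have "\<dots> = (\<Oplus>i\<in>{..<d}. c i \<otimes> Vs ! i)"
      using c(1) KR Vs by (intro finsum_eq) (auto simp: subset_iff)
    finally have "set (take (length Vs) ?Ks) \<subseteq> {\<zero>}"
      using c Vs(2) by (intro independent_imp_trivial_combine[OF K]) auto
    with i Vs(3) show "c i = \<zero>" by (auto simp: image_subset_iff)
  qed
  moreover have "\<exists>c. (\<forall>i\<in>{..<d}. c i \<in> K) \<and> x = (\<Oplus>i\<in>{..<d}. c i \<otimes> Vs ! i)" if x: "x \<in> E" for x
  proof -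
    obtain Ks where Ks: "set Ks \<subseteq> K" "length Ks = d" "x = combine Ks Vs"
      using x Span_mem_iff_length_version[OF K Vs(1)] Vs by auto
    then have "x = (\<Oplus>i\<in>{..<d}. Ks ! i \<otimes> Vs ! i)"
      using combine_eq_finsum[of Ks Vs] Vs KR by auto
    with Ks show ?thesis by (intro exI[of _ "(!) Ks"]) (auto simp: subset_iff)
  qed
  ultimately show ?thesis
    using Vs Span_base_incl[OF K Vs(1)] unfolding is_basis_def by (intro exI[of _ "(!) Vs"]) auto
qed

text \<open>A family that spans over the smaller field spans over the larger one.\<close>

lemma finite_dimension_larger_field:
  assumes K: "subfield K R" and L: "subfield L R" "K \<subseteq> L" and d: "dimension d K E"
    and smult: "\<And>l x. \<lbrakk> l \<in> L; x \<in> E \<rbrakk> \<Longrightarrow> l \<otimes> x \<in> E"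
  shows "\<exists>m. dimension m L E"
proof -
  obtain Us where Us: "set Us \<subseteq> carrier R" "Span K Us = E"
    using exists_base[OF K d] by auto
  have E: "subalgebra K E R"
    using Span_is_subalgebra[OF K Us(1)] Us(2) by (metis)
  have UsE: "set Us \<subseteq> E" using Span_base_incl[OF K Us(1)] Us(2) by blast
  have "subalgebra K (Span L Us) R"
    using Span_is_subalgebra[OF L(1) Us(1)] L(2)
    unfolding subalgebra_def subalgebra_axioms_def by blast
  then have "E \<subseteq> Span L Us"
    using subalgebra_Span_incl[OF K _ Span_base_incl[OF L(1) Us(1)]] Us(2) by blast
  moreover have "subalgebra L E R"
    using E smult unfolding subalgebra_def subalgebra_axioms_def by blast
  then have "Span L Us \<subseteq> E" using subalgebra_Span_incl[OF L(1) _ UsE] by blast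
  ultimately have "Span L Us = E" by blast
  then show ?thesis using Span_finite_dimension[OF L(1) Us(1)] unfolding finite_dimension_def by metis
qed

text \<open>Gaussian elimination: solve one equation for one unknown and substitute into the others.\<close>

lemma underdetermined_system:
  assumes K: "subfield K R" and "finite J" "finite X" "card J < card X"
    and "\<And>x j. x \<in> X \<Longrightarrow> j \<in> J \<Longrightarrow> f x j \<in> K"
  shows "\<exists>a. (\<forall>x\<in>X. a x \<in> K) \<and> (\<exists>x\<in>X. a x \<noteq> \<zero>) \<and> (\<forall>j\<in>J. (\<Oplus>x\<in>X. a x \<otimes> f x j) = \<zero>)"
  using assms(2-)
proof (induct J arbitrary: X f)
  case empty
  then have "X \<noteq> {}" by auto
  then show ?case
    using subringE(3)[OF subfieldE(1)[OF K]] subfieldE(6)[OF K] by (intro exI[of _ "\<lambda>_. \<one>"]) auto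
next
  case (insert l J)
  note Ks = subringE[OF subfieldE(1)[OF K]]
  have KR: "k \<in> K \<Longrightarrow> k \<in> carrier R" for k using Ks(1) by auto
  show ?case
  proof (cases "\<forall>x\<in>X. f x l = \<zero>")
    case True
    have "card J < card X" using insert by simp
    then obtain a where a: "\<forall>x\<in>X. a x \<in> K" "\<exists>x\<in>X. a x \<noteq> \<zero>" "\<forall>j\<in>J. (\<Oplus>x\<in>X. a x \<otimes> f x j) = \<zero>"
      using insert(3)[of X f] insert(4,6) by blast
    moreover have "(\<Oplus>x\<in>X. a x \<otimes> f x l) = \<zero>"
      using True a KR by (intro finsum_zeroI) auto
    ultimately show ?thesis by auto
  next
    case False
    then obtain p where p: "p \<in> X" "f p l \<noteq> \<zero>" by auto
    define r where "r = inv (f p l)"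
    have r: "r \<in> K" "r \<otimes> f p l = \<one>"
      using subfield_m_inv[OF K, of "f p l"] p insert by (auto simp: r_def)
    have fK: "f x j \<in> K" if "x \<in> X" "j = l \<or> j \<in> J" for x j using insert(6) that by auto
    define g where "g x j = f x j \<ominus> (f x l \<otimes> r) \<otimes> f p j" for x j
    have "card J < card (X - {p})" using insert p by simp
    moreover have "g x j \<in> K" if "x \<in> X - {p}" "j \<in> J" for x j
      using that p fK r Ks unfolding g_def a_minus_def by auto
    ultimately obtain a where a: "\<forall>x\<in>X-{p}. a x \<in> K" "\<exists>x\<in>X-{p}. a x \<noteq> \<zero>"
        "\<forall>j\<in>J. (\<Oplus>x\<in>X-{p}. a x \<otimes> g x j) = \<zero>"
      using insert(3)[of "X - {p}" g] insert by auto
    define s where "s = (\<Oplus>x\<in>X-{p}. a x \<otimes> (f x l \<otimes> r))"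
    define b where "b = a(p := \<ominus> s)"
    have sK: "s \<in> K"
      unfolding s_def using a fK r Ks by (intro finsum_subring[OF subfieldE(1)[OF K]]) auto
    have bK: "\<forall>x\<in>X. b x \<in> K" using a sK Ks by (auto simp: b_def)
    have sum: "(\<Oplus>x\<in>X. b x \<otimes> f x j) = (\<Oplus>x\<in>X-{p}. a x \<otimes> g x j)" if j: "j = l \<or> j \<in> J" for j
    proof -
      have "(\<Oplus>x\<in>X. b x \<otimes> f x j) = b p \<otimes> f p j \<oplus> (\<Oplus>x\<in>X-{p}. b x \<otimes> f x j)"
        using p insert bK fK j KR by (intro finsum_remove) auto
      also have "(\<Oplus>x\<in>X-{p}. b x \<otimes> f x j) = (\<Oplus>x\<in>X-{p}. a x \<otimes> f x j)"
        using a fK j KR by (intro finsum_eq) (auto simp: b_def)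
      also have "b p \<otimes> f p j = \<ominus> (\<Oplus>x\<in>X-{p}. a x \<otimes> ((f x l \<otimes> r) \<otimes> f p j))"
      proof -
        have "s \<otimes> f p j = (\<Oplus>x\<in>X-{p}. a x \<otimes> (f x l \<otimes> r) \<otimes> f p j)"
          unfolding s_def using insert a fK r j KR p by (intro finsum_cmult) auto
        also have "\<dots> = (\<Oplus>x\<in>X-{p}. a x \<otimes> ((f x l \<otimes> r) \<otimes> f p j))"
          using insert a fK r j KR p by (intro finsum_eq) (auto simp: m_assoc)
        finally show ?thesis using sK fK p j KR by (simp add: b_def l_minus)
      qed
      also have "\<ominus> (\<Oplus>x\<in>X-{p}. a x \<otimes> ((f x l \<otimes> r) \<otimes> f p j)) \<oplus> (\<Oplus>x\<in>X-{p}. a x \<otimes> f x j)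
          = (\<Oplus>x\<in>X-{p}. a x \<otimes> f x j) \<ominus> (\<Oplus>x\<in>X-{p}. a x \<otimes> ((f x l \<otimes> r) \<otimes> f p j))"
        using insert a fK r j KR p by (simp add: a_minus_def a_comm Pi_def)
      also have "\<dots> = (\<Oplus>x\<in>X-{p}. a x \<otimes> f x j \<ominus> a x \<otimes> ((f x l \<otimes> r) \<otimes> f p j))"
        using insert a fK r j KR p by (subst finsum_minus) auto
      also have "\<dots> = (\<Oplus>x\<in>X-{p}. a x \<otimes> g x j)"
        using insert a fK r j KR p
        by (intro finsum_eq) (auto simp: g_def a_minus_def r_distr r_minus)
      finally show ?thesis .
    qed
    have "(\<Oplus>x\<in>X-{p}. a x \<otimes> g x l) = \<zero>"
    proof (intro finsum_zeroI)
      fix x assume x: "x \<in> X - {p}"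
      have "g x l = \<zero>"
        using x p fK r KR by (simp add: g_def m_assoc)
      then show "a x \<otimes> g x l = \<zero>" using a x KR by auto
    qed
    then have "\<forall>j\<in>insert l J. (\<Oplus>x\<in>X. b x \<otimes> f x j) = \<zero>" using sum a by auto
    moreover have "\<exists>x\<in>X. b x \<noteq> \<zero>" using a(2) by (auto simp: b_def)
    ultimately show ?thesis using bK by blast
  qed
qed

text \<open>A vector-valued equation counts for as many equations as the space has coordinates.\<close>

lemma underdetermined_vector_system:
  assumes K: "subfield K R" and b: "is_basis K E e I" "E \<subseteq> carrier R"
    and fin: "finite J" "finite X" and card: "card J * card I < card X"
    and f: "\<And>x j. x \<in> X \<Longrightarrow> j \<in> J \<Longrightarrow> f x j \<in> E"
  shows "\<exists>a. (\<forall>x\<in>X. a x \<in> K) \<and> (\<exists>x\<in>X. a x \<noteq> \<zero>) \<and> (\<forall>j\<in>J. (\<Oplus>x\<in>X. a x \<otimes> f x j) = \<zero>)"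
proof -
  note KR = subsetD[OF subfieldE(3)[OF K]]
  have I: "finite I" and eR: "\<And>i. i \<in> I \<Longrightarrow> e i \<in> carrier R"
    and "\<forall>y\<in>E. \<exists>c. (\<forall>i\<in>I. c i \<in> K) \<and> y = (\<Oplus>i\<in>I. c i \<otimes> e i)"
    using b unfolding is_basis_def by auto
  then obtain c where c: "\<And>y i. y \<in> E \<Longrightarrow> i \<in> I \<Longrightarrow> c y i \<in> K"
      "\<And>y. y \<in> E \<Longrightarrow> y = (\<Oplus>i\<in>I. c y i \<otimes> e i)"
    by metis
  have "\<exists>a. (\<forall>x\<in>X. a x \<in> K) \<and> (\<exists>x\<in>X. a x \<noteq> \<zero>) \<and>
      (\<forall>p\<in>J \<times> I. (\<Oplus>x\<in>X. a x \<otimes> c (f x (fst p)) (snd p)) = \<zero>)"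
    using fin I card c(1) f by (intro underdetermined_system[OF K]) (auto simp: card_cartesian_product)
  then obtain a where a: "\<forall>x\<in>X. a x \<in> K" "\<exists>x\<in>X. a x \<noteq> \<zero>"
      "\<forall>p\<in>J \<times> I. (\<Oplus>x\<in>X. a x \<otimes> c (f x (fst p)) (snd p)) = \<zero>"
    by blast
  have "(\<Oplus>x\<in>X. a x \<otimes> f x j) = \<zero>" if j: "j \<in> J" for j
  proof -
    have "(\<Oplus>x\<in>X. a x \<otimes> f x j) = (\<Oplus>x\<in>X. \<Oplus>i\<in>I. (a x \<otimes> c (f x j) i) \<otimes> e i)"
    proof (intro finsum_eq)
      fix x assume x: "x \<in> X"
      have "a x \<otimes> f x j = a x \<otimes> (\<Oplus>i\<in>I. c (f x j) i \<otimes> e i)"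
        using c(2)[OF f[OF x j]] by simp
      also have "\<dots> = (\<Oplus>i\<in>I. a x \<otimes> (c (f x j) i \<otimes> e i))"
        using a x c f j eR KR I by (intro finsum_cmult) auto
      also have "\<dots> = (\<Oplus>i\<in>I. a x \<otimes> c (f x j) i \<otimes> e i)"
        using a x c f j eR KR I by (intro finsum_eq) (auto simp: m_assoc)
      finally show "a x \<otimes> f x j = \<dots>" .
    qed
    also have "\<dots> = (\<Oplus>i\<in>I. \<Oplus>x\<in>X. (a x \<otimes> c (f x j) i) \<otimes> e i)"
      using a c f j eR KR I fin by (intro finsum_swap) auto
    also have "\<dots> = (\<Oplus>i\<in>I. (\<Oplus>x\<in>X. a x \<otimes> c (f x j) i) \<otimes> e i)"
      using a c f j eR KR I fin by (intro finsum_eq finsum_cmult(2)[symmetric]) (auto intro!: finsum_closed)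
    also have "\<dots> = \<zero>" using a(3) j eR by (intro finsum_zeroI) auto
    finally show ?thesis .
  qed
  with a show ?thesis by blast
qed

lemma basis_card_le:
  assumes K: "subfield K R" and E: "E \<subseteq> carrier R"
    and e: "is_basis K E e I" and f: "is_basis K E f J"
  shows "card J \<le> card I"
proof (rule ccontr)
  assume "\<not> card J \<le> card I"
  then have "\<exists>a. (\<forall>x\<in>J. a x \<in> K) \<and> (\<exists>x\<in>J. a x \<noteq> \<zero>) \<and> (\<forall>j\<in>{()}. (\<Oplus>x\<in>J. a x \<otimes> f x) = \<zero>)"
    using f by (intro underdetermined_vector_system[OF K e E]) (auto simp: is_basis_def)
  then show False using f unfolding is_basis_def lin_indep_def by blast
qed

end

section \<open>The double centralizer of a maximal subfield\<close>

lemma (in ring) commutator_zero_imp_commute: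
  "\<lbrakk> a \<in> carrier R; b \<in> carrier R; a \<otimes> b \<ominus> b \<otimes> a = \<zero> \<rbrakk> \<Longrightarrow> a \<otimes> b = b \<otimes> a"
  using minus_eq_zero_iff by auto

locale central_simple = ring R for R (structure) +
  fixes K :: "'a set"
  assumes subfield_K: "subfield K R"
    and center: "centralizer R (carrier R) = K"
    and simple: "ideal I R \<Longrightarrow> I = {\<zero>} \<or> I = carrier R"
begin

lemma K_carrier: "k \<in> K \<Longrightarrow> k \<in> carrier R"
  using subfieldE(3)[OF subfield_K] by auto

lemma K_comm: "\<lbrakk> k \<in> K; x \<in> carrier R \<rbrakk> \<Longrightarrow> k \<otimes> x = x \<otimes> k"
  using center unfolding centralizer_def by auto

lemma K_I: "\<lbrakk> k \<in> carrier R; \<And>x. x \<in> carrier R \<Longrightarrow> k \<otimes> x = x \<otimes> k \<rbrakk> \<Longrightarrow> k \<in> K"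
  using center unfolding centralizer_def by auto

text \<open>
  The entries at a fixed place of all such relations form a two-sided ideal. If it is nonzero, some
  relation has entry \<open>\<one>\<close> there; its commutators with ring elements are shorter relations, so they
  vanish, its entries are central, and at \<open>x = \<one>\<close> it is a linear relation between the \<open>\<mu> j\<close>.
\<close>

lemma sandwich_sum_zero_imp_zero:
  assumes "finite J" "\<And>j. j \<in> J \<Longrightarrow> \<mu> j \<in> carrier R" "lin_indep K \<mu> J"
    and "\<And>j. j \<in> J \<Longrightarrow> a j \<in> carrier R"
    and "\<And>x. x \<in> carrier R \<Longrightarrow> (\<Oplus>j\<in>J. \<mu> j \<otimes> x \<otimes> a j) = \<zero>"
    and "j \<in> J"
  shows "a j = \<zero>"
  using assms
proof (induct J arbitrary: a j)
  case (insert s J)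
  note \<mu> = insert(4)
  define rel where "rel d \<longleftrightarrow> (\<forall>j\<in>insert s J. d j \<in> carrier R) \<and>
      (\<forall>x\<in>carrier R. (\<Oplus>j\<in>insert s J. \<mu> j \<otimes> x \<otimes> d j) = \<zero>)" for d
  have rel_carrier: "d j \<in> carrier R" if "rel d" "j \<in> insert s J" for d j
    using that unfolding rel_def by blast
  have relI: "rel d" if "\<And>j. j \<in> insert s J \<Longrightarrow> d j \<in> carrier R"
      "\<And>x. x \<in> carrier R \<Longrightarrow> (\<Oplus>j\<in>insert s J. \<mu> j \<otimes> x \<otimes> d j) = \<zero>" for d
    unfolding rel_def using that by blast
  have rel_sum: "(\<Oplus>j\<in>insert s J. \<mu> j \<otimes> x \<otimes> d j) = \<zero>" if "rel d" "x \<in> carrier R" for d x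
    using that unfolding rel_def by blast
  have indep: "lin_indep K \<mu> J"
    unfolding lin_indep_def
  proof (intro allI impI)
    fix c assume c: "\<forall>i\<in>J. c i \<in> K" "(\<Oplus>i\<in>J. c i \<otimes> \<mu> i) = \<zero>"
    have "(\<Oplus>i\<in>insert s J. (c(s := \<zero>)) i \<otimes> \<mu> i) = (c(s := \<zero>)) s \<otimes> \<mu> s \<oplus> (\<Oplus>i\<in>J. (c(s := \<zero>)) i \<otimes> \<mu> i)"
      using insert c K_carrier by (intro finsum_insert) auto
    also have "(\<Oplus>i\<in>J. (c(s := \<zero>)) i \<otimes> \<mu> i) = (\<Oplus>i\<in>J. c i \<otimes> \<mu> i)"
      using insert c K_carrier by (intro finsum_eq) auto
    finally have "(\<Oplus>i\<in>insert s J. (c(s := \<zero>)) i \<otimes> \<mu> i) = \<zero>"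
      using c \<mu> by simp
    moreover have "\<forall>i\<in>insert s J. (c(s := \<zero>)) i \<in> K"
      using c subringE(2)[OF subfieldE(1)[OF subfield_K]] by auto
    ultimately have "\<forall>i\<in>insert s J. (c(s := \<zero>)) i = \<zero>"
      using insert(5) unfolding lin_indep_def by blast
    then show "\<forall>i\<in>J. c i = \<zero>" using insert(2) by (auto split: if_splits)
  qed
  have short: "d j = \<zero>" if "rel d" "d s = \<zero>" "j \<in> J" for d j
  proof (rule insert(3)[OF _ indep])
    fix x assume x: "x \<in> carrier R"
    have "(\<Oplus>j\<in>insert s J. \<mu> j \<otimes> x \<otimes> d j) = \<mu> s \<otimes> x \<otimes> d s \<oplus> (\<Oplus>j\<in>J. \<mu> j \<otimes> x \<otimes> d j)"
      using insert \<mu> x rel_carrier[OF that(1)] by (intro finsum_insert) auto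
    then show "(\<Oplus>j\<in>J. \<mu> j \<otimes> x \<otimes> d j) = \<zero>"
      using that x \<mu> rel_carrier[OF that(1)] rel_sum[OF that(1) x] by (simp add: Pi_def)
  qed (use \<mu> rel_carrier[OF that(1)] that in auto)
  have rel_add: "rel (\<lambda>j. d j \<oplus> d' j)" if "rel d" "rel d'" for d d'
  proof (rule relI)
    fix x assume x: "x \<in> carrier R"
    have "(\<Oplus>j\<in>insert s J. \<mu> j \<otimes> x \<otimes> (d j \<oplus> d' j))
      = (\<Oplus>j\<in>insert s J. \<mu> j \<otimes> x \<otimes> d j \<oplus> \<mu> j \<otimes> x \<otimes> d' j)"
      using x \<mu> rel_carrier that by (intro finsum_eq) (auto simp: r_distr)
    also have "\<dots> = (\<Oplus>j\<in>insert s J. \<mu> j \<otimes> x \<otimes> d j) \<oplus> (\<Oplus>j\<in>insert s J. \<mu> j \<otimes> x \<otimes> d' j)"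
      using x \<mu> rel_carrier that by (intro finsum_addf) auto
    also have "\<dots> = \<zero>" using rel_sum x that by simp
    finally show "(\<Oplus>j\<in>insert s J. \<mu> j \<otimes> x \<otimes> (d j \<oplus> d' j)) = \<zero>" .
  qed (use that rel_carrier in auto)
  have rel_mult: "rel (\<lambda>j. b \<otimes> d j)" "rel (\<lambda>j. d j \<otimes> b)" if "rel d" "b \<in> carrier R" for d b
  proof -
    have "(\<Oplus>j\<in>insert s J. \<mu> j \<otimes> x \<otimes> (b \<otimes> d j)) = \<zero>" if x: "x \<in> carrier R" for x
    proof -
      have "(\<Oplus>j\<in>insert s J. \<mu> j \<otimes> x \<otimes> (b \<otimes> d j)) = (\<Oplus>j\<in>insert s J. \<mu> j \<otimes> (x \<otimes> b) \<otimes> d j)"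
        using x \<mu> rel_carrier \<open>rel d\<close> \<open>b \<in> _\<close> by (intro finsum_eq) (auto simp: m_assoc)
      then show ?thesis using rel_sum[OF \<open>rel d\<close>, of "x \<otimes> b"] \<open>b \<in> _\<close> x by simp
    qed
    then show "rel (\<lambda>j. b \<otimes> d j)" using rel_carrier[OF that(1)] that(2) by (intro relI) blast+
    have "(\<Oplus>j\<in>insert s J. \<mu> j \<otimes> x \<otimes> (d j \<otimes> b)) = \<zero>" if x: "x \<in> carrier R" for x
    proof -
      have "(\<Oplus>j\<in>insert s J. \<mu> j \<otimes> x \<otimes> (d j \<otimes> b)) = (\<Oplus>j\<in>insert s J. \<mu> j \<otimes> x \<otimes> d j \<otimes> b)"
        using x \<mu> rel_carrier \<open>rel d\<close> \<open>b \<in> _\<close> by (intro finsum_eq) (auto simp: m_assoc)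
      also have "\<dots> = (\<Oplus>j\<in>insert s J. \<mu> j \<otimes> x \<otimes> d j) \<otimes> b"
        using x \<mu> rel_carrier \<open>rel d\<close> \<open>b \<in> _\<close> insert(1) by (intro finsum_cmult[symmetric]) auto
      finally show ?thesis using rel_sum[OF \<open>rel d\<close> x] \<open>b \<in> _\<close> by simp
    qed
    then show "rel (\<lambda>j. d j \<otimes> b)" using rel_carrier[OF that(1)] that(2) by (intro relI) blast+
  qed
  have rel_uminus: "rel (\<lambda>j. (\<ominus> \<one>) \<otimes> d j)" if "rel d" for d
    using rel_mult(1)[OF that, of "\<ominus> \<one>"] by auto
  have rel_a: "rel a" using insert(6,7) by (intro relI) blast+
  have "a s = \<zero>"
  proof (rule ccontr)
    assume nz: "a s \<noteq> \<zero>"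
    let ?I = "(\<lambda>d. d s) ` Collect rel"
    have "ideal ?I R"
    proof (rule idealI[OF ring_axioms])
      show "subgroup ?I (add_monoid R)"
      proof (rule add.subgroupI)
        show "?I \<subseteq> carrier R" using rel_carrier by auto
        show "?I \<noteq> {}" using rel_a by auto
        fix y assume "y \<in> ?I"
        then obtain d where d: "rel d" "y = d s" by auto
        then have "\<ominus> y = (\<ominus> \<one>) \<otimes> d s" using rel_carrier[OF d(1)] by (simp add: l_minus)
        with rel_uminus[OF d(1)] show "\<ominus> y \<in> ?I" by (metis (mono_tags, lifting) image_eqI mem_Collect_eq)
      next
        fix y z assume "y \<in> ?I" "z \<in> ?I"
        then obtain d d' where "rel d" "y = d s" "rel d'" "z = d' s" by auto
        with rel_add[of d d'] show "y \<oplus> z \<in> ?I" by (metis (mono_tags, lifting) image_eqI mem_Collect_eq)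
      qed
    next
      fix y b assume "y \<in> ?I" and b: "b \<in> carrier R"
      then obtain d where d: "rel d" "y = d s" by auto
      show "b \<otimes> y \<in> ?I" using rel_mult(1)[OF d(1) b] d(2) by (metis (mono_tags, lifting) image_eqI mem_Collect_eq)
      show "y \<otimes> b \<in> ?I" using rel_mult(2)[OF d(1) b] d(2) by (metis (mono_tags, lifting) image_eqI mem_Collect_eq)
    qed
    from simple[OF this] nz rel_a have "\<one> \<in> ?I" by auto
    then obtain d where d: "rel d" "d s = \<one>" by auto
    have central: "d j \<in> K" if j: "j \<in> insert s J" for j
    proof (rule K_I)
      show "d j \<in> carrier R" using rel_carrier d j by auto
      fix b assume b: "b \<in> carrier R"
      let ?d = "\<lambda>j. b \<otimes> d j \<oplus> (\<ominus> \<one>) \<otimes> (d j \<otimes> b)"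
      have "rel ?d" by (intro rel_add rel_uminus rel_mult d b)
      moreover have "?d s = \<zero>" using d b by (simp add: l_minus r_neg)
      ultimately have "?d j = \<zero>" using short[of ?d j] j by auto
      then have "b \<otimes> d j \<ominus> d j \<otimes> b = \<zero>"
        using b rel_carrier[OF d(1) j] by (simp add: l_minus a_minus_def)
      then show "d j \<otimes> b = b \<otimes> d j"
        using b rel_carrier[OF d(1) j] commutator_zero_imp_commute[of b "d j"] by simp
    qed
    have "(\<Oplus>j\<in>insert s J. d j \<otimes> \<mu> j) = (\<Oplus>j\<in>insert s J. \<mu> j \<otimes> \<one> \<otimes> d j)"
      using central K_comm \<mu> rel_carrier[OF d(1)] by (intro finsum_eq) auto
    also have "\<dots> = \<zero>" using rel_sum[OF d(1) one_closed] .
    finally have "d s = \<zero>" using insert(5) central unfolding lin_indep_def by blast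
    with d(2) subfieldE(6)[OF subfield_K] show False by simp
  qed
  with short[OF rel_a] insert(8) show ?case by auto
qed simp

end

locale central_simple_with_subfield = central_simple R K for R (structure) and K +
  fixes M :: "'a set" and n :: nat
  assumes dim_R: "dimension (n\<^sup>2) K (carrier R)"
    and subfield_M: "subfield M R" and K_M: "K \<subseteq> M" and dim_M: "dimension n K M"
begin

lemma M_carrier [simp, intro]: "m \<in> M \<Longrightarrow> m \<in> carrier R"
  using subfieldE(3)[OF subfield_M] by auto

lemmas M_subring = subfieldE(1)[OF subfield_M]

lemma M_closed [simp, intro]:
  "\<zero> \<in> M" "\<one> \<in> M" "\<lbrakk> x \<in> M; y \<in> M \<rbrakk> \<Longrightarrow> x \<otimes> y \<in> M" "\<lbrakk> x \<in> M; y \<in> M \<rbrakk> \<Longrightarrow> x \<oplus> y \<in> M"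
  "x \<in> M \<Longrightarrow> \<ominus> x \<in> M" "\<lbrakk> x \<in> M; y \<in> M \<rbrakk> \<Longrightarrow> x \<ominus> y \<in> M"
  using subringE[OF M_subring] by (auto simp: a_minus_def)

lemma M_comm: "\<lbrakk> x \<in> M; y \<in> M \<rbrakk> \<Longrightarrow> x \<otimes> y = y \<otimes> x"
  using subfieldE(4)[OF subfield_M] .

lemma M_inv:
  assumes "x \<in> M" "x \<noteq> \<zero>" shows "inv x \<in> M" "x \<otimes> inv x = \<one>" "inv x \<otimes> x = \<one>" "x \<in> Units R"
proof -
  show *: "inv x \<in> M" "x \<otimes> inv x = \<one>" "inv x \<otimes> x = \<one>"
    using subfield_m_inv[OF subfield_M, of x] assms by auto
  with assms show "x \<in> Units R" unfolding Units_def by auto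
qed

lemma one_not_zero: "\<one> \<noteq> \<zero>" using subfieldE(6)[OF subfield_M] .

lemma n_pos: "n > 0"
proof (rule ccontr)
  assume "\<not> n > 0"
  then have "M = {\<zero>}" using dimension_zero[OF subfield_K] dim_M by auto
  then show False using one_not_zero M_closed(2) by auto
qed

lemma dim_R_over_M: "dimension n M (carrier R)"
proof -
  obtain m where m: "dimension m M (carrier R)"
    using finite_dimension_larger_field[OF subfield_K subfield_M K_M dim_R] by auto
  have "n * m = n\<^sup>2"
    using dimension_is_inj[OF subfield_K telescopic_base[OF subfield_K subfield_M dim_M m] dim_R] .
  then have "m = n" using n_pos by (simp add: power2_eq_square)
  with m show ?thesis by simp
qed

abbreviation sandwich :: "(nat \<Rightarrow> 'a) \<Rightarrow> (nat \<Rightarrow> 'a) \<Rightarrow> 'a \<Rightarrow> 'a" where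
  "sandwich \<mu> a x \<equiv> \<Oplus>i\<in>{..<n}. \<mu> i \<otimes> x \<otimes> a i"

text \<open>
  Sums \<open>x \<mapsto> \<Sum> \<mu> i \<cdot> x \<cdot> a i\<close> are \<open>M\<close>-linear in \<open>x\<close>. Prescribing the values on a basis of \<open>R\<close> over \<open>M\<close>
  takes as many equations over \<open>K\<close> as the family \<open>a\<close> has coordinates, and only \<open>a = 0\<close> gives the
  zero map, so every \<open>M\<close>-linear endomorphism of \<open>R\<close> has this form. Here it is the coordinate map of
  a basis vector \<open>e\<close>, whose values lie in \<open>M\<close>.
\<close>

lemma coordinate_as_sandwich_sum:
  obtains \<mu> a e where "is_basis K M \<mu> {..<n}" "\<And>i. i < n \<Longrightarrow> a i \<in> carrier R" "e \<in> carrier R"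
    "\<And>x. x \<in> carrier R \<Longrightarrow> sandwich \<mu> a x \<in> M"
    "sandwich \<mu> a e = \<one>"
proof -
  obtain \<mu> where \<mu>: "is_basis K M \<mu> {..<n}" using dimension_imp_basis[OF subfield_K dim_M] by auto
  obtain b where b: "is_basis K (carrier R) b {..<n\<^sup>2}" using dimension_imp_basis[OF subfield_K dim_R] by auto
  obtain e where e: "is_basis M (carrier R) e {..<n}" using dimension_imp_basis[OF subfield_M dim_R_over_M] by auto
  have \<mu>M: "i < n \<Longrightarrow> \<mu> i \<in> M" and bR: "p < n\<^sup>2 \<Longrightarrow> b p \<in> carrier R" and eR: "j < n \<Longrightarrow> e j \<in> carrier R" for i p j
    using \<mu> b e unfolding is_basis_def by auto
  \<comment> \<open>The unknowns are the coordinates of the \<open>a i\<close> and a scalar \<open>t\<close> (at \<open>None\<close>) in front of the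
    prescribed value at \<open>e 0\<close>, which makes the system homogeneous and underdetermined.\<close>
  define P where "P = {..<n} \<times> {..<n\<^sup>2}"
  define f where "f x j = (case x of None \<Rightarrow> (if j = 0 then \<ominus> \<one> else \<zero>)
       | Some (i, p) \<Rightarrow> \<mu> i \<otimes> e j \<otimes> b p)" for x j
  have finP: "finite P" by (simp add: P_def)
  have fR: "f x j \<in> carrier R" if "x \<in> insert None (Some ` P)" "j < n" for x j
    using that \<mu>M bR eR by (auto simp: f_def P_def)
  have "card (insert None (Some ` P)) = Suc (n * n\<^sup>2)"
    using finP by (subst card_insert_disjoint) (auto simp: card_image P_def card_cartesian_product)
  then have "card {..<n} * card {..<n\<^sup>2} < card (insert None (Some ` P))" by simp
  then obtain c where c: "\<forall>x\<in>insert None (Some ` P). c x \<in> K" "\<exists>x\<in>insert None (Some ` P). c x \<noteq> \<zero>"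
      "\<forall>j\<in>{..<n}. (\<Oplus>x\<in>insert None (Some ` P). c x \<otimes> f x j) = \<zero>"
    using underdetermined_vector_system[OF subfield_K b, of "{..<n}" "insert None (Some ` P)" f] fR finP by auto
  define t where "t = c None"
  define a where "a i = (\<Oplus>p\<in>{..<n\<^sup>2}. c (Some (i, p)) \<otimes> b p)" for i
  have tK: "t \<in> K" and cK: "i < n \<Longrightarrow> p < n\<^sup>2 \<Longrightarrow> c (Some (i, p)) \<in> K" for i p
    using c(1) by (auto simp: t_def P_def)
  note tR = K_carrier[OF tK] and cR = K_carrier[OF cK]
  have aR: "a i \<in> carrier R" if "i < n" for i
    using that cR bR unfolding a_def by (intro finsum_closed) auto
  define T where "T x = sandwich \<mu> a x" for x
  have TR: "T x \<in> carrier R" if "x \<in> carrier R" for x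
    using that \<mu>M aR unfolding T_def by (intro finsum_closed) auto
  have Te: "T (e j) = (if j = 0 then t else \<zero>)" if j: "j < n" for j
  proof -
    have "T (e j) = (\<Oplus>i\<in>{..<n}. \<Oplus>p\<in>{..<n\<^sup>2}. c (Some (i, p)) \<otimes> f (Some (i, p)) j)"
      unfolding T_def
    proof (intro finsum_eq)
      fix i assume i: "i \<in> {..<n}"
      have "\<mu> i \<otimes> e j \<otimes> a i = (\<Oplus>p\<in>{..<n\<^sup>2}. \<mu> i \<otimes> e j \<otimes> (c (Some (i, p)) \<otimes> b p))"
        unfolding a_def using i j \<mu>M bR eR cR by (intro finsum_cmult) auto
      also have "\<dots> = (\<Oplus>p\<in>{..<n\<^sup>2}. c (Some (i, p)) \<otimes> f (Some (i, p)) j)"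
      proof (intro finsum_eq)
        fix p assume p: "p \<in> {..<n\<^sup>2}"
        have "\<mu> i \<otimes> e j \<otimes> c (Some (i, p)) = c (Some (i, p)) \<otimes> (\<mu> i \<otimes> e j)"
          using p i j \<mu>M eR K_comm[OF cK[of i p], of "\<mu> i \<otimes> e j"] by auto
        then show "\<mu> i \<otimes> e j \<otimes> (c (Some (i, p)) \<otimes> b p) = c (Some (i, p)) \<otimes> f (Some (i, p)) j"
          using p i j \<mu>M bR eR cR by (simp add: f_def m_assoc[symmetric])
      qed
      finally show "\<mu> i \<otimes> e j \<otimes> a i = (\<Oplus>p\<in>{..<n\<^sup>2}. c (Some (i, p)) \<otimes> f (Some (i, p)) j)" .
    qed
    also have "\<dots> = (\<Oplus>x\<in>P. c (Some x) \<otimes> f (Some x) j)"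
    proof -
      have "(\<Oplus>x\<in>(\<Union>i\<in>{..<n}. Pair i ` {..<n\<^sup>2}). c (Some x) \<otimes> f (Some x) j)
        = (\<Oplus>i\<in>{..<n}. \<Oplus>x\<in>Pair i ` {..<n\<^sup>2}. c (Some x) \<otimes> f (Some x) j)"
        using j \<mu>M bR eR cR by (intro add.finprod_UN_disjoint) (auto simp: pairwise_def disjnt_def f_def)
      also have "\<dots> = (\<Oplus>i\<in>{..<n}. \<Oplus>p\<in>{..<n\<^sup>2}. c (Some (i, p)) \<otimes> f (Some (i, p)) j)"
        using j \<mu>M bR eR cR
        by (intro finsum_eq finsum_reindex finsum_closed) (auto simp: f_def inj_on_def)
      also have "(\<Union>i\<in>{..<n}. Pair i ` {..<n\<^sup>2}) = P" unfolding P_def by auto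
      finally show ?thesis by simp
    qed
    also have "\<dots> = (\<Oplus>x\<in>Some ` P. c x \<otimes> f x j)"
      using j \<mu>M bR eR cR by (subst finsum_reindex) (auto simp: f_def P_def)
    finally have T: "T (e j) = (\<Oplus>x\<in>Some ` P. c x \<otimes> f x j)" .
    have "\<zero> = (\<Oplus>x\<in>insert None (Some ` P). c x \<otimes> f x j)" using c(3) j by simp
    also have "\<dots> = c None \<otimes> f None j \<oplus> T (e j)"
      unfolding T using finP j \<mu>M bR eR cR tR
      by (intro finsum_insert) (auto simp: f_def P_def t_def)
    also have "\<dots> = T (e j) \<ominus> (if j = 0 then t else \<zero>)"
      using tR TR eR j by (auto simp: f_def t_def a_minus_def r_minus a_comm)
    finally show ?thesis using minus_eq_zero_iff[OF TR[OF eR[OF j]], of "if j = 0 then t else \<zero>"] tR by auto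
  qed
  have Tlin: "T x = m 0 \<otimes> t" if m: "\<And>j. j < n \<Longrightarrow> m j \<in> M" and x: "x = (\<Oplus>j\<in>{..<n}. m j \<otimes> e j)" for x m
  proof -
    have "T x = (\<Oplus>i\<in>{..<n}. \<Oplus>j\<in>{..<n}. m j \<otimes> (\<mu> i \<otimes> e j \<otimes> a i))"
      unfolding T_def
    proof (intro finsum_eq)
      fix i assume i: "i \<in> {..<n}"
      have "\<mu> i \<otimes> x = (\<Oplus>j\<in>{..<n}. \<mu> i \<otimes> (m j \<otimes> e j))"
        unfolding x using i m \<mu>M eR by (intro finsum_cmult) auto
      also have "\<dots> \<otimes> a i = (\<Oplus>j\<in>{..<n}. \<mu> i \<otimes> (m j \<otimes> e j) \<otimes> a i)"
        using i m \<mu>M eR aR by (intro finsum_cmult) auto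
      also have "\<dots> = (\<Oplus>j\<in>{..<n}. m j \<otimes> (\<mu> i \<otimes> e j \<otimes> a i))"
      proof (intro finsum_eq)
        fix j assume j: "j \<in> {..<n}"
        have "\<mu> i \<otimes> m j = m j \<otimes> \<mu> i" using i j m \<mu>M M_comm by auto
        then have "\<mu> i \<otimes> m j \<otimes> e j \<otimes> a i = m j \<otimes> \<mu> i \<otimes> e j \<otimes> a i" by simp
        then show "\<mu> i \<otimes> (m j \<otimes> e j) \<otimes> a i = m j \<otimes> (\<mu> i \<otimes> e j \<otimes> a i)"
          using i j m \<mu>M eR aR by (simp add: m_assoc)
      qed
      finally show "\<mu> i \<otimes> x \<otimes> a i = (\<Oplus>j\<in>{..<n}. m j \<otimes> (\<mu> i \<otimes> e j \<otimes> a i))" .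
    qed
    also have "\<dots> = (\<Oplus>j\<in>{..<n}. \<Oplus>i\<in>{..<n}. m j \<otimes> (\<mu> i \<otimes> e j \<otimes> a i))"
      using m \<mu>M eR aR by (intro finsum_swap) auto
    also have "\<dots> = (\<Oplus>j\<in>{..<n}. m j \<otimes> T (e j))"
      unfolding T_def using m \<mu>M eR aR
      by (intro finsum_eq finsum_cmult[symmetric]) (auto intro!: finsum_closed)
    also have "\<dots> = (\<Oplus>j\<in>{..<n}. if j = 0 then m j \<otimes> t else \<zero>)"
      using Te m tR by (intro finsum_eq) auto
    also have "\<dots> = m 0 \<otimes> t" using n_pos m tR by (intro finsum_delta) auto
    finally show ?thesis .
  qed
  have coords: "\<exists>m. (\<forall>j<n. m j \<in> M) \<and> x = (\<Oplus>j\<in>{..<n}. m j \<otimes> e j)" if "x \<in> carrier R" for x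
    using basis_coords[OF e that] by (simp only: Ball_def lessThan_iff)
  have t0: "t \<noteq> \<zero>"
  proof
    assume t: "t = \<zero>"
    have "T x = \<zero>" if "x \<in> carrier R" for x
      using coords[OF that] Tlin n_pos t by auto
    then have "a i = \<zero>" if "i < n" for i
      using that aR \<mu>M \<mu> unfolding T_def is_basis_def
      by (intro sandwich_sum_zero_imp_zero[of "{..<n}" \<mu> a i]) auto
    then have "c (Some (i, p)) = \<zero>" if "i < n" "p < n\<^sup>2" for i p
    proof -
      have "(\<Oplus>p\<in>{..<n\<^sup>2}. c (Some (i, p)) \<otimes> b p) = \<zero>"
        using \<open>\<And>i. i < n \<Longrightarrow> a i = \<zero>\<close>[OF that(1)] by (simp add: a_def)
      moreover have "\<forall>p\<in>{..<n\<^sup>2}. c (Some (i, p)) \<in> K" using cK that by auto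
      moreover have "lin_indep K b {..<n\<^sup>2}" using b unfolding is_basis_def by simp
      ultimately show ?thesis using that lin_indepD[of K b "{..<n\<^sup>2}" "\<lambda>p. c (Some (i, p))" p] by simp
    qed
    with t c(2) show False by (auto simp: t_def P_def)
  qed
  obtain t' where t': "t' \<in> K" "t \<otimes> t' = \<one>"
    using subfield_m_inv[OF subfield_K, of t] tK t0 by auto
  note t'R = K_carrier[OF t'(1)]
  have T': "sandwich \<mu> (\<lambda>i. a i \<otimes> t') x = T x \<otimes> t'" if x: "x \<in> carrier R" for x
  proof -
    have "T x \<otimes> t' = (\<Oplus>i\<in>{..<n}. \<mu> i \<otimes> x \<otimes> a i \<otimes> t')"
      unfolding T_def using x \<mu>M aR t'R by (intro finsum_cmult) auto
    also have "\<dots> = sandwich \<mu> (\<lambda>i. a i \<otimes> t') x"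
      using x \<mu>M aR t'R by (intro finsum_eq) (auto simp: m_assoc)
    finally show ?thesis by simp
  qed
  show thesis
  proof (rule that[of \<mu> "\<lambda>i. a i \<otimes> t'" "e 0"])
    show "sandwich \<mu> (\<lambda>i. a i \<otimes> t') x \<in> M" if x: "x \<in> carrier R" for x
      using coords[OF x] Tlin T'[OF x] n_pos tR t'R t' by (auto simp: m_assoc)
    show "sandwich \<mu> (\<lambda>i. a i \<otimes> t') (e 0) = \<one>"
      using T'[OF eR] Te n_pos t' by auto
  qed (use \<mu> aR eR t'R n_pos in auto)
qed

end

section \<open>Automorphism groups\<close>

lemma aut_groupD:
  assumes "f \<in> carrier (aut_group R K L)"
  shows "f \<in> Bij L" "bij_betw f L L" "f \<in> extensional L" "\<And>x. x \<in> L \<Longrightarrow> f x \<in> L"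
    "\<And>x y. \<lbrakk> x \<in> L; y \<in> L \<rbrakk> \<Longrightarrow> f (x \<otimes>\<^bsub>R\<^esub> y) = f x \<otimes>\<^bsub>R\<^esub> f y"
    "\<And>x y. \<lbrakk> x \<in> L; y \<in> L \<rbrakk> \<Longrightarrow> f (x \<oplus>\<^bsub>R\<^esub> y) = f x \<oplus>\<^bsub>R\<^esub> f y"
    "f \<one>\<^bsub>R\<^esub> = \<one>\<^bsub>R\<^esub>" "\<And>x. x \<in> K \<Longrightarrow> f x = x"
    "\<And>x y. \<lbrakk> x \<in> L; y \<in> L; f x = f y \<rbrakk> \<Longrightarrow> x = y"
proof -
  have f: "f \<in> Bij L" "f \<in> ring_iso (R\<lparr>carrier := L\<rparr>) (R\<lparr>carrier := L\<rparr>)" "\<And>x. x \<in> K \<Longrightarrow> f x = x"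
    using assms unfolding aut_group_def by auto
  then show "f \<in> Bij L" "\<And>x. x \<in> K \<Longrightarrow> f x = x" by auto
  show b: "bij_betw f L L" and "f \<in> extensional L" using f(1) unfolding Bij_def by auto
  show "\<And>x. x \<in> L \<Longrightarrow> f x \<in> L" using b by (auto simp: bij_betw_def)
  show "\<And>x y. \<lbrakk> x \<in> L; y \<in> L; f x = f y \<rbrakk> \<Longrightarrow> x = y" using b by (auto simp: bij_betw_def inj_on_def)
  have h: "f \<in> ring_hom (R\<lparr>carrier := L\<rparr>) (R\<lparr>carrier := L\<rparr>)" using f(2) by (simp add: ring_iso_def)
  show "\<And>x y. \<lbrakk> x \<in> L; y \<in> L \<rbrakk> \<Longrightarrow> f (x \<otimes>\<^bsub>R\<^esub> y) = f x \<otimes>\<^bsub>R\<^esub> f y"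
    "\<And>x y. \<lbrakk> x \<in> L; y \<in> L \<rbrakk> \<Longrightarrow> f (x \<oplus>\<^bsub>R\<^esub> y) = f x \<oplus>\<^bsub>R\<^esub> f y"
    "f \<one>\<^bsub>R\<^esub> = \<one>\<^bsub>R\<^esub>"
    using ring_hom_memE[OF h] by auto
qed

lemma aut_groupI:
  assumes "f \<in> extensional L" "bij_betw f L L"
    "\<And>x y. \<lbrakk> x \<in> L; y \<in> L \<rbrakk> \<Longrightarrow> f (x \<otimes>\<^bsub>R\<^esub> y) = f x \<otimes>\<^bsub>R\<^esub> f y"
    "\<And>x y. \<lbrakk> x \<in> L; y \<in> L \<rbrakk> \<Longrightarrow> f (x \<oplus>\<^bsub>R\<^esub> y) = f x \<oplus>\<^bsub>R\<^esub> f y"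
    "f \<one>\<^bsub>R\<^esub> = \<one>\<^bsub>R\<^esub>" "\<And>x. x \<in> K \<Longrightarrow> f x = x"
  shows "f \<in> carrier (aut_group R K L)"
proof -
  have "f \<in> ring_hom (R\<lparr>carrier := L\<rparr>) (R\<lparr>carrier := L\<rparr>)"
    using assms by (intro ring_hom_memI) (auto simp: bij_betw_def)
  then show ?thesis using assms unfolding aut_group_def ring_iso_def Bij_def by auto
qed

lemma aut_group_mult:
  assumes "f \<in> carrier (aut_group R K L)" "g \<in> carrier (aut_group R K L)"
  shows "f \<otimes>\<^bsub>aut_group R K L\<^esub> g = compose L f g"
  using aut_groupD(1)[OF assms(1)] aut_groupD(1)[OF assms(2)]
  by (simp add: aut_group_def BijGroup_def)

lemma aut_group_one: "\<one>\<^bsub>aut_group R K L\<^esub> = (\<lambda>x\<in>L. x)"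
  by (simp add: aut_group_def BijGroup_def)

lemma (in ring) group_aut_group:
  assumes L: "subring L R" and K: "K \<subseteq> L"
  shows "group (aut_group R K L)"
proof -
  interpret B: group "BijGroup L" by (rule group_BijGroup)
  note Lc = subringE(3,6,7)[OF L]
  have "subgroup (carrier (aut_group R K L)) (BijGroup L)"
  proof (rule B.subgroupI)
    show "carrier (aut_group R K L) \<subseteq> carrier (BijGroup L)"
      by (auto simp: aut_group_def BijGroup_def)
    have "(\<lambda>x\<in>L. x) \<in> carrier (aut_group R K L)"
      using Lc K id_Bij[of L] by (intro aut_groupI) (auto simp: Bij_def)
    then show "carrier (aut_group R K L) \<noteq> {}" by blast
  next
    fix f assume "f \<in> carrier (aut_group R K L)"
    note f = aut_groupD[OF this]
    let ?g = "\<lambda>x\<in>L. inv_into L f x"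
    have g: "?g x = x" if "x \<in> L" "f x = x" for x
      using f(2) that inv_into_f_f[of f L x] by (simp add: bij_betw_def)
    have "?g \<in> carrier (aut_group R K L)"
    proof (rule aut_groupI)
      fix x y assume xy: "x \<in> L" "y \<in> L"
      have "inv_into L f (x \<otimes> y) = inv_into L f x \<otimes> inv_into L f y"
        using Lc(2) by (intro Bij_inv_into_lemma[where g = "(\<otimes>)"] f xy) auto
      moreover have "inv_into L f (x \<oplus> y) = inv_into L f x \<oplus> inv_into L f y"
        using Lc(3) by (intro Bij_inv_into_lemma[where g = "(\<oplus>)"] f xy) auto
      ultimately show "?g (x \<otimes> y) = ?g x \<otimes> ?g y" "?g (x \<oplus> y) = ?g x \<oplus> ?g y" using xy Lc by auto
    qed (use restrict_inv_into_Bij[OF f(1)] g Lc K f(7,8) in \<open>auto simp: Bij_def\<close>)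
    then show "inv\<^bsub>BijGroup L\<^esub> f \<in> carrier (aut_group R K L)" by (simp only: inv_BijGroup[OF f(1)])
  next
    fix f g assume fg: "f \<in> carrier (aut_group R K L)" "g \<in> carrier (aut_group R K L)"
    note f = aut_groupD[OF fg(1)] and g = aut_groupD[OF fg(2)]
    have c: "compose L f g x = f (g x)" if "x \<in> L" for x using that by (simp add: compose_def)
    have "compose L f g \<in> carrier (aut_group R K L)"
    proof (rule aut_groupI)
      show "compose L f g \<in> extensional L" "bij_betw (compose L f g) L L"
        using compose_Bij[OF f(1) g(1)] by (auto simp: Bij_def)
    qed (use f(4-8) g(4-8) c Lc K in \<open>simp_all add: subset_iff\<close>)
    then show "f \<otimes>\<^bsub>BijGroup L\<^esub> g \<in> carrier (aut_group R K L)"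
      using f(1) g(1) by (simp add: BijGroup_def)
  qed
  from B.subgroup_imp_group[OF this] show ?thesis by (simp add: aut_group_def)
qed

context central_simple_with_subfield
begin

abbreviation "Gal \<equiv> aut_group R K M"
abbreviation Gal_mult (infixl \<open>\<star>\<close> 70) where "\<sigma> \<star> \<tau> \<equiv> \<sigma> \<otimes>\<^bsub>Gal\<^esub> \<tau>"
abbreviation Gal_inv (\<open>inv\<^sub>G _\<close> [81] 80) where "inv\<^sub>G \<sigma> \<equiv> inv\<^bsub>Gal\<^esub> \<sigma>"
abbreviation Gal_pow (infixr \<open>[^]\<^sub>G\<close> 75) where "\<sigma> [^]\<^sub>G (k::nat) \<equiv> \<sigma> [^]\<^bsub>Gal\<^esub> k"
abbreviation Gal_one (\<open>\<one>\<^sub>G\<close>) where "\<one>\<^sub>G \<equiv> \<one>\<^bsub>Gal\<^esub>"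

lemma group_Gal: "group Gal"
  using group_aut_group[OF M_subring K_M] .

lemma Gal_closed [simp, intro]: "\<lbrakk> \<sigma> \<in> carrier Gal; m \<in> M \<rbrakk> \<Longrightarrow> \<sigma> m \<in> M"
  using aut_groupD(4) by metis

lemma Gal_eqI:
  assumes "\<sigma> \<in> carrier Gal" "\<tau> \<in> carrier Gal" "\<And>m. m \<in> M \<Longrightarrow> \<sigma> m = \<tau> m"
  shows "\<sigma> = \<tau>"
  using assms aut_groupD(3) extensionalityI by metis

lemma distinct_Gal:
  "\<lbrakk> \<sigma> \<in> carrier Gal; \<tau> \<in> carrier Gal; \<sigma> \<noteq> \<tau> \<rbrakk> \<Longrightarrow> \<exists>m\<in>M. \<sigma> m \<noteq> \<tau> m"
  using Gal_eqI by blast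

lemma Gal_mult_closed [simp, intro]:
  "\<lbrakk> \<sigma> \<in> carrier Gal; \<tau> \<in> carrier Gal \<rbrakk> \<Longrightarrow> \<sigma> \<star> \<tau> \<in> carrier Gal"
  "\<sigma> \<in> carrier Gal \<Longrightarrow> inv\<^sub>G \<sigma> \<in> carrier Gal" "\<one>\<^sub>G \<in> carrier Gal"
  using group.inv_closed[OF group_Gal] monoid.m_closed[OF group.is_monoid[OF group_Gal]]
    monoid.one_closed[OF group.is_monoid[OF group_Gal]] by auto

lemma Gal_mult_apply:
  "\<lbrakk> \<sigma> \<in> carrier Gal; \<tau> \<in> carrier Gal; m \<in> M \<rbrakk> \<Longrightarrow> (\<sigma> \<star> \<tau>) m = \<sigma> (\<tau> m)"
  by (simp add: aut_group_mult compose_def)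

lemma Gal_one_apply: "m \<in> M \<Longrightarrow> \<one>\<^sub>G m = m"
  by (simp add: aut_group_one)

lemma Gal_inv_apply:
  assumes "\<sigma> \<in> carrier Gal" "m \<in> M"
  shows "(inv\<^sub>G \<sigma>) (\<sigma> m) = m" "\<sigma> ((inv\<^sub>G \<sigma>) m) = m"
  using Gal_mult_apply[of "inv\<^sub>G \<sigma>" \<sigma> m] Gal_mult_apply[of \<sigma> "inv\<^sub>G \<sigma>" m]
    group.l_inv[OF group_Gal assms(1)] group.r_inv[OF group_Gal assms(1)] assms Gal_one_apply
  by auto

lemma Gal_zero: "\<sigma> \<in> carrier Gal \<Longrightarrow> \<sigma> \<zero> = \<zero>"
  using aut_groupD(8)[of \<sigma> R K M \<zero>] subringE(2)[OF subfieldE(1)[OF subfield_K]] by auto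

lemma Gal_finsum:
  assumes "\<sigma> \<in> carrier Gal" "\<And>i. i \<in> I \<Longrightarrow> f i \<in> M"
  shows "\<sigma> (\<Oplus>i\<in>I. f i) = (\<Oplus>i\<in>I. \<sigma> (f i))"
  using assms(2)
proof (induct I rule: infinite_finite_induct)
  case (insert x I)
  have "(\<Oplus>i\<in>I. f i) \<in> M" using insert by (intro finsum_subring[OF M_subring]) auto
  then show ?case using insert assms(1) aut_groupD(6)[OF assms(1)] by (simp add: Pi_def)
qed (use Gal_zero[OF assms(1)] in auto)

section \<open>Invertible elements inducing a given automorphism\<close>

text \<open>The units among these elements are those whose conjugation induces \<open>\<sigma>\<close> on \<open>M\<close>.\<close>

definition twist :: "('a \<Rightarrow> 'a) \<Rightarrow> 'a set" where
  "twist \<sigma> = {v \<in> carrier R. \<forall>m\<in>M. v \<otimes> m = \<sigma> m \<otimes> v}"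

lemma twistD: "v \<in> twist \<sigma> \<Longrightarrow> v \<in> carrier R" "\<lbrakk> v \<in> twist \<sigma>; m \<in> M \<rbrakk> \<Longrightarrow> v \<otimes> m = \<sigma> m \<otimes> v"
  by (auto simp: twist_def)

lemma twist_mult:
  assumes "v \<in> twist \<sigma>" "w \<in> twist \<tau>" "\<sigma> \<in> carrier Gal" "\<tau> \<in> carrier Gal"
  shows "v \<otimes> w \<in> twist (\<sigma> \<star> \<tau>)"
  unfolding twist_def
proof (intro CollectI conjI ballI)
  note [simp] = twistD(1)[OF assms(1)] twistD(1)[OF assms(2)]
  show "v \<otimes> w \<in> carrier R" by simp
  fix m assume m: "m \<in> M"
  have "v \<otimes> w \<otimes> m = v \<otimes> (\<tau> m \<otimes> w)" using m twistD(2)[OF assms(2) m] by (simp add: m_assoc)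
  also have "\<dots> = \<sigma> (\<tau> m) \<otimes> v \<otimes> w"
    using m assms twistD(2)[OF assms(1), of "\<tau> m"] by (simp add: m_assoc[symmetric])
  finally show "v \<otimes> w \<otimes> m = (\<sigma> \<star> \<tau>) m \<otimes> (v \<otimes> w)"
    using m assms by (simp add: Gal_mult_apply m_assoc)
qed

lemma twist_inv:
  assumes "u \<in> twist \<sigma>" "u \<in> Units R" "\<sigma> \<in> carrier Gal"
  shows "inv u \<in> twist (inv\<^sub>G \<sigma>)"
proof -
  have "inv u \<otimes> m = (inv\<^sub>G \<sigma>) m \<otimes> inv u" if "m \<in> M" for m
    using twistD(2)[OF assms(1), of "(inv\<^sub>G \<sigma>) m"] Gal_inv_apply(2)[OF assms(3) that] assms(2,3) that
    by (intro Units_intertwine_inv) auto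
  then show ?thesis using assms(2) by (auto simp: twist_def)
qed

text \<open>
  The coordinate map \<open>l x = \<Sum> \<mu> i \<cdot> x \<cdot> a i\<close> commutes with multiplication by an element \<open>c\<close> that
  centralizes \<open>M\<close>, so \<open>c = c \<cdot> l e = l (c \<cdot> e)\<close> is one of its values.
\<close>

theorem centralizer_M: "centralizer R M = M"
proof
  show "M \<subseteq> centralizer R M" unfolding centralizer_def using M_comm by auto
  show "centralizer R M \<subseteq> M"
  proof
    fix c assume "c \<in> centralizer R M"
    then have c: "c \<in> carrier R" and comm: "\<And>m. m \<in> M \<Longrightarrow> c \<otimes> m = m \<otimes> c"
      by (auto simp: centralizer_def)
    obtain \<mu> a e where \<mu>: "is_basis K M \<mu> {..<n}" and a: "\<And>i. i < n \<Longrightarrow> a i \<in> carrier R" and e: "e \<in> carrier R"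
      and TM: "\<And>x. x \<in> carrier R \<Longrightarrow> sandwich \<mu> a x \<in> M"
      and Te: "sandwich \<mu> a e = \<one>" using coordinate_as_sandwich_sum by blast
    have \<mu>M: "\<And>i. i < n \<Longrightarrow> \<mu> i \<in> M" using \<mu> by (auto simp: is_basis_def)
    have "c = c \<otimes> sandwich \<mu> a e" using Te c by simp
    also have "\<dots> = (\<Oplus>i\<in>{..<n}. c \<otimes> (\<mu> i \<otimes> e \<otimes> a i))"
      using c a e \<mu>M by (intro finsum_cmult) auto
    also have "\<dots> = sandwich \<mu> a (c \<otimes> e)"
    proof (intro finsum_eq)
      fix i assume i: "i \<in> {..<n}"
      show "c \<otimes> (\<mu> i \<otimes> e \<otimes> a i) = \<mu> i \<otimes> (c \<otimes> e) \<otimes> a i"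
        using i c a e \<mu>M comm[of "\<mu> i"] by (auto simp: m_assoc[symmetric])
    qed
    finally show "c \<in> M" using TM[of "c \<otimes> e"] c e by auto
  qed
qed

text \<open>
  The values of the coordinate map commute with each \<open>m\<close> in \<open>M\<close>. Since sums \<open>\<Sum> \<mu> i \<cdot> x \<cdot> a i\<close> determine
  the \<open>a i\<close>, this says that \<open>a j \<cdot> m\<close> is a combination of the \<open>a i\<close> with the coefficients in \<open>K\<close> of
  multiplication by \<open>m\<close> in the basis \<open>\<mu>\<close>. Multiplication by \<open>\<sigma> m\<close> has the same coefficients in the basis
  \<open>\<sigma> \<circ> \<mu>\<close>, because \<open>\<sigma>\<close> fixes them. Hence \<open>w = \<Sum> \<sigma> (\<mu> i) \<cdot> x \<cdot> a i\<close> satisfies \<open>w \<cdot> m = \<sigma> m \<cdot> w\<close>.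
\<close>

lemma casimir_element:
  obtains \<mu> a e where "is_basis K M \<mu> {..<n}" "\<And>i. i < n \<Longrightarrow> a i \<in> carrier R" "e \<in> carrier R"
    "sandwich \<mu> a e = \<one>"
    "\<And>\<sigma> x. \<lbrakk> \<sigma> \<in> carrier Gal; x \<in> carrier R \<rbrakk> \<Longrightarrow> sandwich (\<lambda>i. \<sigma> (\<mu> i)) a x \<in> twist \<sigma>"
proof -
  obtain \<mu> a e where \<mu>: "is_basis K M \<mu> {..<n}" and a: "\<And>i. i < n \<Longrightarrow> a i \<in> carrier R" and e: "e \<in> carrier R"
    and TM: "\<And>x. x \<in> carrier R \<Longrightarrow> sandwich \<mu> a x \<in> M"
    and Te: "sandwich \<mu> a e = \<one>" using coordinate_as_sandwich_sum by blast
  have \<mu>M: "\<And>i. i < n \<Longrightarrow> \<mu> i \<in> M" using \<mu> by (auto simp: is_basis_def)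
  have transfer: "(\<Oplus>j\<in>{..<n}. y j \<otimes> x \<otimes> (\<Oplus>i\<in>{..<n}. c i j \<otimes> a i))
      = (\<Oplus>i\<in>{..<n}. (\<Oplus>j\<in>{..<n}. c i j \<otimes> y j) \<otimes> x \<otimes> a i)"
    if "\<And>j. j < n \<Longrightarrow> y j \<in> carrier R" "x \<in> carrier R" "\<And>i j. i < n \<Longrightarrow> j < n \<Longrightarrow> c i j \<in> K" for y x c
  proof -
    note t = that(1,2) a that(3)[THEN K_carrier]
    have "(\<Oplus>j\<in>{..<n}. y j \<otimes> x \<otimes> (\<Oplus>i\<in>{..<n}. c i j \<otimes> a i))
       = (\<Oplus>j\<in>{..<n}. \<Oplus>i\<in>{..<n}. c i j \<otimes> y j \<otimes> x \<otimes> a i)"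
    proof (intro finsum_eq)
      fix j assume j: "j \<in> {..<n}"
      have "y j \<otimes> x \<otimes> (\<Oplus>i\<in>{..<n}. c i j \<otimes> a i) = (\<Oplus>i\<in>{..<n}. y j \<otimes> x \<otimes> (c i j \<otimes> a i))"
        using j t by (intro finsum_cmult) auto
      also have "\<dots> = (\<Oplus>i\<in>{..<n}. c i j \<otimes> y j \<otimes> x \<otimes> a i)"
      proof (intro finsum_eq)
        fix i assume i: "i \<in> {..<n}"
        have "y j \<otimes> x \<otimes> c i j = c i j \<otimes> (y j \<otimes> x)"
          using i j t K_comm[OF that(3), of i j "y j \<otimes> x"] by auto
        then have "y j \<otimes> x \<otimes> c i j \<otimes> a i = c i j \<otimes> (y j \<otimes> x) \<otimes> a i" by simp
        then show "y j \<otimes> x \<otimes> (c i j \<otimes> a i) = c i j \<otimes> y j \<otimes> x \<otimes> a i"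
          using i j t by (simp add: m_assoc)
      qed
      finally show "y j \<otimes> x \<otimes> (\<Oplus>i\<in>{..<n}. c i j \<otimes> a i) = (\<Oplus>i\<in>{..<n}. c i j \<otimes> y j \<otimes> x \<otimes> a i)" .
    qed
    also have "\<dots> = (\<Oplus>i\<in>{..<n}. \<Oplus>j\<in>{..<n}. c i j \<otimes> y j \<otimes> x \<otimes> a i)"
      using t by (intro finsum_swap) auto
    also have "\<dots> = (\<Oplus>i\<in>{..<n}. (\<Oplus>j\<in>{..<n}. c i j \<otimes> y j) \<otimes> x \<otimes> a i)"
    proof (intro finsum_eq)
      fix i assume i: "i \<in> {..<n}"
      have s: "(\<Oplus>j\<in>{..<n}. c i j \<otimes> y j) \<in> carrier R" using i t by (intro finsum_closed) auto
      have "(\<Oplus>j\<in>{..<n}. c i j \<otimes> y j) \<otimes> (x \<otimes> a i) = (\<Oplus>j\<in>{..<n}. c i j \<otimes> y j \<otimes> (x \<otimes> a i))"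
        using i t by (intro finsum_cmult) auto
      also have "\<dots> = (\<Oplus>j\<in>{..<n}. c i j \<otimes> y j \<otimes> x \<otimes> a i)"
        using i t by (intro finsum_eq) (auto simp: m_assoc)
      finally show "(\<Oplus>j\<in>{..<n}. c i j \<otimes> y j \<otimes> x \<otimes> a i) = (\<Oplus>j\<in>{..<n}. c i j \<otimes> y j) \<otimes> x \<otimes> a i"
        using i t s by (simp add: m_assoc)
    qed
    finally show ?thesis .
  qed
  show thesis
  proof (rule that[OF \<mu> a e Te])
    fix \<sigma> x assume \<sigma>: "\<sigma> \<in> carrier Gal" and x: "x \<in> carrier R"
    have \<sigma>M: "i < n \<Longrightarrow> \<sigma> (\<mu> i) \<in> M" for i using \<sigma> \<mu>M by auto
    show "sandwich (\<lambda>i. \<sigma> (\<mu> i)) a x \<in> twist \<sigma>"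
      unfolding twist_def
    proof (intro CollectI conjI ballI)
      show "sandwich (\<lambda>i. \<sigma> (\<mu> i)) a x \<in> carrier R"
        using \<sigma>M x a by (intro finsum_closed) auto
      fix m assume m: "m \<in> M"
      have "\<forall>i\<in>{..<n}. \<exists>c. (\<forall>j\<in>{..<n}. c j \<in> K) \<and> m \<otimes> \<mu> i = (\<Oplus>j\<in>{..<n}. c j \<otimes> \<mu> j)"
        using basis_coords[OF \<mu>] m \<mu>M by auto
      then obtain c where c: "\<And>i j. i < n \<Longrightarrow> j < n \<Longrightarrow> c i j \<in> K"
        "\<And>i. i < n \<Longrightarrow> m \<otimes> \<mu> i = (\<Oplus>j\<in>{..<n}. c i j \<otimes> \<mu> j)"
        by (metis lessThan_iff)
      note cR = c(1)[THEN K_carrier]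
      define a' where "a' j = (\<Oplus>i\<in>{..<n}. c i j \<otimes> a i)" for j
      have a'R: "j < n \<Longrightarrow> a' j \<in> carrier R" for j
        using cR a unfolding a'_def by (intro finsum_closed) auto
      have am: "a j \<otimes> m = a' j" if j: "j < n" for j
      proof -
        have "a j \<otimes> m \<ominus> a' j = \<zero>"
        proof (rule sandwich_sum_zero_imp_zero[of "{..<n}" \<mu>])
          fix x assume x: "x \<in> carrier R"
          let ?T = "\<Oplus>i\<in>{..<n}. \<mu> i \<otimes> x \<otimes> a i"
          have "(\<Oplus>j\<in>{..<n}. \<mu> j \<otimes> x \<otimes> (a j \<otimes> m \<ominus> a' j))
             = (\<Oplus>j\<in>{..<n}. \<mu> j \<otimes> x \<otimes> a j \<otimes> m \<ominus> \<mu> j \<otimes> x \<otimes> a' j)"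
            using x m a a'R \<mu>M by (intro finsum_eq) (auto simp: a_minus_def r_distr r_minus m_assoc)
          also have "\<dots> = (\<Oplus>j\<in>{..<n}. \<mu> j \<otimes> x \<otimes> a j \<otimes> m) \<ominus> (\<Oplus>j\<in>{..<n}. \<mu> j \<otimes> x \<otimes> a' j)"
            using x m a a'R \<mu>M by (intro finsum_minus) auto
          also have "(\<Oplus>j\<in>{..<n}. \<mu> j \<otimes> x \<otimes> a j \<otimes> m) = ?T \<otimes> m"
            using x m a a'R \<mu>M by (intro finsum_cmult[symmetric]) auto
          also have "(\<Oplus>j\<in>{..<n}. \<mu> j \<otimes> x \<otimes> a' j) = (\<Oplus>i\<in>{..<n}. m \<otimes> \<mu> i \<otimes> x \<otimes> a i)"
            unfolding a'_def using transfer[of \<mu> x c] x m a \<mu>M c by (auto intro!: finsum_eq simp flip: c(2))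
          also have "\<dots> = (\<Oplus>i\<in>{..<n}. m \<otimes> (\<mu> i \<otimes> x \<otimes> a i))"
            using x m a a'R \<mu>M by (intro finsum_eq) (auto simp: m_assoc)
          also have "\<dots> = m \<otimes> ?T"
            using x m a a'R \<mu>M by (intro finsum_cmult[symmetric]) auto
          finally show "(\<Oplus>j\<in>{..<n}. \<mu> j \<otimes> x \<otimes> (a j \<otimes> m \<ominus> a' j)) = \<zero>"
            using M_comm[OF TM[OF x] m] M_carrier[OF TM[OF x]] m by simp
        qed (use \<mu> \<mu>M a a'R m j in \<open>auto simp: is_basis_def\<close>)
        then show ?thesis using minus_eq_zero_iff a a'R m j by auto
      qed
      have "sandwich (\<lambda>i. \<sigma> (\<mu> i)) a x \<otimes> m = (\<Oplus>i\<in>{..<n}. \<sigma> (\<mu> i) \<otimes> x \<otimes> a i \<otimes> m)"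
        using \<sigma>M x a m by (intro finsum_cmult) auto
      also have "\<dots> = (\<Oplus>j\<in>{..<n}. \<sigma> (\<mu> j) \<otimes> x \<otimes> a' j)"
        using \<sigma>M x a m am a'R by (intro finsum_eq) (auto simp: m_assoc)
      also have "\<dots> = (\<Oplus>i\<in>{..<n}. (\<Oplus>j\<in>{..<n}. c i j \<otimes> \<sigma> (\<mu> j)) \<otimes> x \<otimes> a i)"
        unfolding a'_def using \<sigma>M x c by (intro transfer) auto
      also have "\<dots> = (\<Oplus>i\<in>{..<n}. \<sigma> m \<otimes> (\<sigma> (\<mu> i) \<otimes> x \<otimes> a i))"
      proof (intro finsum_eq)
        fix i assume i: "i \<in> {..<n}"
        have "\<sigma> m \<otimes> \<sigma> (\<mu> i) = \<sigma> (m \<otimes> \<mu> i)" using aut_groupD(5)[OF \<sigma>] m \<mu>M i by auto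
        also have "\<dots> = (\<Oplus>j\<in>{..<n}. \<sigma> (c i j \<otimes> \<mu> j))"
          using subsetD[OF K_M c(1)] i \<mu>M \<sigma> unfolding c(2)[OF i[unfolded lessThan_iff]] by (intro Gal_finsum) auto
        also have "\<dots> = (\<Oplus>j\<in>{..<n}. c i j \<otimes> \<sigma> (\<mu> j))"
          using c i \<mu>M \<sigma>M K_M \<sigma> cR aut_groupD(5,8)[OF \<sigma>] by (intro finsum_eq) (auto simp: subset_iff)
        finally show "(\<Oplus>j\<in>{..<n}. c i j \<otimes> \<sigma> (\<mu> j)) \<otimes> x \<otimes> a i = \<sigma> m \<otimes> (\<sigma> (\<mu> i) \<otimes> x \<otimes> a i)"
          using i \<sigma>M x a m \<sigma> by (simp add: m_assoc[symmetric])
      qed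
      also have "\<dots> = \<sigma> m \<otimes> sandwich (\<lambda>i. \<sigma> (\<mu> i)) a x"
        using \<sigma>M x a m \<sigma> by (intro finsum_cmult[symmetric]) auto
      finally show "sandwich (\<lambda>i. \<sigma> (\<mu> i)) a x \<otimes> m = \<sigma> m \<otimes> sandwich (\<lambda>i. \<sigma> (\<mu> i)) a x" .
    qed
  qed
qed

text \<open>
  For \<open>v \<noteq> 0\<close> some \<open>w\<close> in the space \<open>twist\<close> of the inverse of \<open>\<sigma>\<close> has \<open>w \<cdot> v \<noteq> 0\<close>: otherwise the elements
  \<open>a i\<close> and \<open>e\<close> of \<open>casimir_element\<close> satisfy \<open>a i \<cdot> v = 0\<close> for all \<open>i\<close>, so \<open>v = (\<Sum> \<mu> i \<cdot> e \<cdot> a i) \<cdot> v = 0\<close>. The product \<open>w \<cdot> v\<close> centralizes \<open>M\<close>, so it is a nonzero element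
  of the field \<open>M\<close>. Hence \<open>v\<close> has a left inverse, and so does \<open>w\<close> by the same argument.
\<close>

theorem
  assumes \<sigma>: "\<sigma> \<in> carrier Gal"
  shows twist_unit: "\<lbrakk> v \<in> twist \<sigma>; v \<noteq> \<zero> \<rbrakk> \<Longrightarrow> v \<in> Units R"
    and ex_twist_unit: "\<exists>u\<in>Units R. u \<in> twist \<sigma>"
proof -
  obtain \<mu> a e where \<mu>: "is_basis K M \<mu> {..<n}" and a: "\<And>i. i < n \<Longrightarrow> a i \<in> carrier R" and e: "e \<in> carrier R"
    and Te: "sandwich \<mu> a e = \<one>"
    and Q: "\<And>\<sigma> x. \<lbrakk> \<sigma> \<in> carrier Gal; x \<in> carrier R \<rbrakk> \<Longrightarrow> sandwich (\<lambda>i. \<sigma> (\<mu> i)) a x \<in> twist \<sigma>"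
    using casimir_element by blast
  have \<mu>M: "\<And>i. i < n \<Longrightarrow> \<mu> i \<in> M" using \<mu> by (auto simp: is_basis_def)
  have reach: "\<exists>w\<in>twist \<tau>. w \<otimes> v \<noteq> \<zero>" if \<tau>: "\<tau> \<in> carrier Gal" and v: "v \<in> carrier R" "v \<noteq> \<zero>" for \<tau> v
  proof (rule ccontr)
    assume neg: "\<not> ?thesis"
    have "lin_indep K (\<lambda>i. \<tau> (\<mu> i)) {..<n}"
      unfolding lin_indep_def
    proof (intro allI impI)
      fix c assume c: "\<forall>i\<in>{..<n}. c i \<in> K" "(\<Oplus>i\<in>{..<n}. c i \<otimes> \<tau> (\<mu> i)) = \<zero>"
      have cM: "i < n \<Longrightarrow> c i \<in> M" for i using c K_M by auto
      have "\<tau> (\<Oplus>i\<in>{..<n}. c i \<otimes> \<mu> i) = (\<Oplus>i\<in>{..<n}. \<tau> (c i \<otimes> \<mu> i))"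
        using cM \<mu>M by (intro Gal_finsum \<tau>) auto
      also have "\<dots> = (\<Oplus>i\<in>{..<n}. c i \<otimes> \<tau> (\<mu> i))"
        using c cM \<mu>M \<tau> aut_groupD(5,8)[OF \<tau>] by (intro finsum_eq) auto
      finally have "\<tau> (\<Oplus>i\<in>{..<n}. c i \<otimes> \<mu> i) = \<tau> \<zero>" using c Gal_zero[OF \<tau>] by simp
      moreover have "(\<Oplus>i\<in>{..<n}. c i \<otimes> \<mu> i) \<in> M"
        using cM \<mu>M by (intro finsum_subring[OF M_subring]) auto
      ultimately have "(\<Oplus>i\<in>{..<n}. c i \<otimes> \<mu> i) = \<zero>" using aut_groupD(9)[OF \<tau>] by auto
      then show "\<forall>i\<in>{..<n}. c i = \<zero>" using \<mu> c unfolding is_basis_def lin_indep_def by blast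
    qed
    then have "a i \<otimes> v = \<zero>" if "i < n" for i
    proof (rule sandwich_sum_zero_imp_zero[rotated 2, where a = "\<lambda>i. a i \<otimes> v"])
      fix x assume x: "x \<in> carrier R"
      have "(\<Oplus>i\<in>{..<n}. \<tau> (\<mu> i) \<otimes> x \<otimes> (a i \<otimes> v)) = (\<Oplus>i\<in>{..<n}. \<tau> (\<mu> i) \<otimes> x \<otimes> a i \<otimes> v)"
        using \<tau> \<mu>M x a v by (intro finsum_eq) (auto simp: m_assoc)
      also have "\<dots> = sandwich (\<lambda>i. \<tau> (\<mu> i)) a x \<otimes> v"
        using \<tau> \<mu>M x a v by (intro finsum_cmult[symmetric]) auto
      finally show "(\<Oplus>i\<in>{..<n}. \<tau> (\<mu> i) \<otimes> x \<otimes> (a i \<otimes> v)) = \<zero>" using neg Q[OF \<tau> x] by auto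
    qed (use \<tau> \<mu>M a v that in auto)
    then have "(\<Oplus>i\<in>{..<n}. \<mu> i \<otimes> e \<otimes> a i \<otimes> v) = \<zero>"
      using \<mu>M a v e by (intro finsum_zeroI) (auto simp: m_assoc)
    moreover have "(\<Oplus>i\<in>{..<n}. \<mu> i \<otimes> e \<otimes> a i \<otimes> v) = sandwich \<mu> a e \<otimes> v"
      using \<mu>M a v e by (intro finsum_cmult[symmetric]) auto
    ultimately show False using Te v by simp
  qed
  have M_I: "v \<in> M" if "v \<in> twist \<one>\<^sub>G" for v
    using that centralizer_M unfolding twist_def centralizer_def by (auto simp: Gal_one_apply)
  have left: "\<exists>w l r. w \<in> twist (inv\<^sub>G \<tau>) \<and> w \<noteq> \<zero> \<and> l \<in> carrier R \<and> l \<otimes> v = \<one> \<and> r \<in> carrier R \<and> w \<otimes> r = \<one>"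
    if \<tau>: "\<tau> \<in> carrier Gal" and v: "v \<in> twist \<tau>" "v \<noteq> \<zero>" for \<tau> v
  proof -
    note vR = twistD(1)[OF v(1)]
    obtain w where w: "w \<in> twist (inv\<^sub>G \<tau>)" "w \<otimes> v \<noteq> \<zero>"
      using reach[of "inv\<^sub>G \<tau>" v] \<tau> vR v by auto
    note wR = twistD(1)[OF w(1)]
    have "w \<otimes> v \<in> M"
      using M_I twist_mult[OF w(1) v(1)] \<tau> group.l_inv[OF group_Gal \<tau>] by simp
    note i = M_inv[OF this w(2)]
    have "inv (w \<otimes> v) \<otimes> w \<otimes> v = \<one>" "w \<otimes> (v \<otimes> inv (w \<otimes> v)) = \<one>"
      using i wR vR m_assoc[of "inv (w \<otimes> v)" w v] m_assoc[of w v "inv (w \<otimes> v)"] by auto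
    moreover have "w \<noteq> \<zero>" using w vR by auto
    ultimately show ?thesis using w i wR vR by (meson M_carrier m_closed)
  qed
  show unit: "v \<in> Units R" if v: "v \<in> twist \<sigma>" "v \<noteq> \<zero>" for v
  proof -
    note vR = twistD(1)[OF v(1)]
    obtain w l r where w: "w \<in> twist (inv\<^sub>G \<sigma>)" "w \<noteq> \<zero>" "w \<otimes> r = \<one>" and r: "r \<in> carrier R"
      and l: "l \<in> carrier R" "l \<otimes> v = \<one>"
      using left[OF \<sigma> v] by blast
    obtain v' l' r' where l': "l' \<in> carrier R" "l' \<otimes> w = \<one>" and v': "v' \<in> twist \<sigma>"
      using left[of "inv\<^sub>G \<sigma>" w] \<sigma> w group.inv_inv[OF group_Gal \<sigma>] by auto
    note wR = twistD(1)[OF w(1)]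
    have "l' = l' \<otimes> (w \<otimes> r)" using w l' by simp
    also have "\<dots> = l' \<otimes> w \<otimes> r" using m_assoc[OF l'(1) wR r] by simp
    also have "\<dots> = r" using l' r by simp
    finally have wU: "w \<in> Units R" using w(3) l' r wR by (auto simp: Units_def)
    have "w \<otimes> v \<in> M"
      using M_I twist_mult[OF w(1) v(1)] \<sigma> group.l_inv[OF group_Gal \<sigma>] by simp
    moreover have "w \<otimes> v \<noteq> \<zero>"
    proof
      assume "w \<otimes> v = \<zero>"
      then have "inv w \<otimes> w \<otimes> v = \<zero>" using wU wR vR m_assoc[of "inv w" w v] by simp
      then show False using wU vR v by simp
    qed
    ultimately have "inv w \<otimes> (w \<otimes> v) \<in> Units R"
      using Units_m_closed[OF Units_inv_Units[OF wU] M_inv(4)] by blast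
    then show ?thesis using wU wR vR by (simp add: m_assoc[symmetric])
  qed
  have "\<exists>v\<in>twist \<sigma>. v \<noteq> \<zero>"
    using reach[OF \<sigma> one_closed one_not_zero] twistD(1) by fastforce
  then show "\<exists>u\<in>Units R. u \<in> twist \<sigma>" using unit by blast
qed

lemma twist_smult:
  assumes "c \<in> M" "v \<in> twist \<sigma>" "\<sigma> \<in> carrier Gal"
  shows "c \<otimes> v \<in> twist \<sigma>"
  unfolding twist_def
proof (intro CollectI conjI ballI)
  note vR = twistD(1)[OF assms(2)]
  show "c \<otimes> v \<in> carrier R" using vR assms by auto
  fix m assume m: "m \<in> M"
  have "c \<otimes> v \<otimes> m = c \<otimes> \<sigma> m \<otimes> v"
    using m vR assms twistD(2)[OF assms(2) m] by (simp add: m_assoc)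
  also have "c \<otimes> \<sigma> m = \<sigma> m \<otimes> c" using M_comm assms m by auto
  finally show "c \<otimes> v \<otimes> m = \<sigma> m \<otimes> (c \<otimes> v)" using m vR assms by (simp add: m_assoc)
qed

text \<open>The units that will form the bases of the crossed products.\<close>

definition v :: "('a \<Rightarrow> 'a) \<Rightarrow> 'a" where
  "v \<sigma> = (SOME u. u \<in> Units R \<and> u \<in> twist \<sigma>)"

lemma v:
  assumes "\<sigma> \<in> carrier Gal"
  shows "v \<sigma> \<in> twist \<sigma>" "v \<sigma> \<in> Units R" "v \<sigma> \<in> carrier R" "inv (v \<sigma>) \<in> carrier R"
proof -
  have "\<exists>u. u \<in> Units R \<and> u \<in> twist \<sigma>" using ex_twist_unit[OF assms] by blast
  from someI_ex[OF this] show "v \<sigma> \<in> twist \<sigma>" "v \<sigma> \<in> Units R" by (auto simp: v_def)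
  then show "v \<sigma> \<in> carrier R" "inv (v \<sigma>) \<in> carrier R" by auto
qed

end

section \<open>Galois descent inside the centralizer of a fixed field\<close>

context ring
begin

lemma finsum_bij:
  assumes "bij_betw h I I" "\<And>i. i \<in> I \<Longrightarrow> f i \<in> carrier R"
  shows "(\<Oplus>i\<in>I. f (h i)) = (\<Oplus>i\<in>I. f i)"
  using finsum_reindex[of f h I] assms by (auto simp: bij_betw_def)

lemma dimension_in_subring:
  assumes B: "subring B R" and K: "subfield K R" and d: "dimension d K E" and "E \<subseteq> B"
  shows "ring.dimension (R\<lparr>carrier := B\<rparr>) d K E"
proof -
  interpret B: ring "R\<lparr>carrier := B\<rparr>" by (rule subring_is_ring[OF B])
  obtain Us where Us: "set Us \<subseteq> carrier R" "independent K Us" "length Us = d" "Span K Us = E"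
    using exists_base[OF K d] by auto
  have UsB: "set Us \<subseteq> B" using Span_base_incl[OF K Us(1)] Us(4) \<open>E \<subseteq> B\<close> by blast
  have "B.independent K Us"
    using Us(2) UsB
  proof (induct Us rule: list.induct)
    case (Cons u Us)
    then show ?case
      using independent_backwards[OF Cons(2)] B.li_Cons[of u K Us] by (simp only: Span_consistent[OF B]) auto
  qed simp
  moreover have "B.Span K Us = E" using Us(4) by (simp only: Span_consistent[OF B])
  ultimately show ?thesis using B.dimension_independent[of K Us] Us(3) by metis
qed

lemma subfield_in_subring:
  assumes "subring B R" "subfield K R" "K \<subseteq> B"
  shows "subfield K (R\<lparr>carrier := B\<rparr>)"
  using ring.subfield_iff(1)[OF subring_is_ring[OF assms(1)], of K] subfield_iff(2)[OF assms(2)] assms(3)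
  by simp

lemma centralizer_subring:
  assumes S: "S \<subseteq> carrier R"
  shows "subring (centralizer R S) R"
proof (rule subringI)
  have SR: "s \<in> S \<Longrightarrow> s \<in> carrier R" for s using S by auto
  show "centralizer R S \<subseteq> carrier R" "\<one> \<in> centralizer R S" using SR by (auto simp: centralizer_def)
  show "\<ominus> h \<in> centralizer R S" if "h \<in> centralizer R S" for h
    using that SR by (auto simp: centralizer_def l_minus r_minus)
  show "h1 \<otimes> h2 \<in> centralizer R S" if "h1 \<in> centralizer R S" "h2 \<in> centralizer R S" for h1 h2
    unfolding centralizer_def
  proof (intro CollectI conjI ballI)
    show "h1 \<otimes> h2 \<in> carrier R" using that by (auto simp: centralizer_def)
    fix s assume s: "s \<in> S"
    have h: "h1 \<in> carrier R" "h2 \<in> carrier R" "h1 \<otimes> s = s \<otimes> h1" "h2 \<otimes> s = s \<otimes> h2"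
      using that s by (auto simp: centralizer_def)
    have "h1 \<otimes> h2 \<otimes> s = h1 \<otimes> s \<otimes> h2"
      using h s SR m_assoc[of h1 h2 s] m_assoc[of h1 s h2] by simp
    then show "h1 \<otimes> h2 \<otimes> s = s \<otimes> (h1 \<otimes> h2)"
      using h s SR m_assoc[of s h1 h2] by simp
  qed
  show "h1 \<oplus> h2 \<in> centralizer R S" if "h1 \<in> centralizer R S" "h2 \<in> centralizer R S" for h1 h2
    using that SR by (auto simp: centralizer_def l_distr r_distr)
qed

lemma centralizer_Units_inv:
  assumes u: "u \<in> centralizer R S" "u \<in> Units R" and S: "S \<subseteq> carrier R"
  shows "inv u \<in> centralizer R S"
proof -
  have "inv u \<otimes> s = s \<otimes> inv u" if "s \<in> S" for s
    using u that S by (intro Units_intertwine_inv) (auto simp: centralizer_def)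
  then show ?thesis using u(2) by (auto simp: centralizer_def)
qed

end

context central_simple_with_subfield
begin

text \<open>
  Dedekind's argument: subtracting \<open>\<chi> l z\<close> times the relation from its product with \<open>z\<close> removes the
  term \<open>w l\<close> and multiplies each \<open>w j\<close> by \<open>\<chi> j z - \<chi> l z\<close>.
\<close>

lemma eigenvectors_sum_zero:
  assumes "finite J" "S \<subseteq> carrier R" "\<And>j. j \<in> J \<Longrightarrow> w j \<in> carrier R"
    and "\<And>j z. \<lbrakk> j \<in> J; z \<in> S \<rbrakk> \<Longrightarrow> \<chi> j z \<in> M"
    and "\<And>j z. \<lbrakk> j \<in> J; z \<in> S \<rbrakk> \<Longrightarrow> w j \<otimes> z = \<chi> j z \<otimes> w j"
    and "\<And>i j. \<lbrakk> i \<in> J; j \<in> J; i \<noteq> j \<rbrakk> \<Longrightarrow> \<exists>z\<in>S. \<chi> i z \<noteq> \<chi> j z"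
    and "(\<Oplus>j\<in>J. w j) = \<zero>" "j \<in> J"
  shows "w j = \<zero>"
  using assms(1,3-)
proof (induct J arbitrary: w j)
  case (insert l J)
  note \<chi>M = insert(5)
  have wR: "w j \<in> carrier R" if "j \<in> insert l J" for j using insert(4) that by simp
  have SR: "z \<in> S \<Longrightarrow> z \<in> carrier R" for z using assms(2) by auto
  have eig: "w j \<otimes> z = \<chi> j z \<otimes> w j" if "j \<in> insert l J" "z \<in> S" for j z using insert(6) that by blast
  have sum: "w l \<oplus> (\<Oplus>j\<in>J. w j) = \<zero>" using insert(1,2,8) wR by (simp add: Pi_def)
  have zero: "w j = \<zero>" if j: "j \<in> J" for j
  proof -
    have "l \<noteq> j" using j insert(2) by auto
    then obtain z where z: "z \<in> S" "\<chi> j z \<noteq> \<chi> l z" using insert(7)[of j l] j by auto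
    define w' where "w' j = (\<chi> j z \<ominus> \<chi> l z) \<otimes> w j" for j
    have \<chi>z: "\<chi> l z \<in> M" "\<And>j. j \<in> J \<Longrightarrow> \<chi> j z \<in> M" using \<chi>M z by auto
    have "w' j = \<zero>"
    proof (rule insert(3)[of w'])
      show "w' j \<in> carrier R" if "j \<in> J" for j using that \<chi>z wR by (simp add: w'_def)
      show "\<chi> j z \<in> M" if "j \<in> J" "z \<in> S" for j z using that \<chi>M by auto
      show "w' j \<otimes> s = \<chi> j s \<otimes> w' j" if "j \<in> J" "s \<in> S" for j s
      proof -
        have M: "\<chi> j z \<ominus> \<chi> l z \<in> M" "\<chi> j s \<in> M" using that \<chi>z \<chi>M by auto
        have "w' j \<otimes> s = (\<chi> j z \<ominus> \<chi> l z) \<otimes> (\<chi> j s \<otimes> w j)"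
          using M that wR SR eig[of j s] by (simp add: w'_def m_assoc)
        also have "\<dots> = \<chi> j s \<otimes> (\<chi> j z \<ominus> \<chi> l z) \<otimes> w j"
          using M that wR M_comm[OF M] by (simp add: m_assoc[symmetric])
        finally show ?thesis using M that wR by (simp add: w'_def m_assoc)
      qed
      show "\<exists>z\<in>S. \<chi> i z \<noteq> \<chi> j z" if "i \<in> J" "j \<in> J" "i \<noteq> j" for i j using insert(7) that by auto
      have "(\<Oplus>j\<in>J. w' j) = (\<Oplus>j\<in>J. w j \<otimes> z \<ominus> \<chi> l z \<otimes> w j)"
        using \<chi>z wR z eig SR
        by (intro finsum_eq) (auto simp: w'_def a_minus_def l_distr l_minus)
      also have "\<dots> = (\<Oplus>j\<in>J. w j \<otimes> z) \<ominus> (\<Oplus>j\<in>J. \<chi> l z \<otimes> w j)"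
        using insert(1) \<chi>z wR z SR by (intro finsum_minus) auto
      also have "(\<Oplus>j\<in>J. w j \<otimes> z) = (\<Oplus>j\<in>J. w j) \<otimes> z"
        using insert(1) wR z SR by (intro finsum_cmult[symmetric]) auto
      also have "(\<Oplus>j\<in>J. \<chi> l z \<otimes> w j) = \<chi> l z \<otimes> (\<Oplus>j\<in>J. w j)"
        using insert(1) wR \<chi>z by (intro finsum_cmult[symmetric]) auto
      also have s: "(\<Oplus>j\<in>J. w j) = \<ominus> w l"
        using sum wR by (intro minus_equality[symmetric]) (auto simp: Pi_def a_comm)
      also have "(\<ominus> w l) \<otimes> z \<ominus> \<chi> l z \<otimes> (\<ominus> w l) = \<zero>"
        using wR[of l] z SR \<chi>z eig[of l z] by (simp add: l_minus r_minus a_minus_def l_neg)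
      finally show "(\<Oplus>j\<in>J. w' j) = \<zero>" .
    qed (use j in auto)
    moreover have M: "\<chi> j z \<ominus> \<chi> l z \<in> M" "\<chi> j z \<ominus> \<chi> l z \<noteq> \<zero>"
      using \<chi>z j z minus_eq_zero_iff[of "\<chi> j z" "\<chi> l z"] by auto
    ultimately have "inv (\<chi> j z \<ominus> \<chi> l z) \<otimes> (\<chi> j z \<ominus> \<chi> l z) \<otimes> w j = \<zero>"
      using wR[of j] j m_assoc[of "inv (\<chi> j z \<ominus> \<chi> l z)" "\<chi> j z \<ominus> \<chi> l z" "w j"] M_inv(1)[OF M]
      by (simp add: w'_def)
    then show ?thesis using M_inv(3)[OF M] wR[of j] j by simp
  qed
  then have "(\<Oplus>j\<in>J. w j) = \<zero>" by (intro finsum_zeroI)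
  then have "w l = \<zero>" using sum wR[of l] by simp
  with zero insert(9) show ?case by auto
qed simp

text \<open>
  Two pairs suffice for one automorphism \<open>\<sigma>\<close>: scale \<open>(1, m), (- \<sigma> m, 1)\<close> for any \<open>m\<close> that \<open>\<sigma>\<close>
  moves. For several automorphisms the corresponding tensors are multiplied in \<open>M \<otimes> M\<close>; the index,
  a list of booleans, records which pair was taken for each of them.
\<close>

lemma ex_separating_pairs:
  assumes "finite S" "S \<subseteq> carrier Gal" "\<one>\<^sub>G \<notin> S"
  shows "\<exists>(I::bool list set) x y. finite I \<and> (\<forall>i\<in>I. x i \<in> M \<and> y i \<in> M) \<and>
    (\<Oplus>i\<in>I. x i \<otimes> y i) = \<one> \<and> (\<forall>\<sigma>\<in>S. (\<Oplus>i\<in>I. x i \<otimes> \<sigma> (y i)) = \<zero>)"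
  using assms
proof (induct S)
  case empty
  show ?case
    by (rule exI[of _ "{[]}"], rule exI[of _ "\<lambda>_. \<one>"], rule exI[of _ "\<lambda>_. \<one>"]) auto
next
  case (insert \<sigma> S)
  obtain I :: "bool list set" and x y where I: "finite I" and xyM: "\<And>i. i \<in> I \<Longrightarrow> x i \<in> M" "\<And>i. i \<in> I \<Longrightarrow> y i \<in> M"
    and one: "(\<Oplus>i\<in>I. x i \<otimes> y i) = \<one>" and zero: "\<And>\<sigma>. \<sigma> \<in> S \<Longrightarrow> (\<Oplus>i\<in>I. x i \<otimes> \<sigma> (y i)) = \<zero>"
    using insert(3-5) by blast
  have \<sigma>: "\<sigma> \<in> carrier Gal" "\<sigma> \<noteq> \<one>\<^sub>G" using insert by auto
  then obtain m where m: "m \<in> M" "\<sigma> m \<noteq> m"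
    using Gal_eqI[OF \<sigma>(1) Gal_mult_closed(3)] by (auto simp: Gal_one_apply)
  have dM: "m \<ominus> \<sigma> m \<in> M" "m \<ominus> \<sigma> m \<noteq> \<zero>" using m \<sigma> minus_eq_zero_iff[of m "\<sigma> m"] by auto
  define d where "d = inv (m \<ominus> \<sigma> m)"
  have d: "d \<in> M" "d \<otimes> (m \<ominus> \<sigma> m) = \<one>" using M_inv[OF dM] by (auto simp: d_def)
  define I' where "I' = Cons True ` I \<union> Cons False ` I"
  define x' where "x' l = (if hd l then d \<otimes> x (tl l) else \<ominus> (d \<otimes> \<sigma> m \<otimes> x (tl l)))" for l
  define y' where "y' l = (if hd l then m \<otimes> y (tl l) else y (tl l))" for l
  have xyM': "x' l \<in> M" "y' l \<in> M" if "l \<in> I'" for l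
    using that xyM d m \<sigma> by (auto simp: x'_def y'_def I'_def)
  have sum: "(\<Oplus>l\<in>I'. x' l \<otimes> \<tau> (y' l)) = d \<otimes> (\<tau> m \<ominus> \<sigma> m) \<otimes> (\<Oplus>i\<in>I. x i \<otimes> \<tau> (y i))"
    if \<tau>: "\<tau> \<in> carrier Gal" for \<tau>
  proof -
    have c: "x' l \<otimes> \<tau> (y' l) \<in> carrier R" if "l \<in> I'" for l using xyM'[OF that] \<tau> by auto
    have "(\<Oplus>l\<in>I'. x' l \<otimes> \<tau> (y' l)) = (\<Oplus>l\<in>Cons True ` I. x' l \<otimes> \<tau> (y' l)) \<oplus> (\<Oplus>l\<in>Cons False ` I. x' l \<otimes> \<tau> (y' l))"
      unfolding I'_def using I c by (intro finsum_Un_disjoint) (auto simp: I'_def)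
    also have "(\<Oplus>l\<in>Cons True ` I. x' l \<otimes> \<tau> (y' l)) = (\<Oplus>i\<in>I. x' (True # i) \<otimes> \<tau> (y' (True # i)))"
      using c by (intro finsum_reindex) (auto simp: I'_def)
    also have "(\<Oplus>l\<in>Cons False ` I. x' l \<otimes> \<tau> (y' l)) = (\<Oplus>i\<in>I. x' (False # i) \<otimes> \<tau> (y' (False # i)))"
      using c by (intro finsum_reindex) (auto simp: I'_def)
    also have "(\<Oplus>i\<in>I. x' (True # i) \<otimes> \<tau> (y' (True # i))) \<oplus> (\<Oplus>i\<in>I. x' (False # i) \<otimes> \<tau> (y' (False # i)))
       = (\<Oplus>i\<in>I. x' (True # i) \<otimes> \<tau> (y' (True # i)) \<oplus> x' (False # i) \<otimes> \<tau> (y' (False # i)))"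
      using c by (intro finsum_addf[symmetric]) (auto simp: I'_def)
    also have "\<dots> = (\<Oplus>i\<in>I. d \<otimes> (\<tau> m \<ominus> \<sigma> m) \<otimes> (x i \<otimes> \<tau> (y i)))"
    proof (intro finsum_eq)
      fix i assume i: "i \<in> I"
      note M = d(1) Gal_closed[OF \<tau> m(1)] Gal_closed[OF \<sigma>(1) m(1)] xyM(1)[OF i] Gal_closed[OF \<tau> xyM(2)[OF i]]
      have "x i \<otimes> \<tau> m = \<tau> m \<otimes> x i" using M_comm M by auto
      then have "d \<otimes> x i \<otimes> (\<tau> m \<otimes> \<tau> (y i)) = d \<otimes> \<tau> m \<otimes> (x i \<otimes> \<tau> (y i))"
        using M by (metis M_carrier m_assoc m_closed)
      moreover have "(\<ominus> (d \<otimes> \<sigma> m \<otimes> x i)) \<otimes> \<tau> (y i) = \<ominus> (d \<otimes> \<sigma> m \<otimes> (x i \<otimes> \<tau> (y i)))"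
        using M by (simp add: l_minus m_assoc)
      ultimately show "x' (True # i) \<otimes> \<tau> (y' (True # i)) \<oplus> x' (False # i) \<otimes> \<tau> (y' (False # i))
          = d \<otimes> (\<tau> m \<ominus> \<sigma> m) \<otimes> (x i \<otimes> \<tau> (y i))"
        using M aut_groupD(5)[OF \<tau> m(1) xyM(2)[OF i]]
        by (simp add: x'_def y'_def a_minus_def l_distr r_distr l_minus r_minus)
    qed
    also have "\<dots> = d \<otimes> (\<tau> m \<ominus> \<sigma> m) \<otimes> (\<Oplus>i\<in>I. x i \<otimes> \<tau> (y i))"
      using I d m \<tau> \<sigma> xyM by (intro finsum_cmult[symmetric]) auto
    finally show ?thesis .
  qed
  have "(\<Oplus>l\<in>I'. x' l \<otimes> y' l) = (\<Oplus>l\<in>I'. x' l \<otimes> \<one>\<^sub>G (y' l))"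
    using xyM' by (intro finsum_eq) (auto simp: Gal_one_apply)
  also have "\<dots> = d \<otimes> (m \<ominus> \<sigma> m) \<otimes> (\<Oplus>i\<in>I. x i \<otimes> \<one>\<^sub>G (y i))"
    using sum[OF Gal_mult_closed(3)] m by (simp add: Gal_one_apply)
  also have "(\<Oplus>i\<in>I. x i \<otimes> \<one>\<^sub>G (y i)) = (\<Oplus>i\<in>I. x i \<otimes> y i)"
    using xyM by (intro finsum_eq) (auto simp: Gal_one_apply)
  finally have one': "(\<Oplus>l\<in>I'. x' l \<otimes> y' l) = \<one>" using d one by simp
  have zero': "(\<Oplus>l\<in>I'. x' l \<otimes> \<tau> (y' l)) = \<zero>" if "\<tau> \<in> insert \<sigma> S" for \<tau>
  proof (cases "\<tau> = \<sigma>")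
    case True
    have "(\<Oplus>i\<in>I. x i \<otimes> \<sigma> (y i)) \<in> carrier R" using xyM \<sigma> by (intro finsum_closed) auto
    moreover have "\<sigma> m \<ominus> \<sigma> m = \<zero>" using m \<sigma> minus_eq_zero_iff[of "\<sigma> m" "\<sigma> m"] by auto
    ultimately show ?thesis using True sum[OF \<sigma>(1)] d by simp
  next
    case False
    then show ?thesis using that insert(4) sum[of \<tau>] zero[of \<tau>] d m \<sigma> by auto
  qed
  show ?case
  proof (rule exI[of _ I'], rule exI[of _ x'], rule exI[of _ y'], intro conjI ballI)
    show "finite I'" using I by (simp add: I'_def)
    show "x' i \<in> M" "y' i \<in> M" if "i \<in> I'" for i using xyM'[OF that] .
  qed (fact one' zero')+
qed

end

locale galois_subgroup = central_simple_with_subfield +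
  fixes H :: "('a \<Rightarrow> 'a) set"
  assumes subgroup_H: "subgroup H (aut_group R K M)" and finite_H: "finite H"
begin

definition "Z = fixed_points H M"
definition "C = centralizer R Z"

definition trace :: "'a \<Rightarrow> 'a" where "trace m = (\<Oplus>\<sigma>\<in>H. \<sigma> m)"

lemma H_Gal: "\<sigma> \<in> H \<Longrightarrow> \<sigma> \<in> carrier Gal"
  using subgroup.subset[OF subgroup_H] by auto

lemma H_closed: "\<lbrakk> \<sigma> \<in> H; \<tau> \<in> H \<rbrakk> \<Longrightarrow> \<sigma> \<star> \<tau> \<in> H" "\<sigma> \<in> H \<Longrightarrow> inv\<^sub>G \<sigma> \<in> H" "\<one>\<^sub>G \<in> H"
  using subgroup.m_closed[OF subgroup_H] subgroup.m_inv_closed[OF subgroup_H] subgroup.one_closed[OF subgroup_H]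
  by auto

lemma Z_M: "z \<in> Z \<Longrightarrow> z \<in> M" by (auto simp: Z_def fixed_points_def)
lemma Z_fixed: "\<lbrakk> z \<in> Z; \<sigma> \<in> H \<rbrakk> \<Longrightarrow> \<sigma> z = z" by (auto simp: Z_def fixed_points_def)
lemma Z_I: "\<lbrakk> z \<in> M; \<And>\<sigma>. \<sigma> \<in> H \<Longrightarrow> \<sigma> z = z \<rbrakk> \<Longrightarrow> z \<in> Z" by (auto simp: Z_def fixed_points_def)

lemma K_Z: "K \<subseteq> Z"
  using K_M aut_groupD(8)[OF H_Gal] by (auto intro!: Z_I)

lemma subfield_Z: "subfield Z R"
proof -
  have inv_Z: "inv z \<in> Z" if z: "z \<in> Z" "z \<noteq> \<zero>" for z
  proof (rule Z_I)
    note i = M_inv[OF Z_M[OF z(1)] z(2)]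
    show "inv z \<in> M" by (rule i)
    fix \<sigma> assume s: "\<sigma> \<in> H"
    have "\<sigma> (inv z) \<otimes> z = \<sigma> (inv z \<otimes> z)"
      using aut_groupD(5)[OF H_Gal[OF s] i(1) Z_M[OF z(1)]] Z_fixed[OF z(1) s] by simp
    also have "\<dots> = inv z \<otimes> z" using i(3) aut_groupD(7)[OF H_Gal[OF s]] by simp
    finally show "\<sigma> (inv z) = inv z"
      by (rule Units_r_cancel[OF i(4) M_carrier[OF Gal_closed[OF H_Gal[OF s] i(1)]] M_carrier[OF i(1)]])
  qed
  have sub: "subring Z R"
  proof (rule subringI)
    show "Z \<subseteq> carrier R" "\<one> \<in> Z" using Z_M aut_groupD(7)[OF H_Gal] by (auto intro!: Z_I)
    show "h1 \<otimes> h2 \<in> Z" "h1 \<oplus> h2 \<in> Z" if h: "h1 \<in> Z" "h2 \<in> Z" for h1 h2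
    proof -
      have hM: "h1 \<in> M" "h2 \<in> M" using h Z_M by auto
      have "\<sigma> (h1 \<otimes> h2) = h1 \<otimes> h2" "\<sigma> (h1 \<oplus> h2) = h1 \<oplus> h2" if s: "\<sigma> \<in> H" for \<sigma>
        unfolding aut_groupD(5)[OF H_Gal[OF s] hM] aut_groupD(6)[OF H_Gal[OF s] hM]
          Z_fixed[OF h(1) s] Z_fixed[OF h(2) s] by (rule refl)+
      then show "h1 \<otimes> h2 \<in> Z" "h1 \<oplus> h2 \<in> Z" using hM by (auto intro!: Z_I)
    qed
    show "\<ominus> h \<in> Z" if h: "h \<in> Z" for h
    proof (rule Z_I)
      fix \<sigma> assume s: "\<sigma> \<in> H"
      have hM: "h \<in> M" "\<ominus> h \<in> M" using Z_M[OF h] by auto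
      have "\<sigma> (\<ominus> h) \<oplus> h = \<sigma> (\<ominus> h \<oplus> h)"
        using aut_groupD(6)[OF H_Gal[OF s] hM(2,1)] Z_fixed[OF h s] by simp
      also have "\<dots> = \<zero>" using hM Gal_zero[OF H_Gal[OF s]] by (simp add: l_neg)
      finally show "\<sigma> (\<ominus> h) = \<ominus> h" using hM H_Gal[OF s] by (metis M_carrier Gal_closed minus_equality)
    qed (use Z_M[OF h] in auto)
  qed
  have "k \<in> Units (R\<lparr>carrier := Z\<rparr>)" if k: "k \<in> Z" "k \<noteq> \<zero>" for k
    using M_inv(2,3)[OF Z_M[OF k(1)] k(2)] inv_Z[OF k] k(1) by (auto simp: Units_def)
  moreover have "\<zero> \<notin> Units (R\<lparr>carrier := Z\<rparr>)"
    using Z_M one_not_zero by (auto simp: Units_def)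
  ultimately have "Units (R\<lparr>carrier := Z\<rparr>) = Z - {\<zero>}" by (auto simp: Units_def)
  then show ?thesis
    using subcringI[OF sub] M_comm Z_M by (intro subfieldI) auto
qed

lemma trace_Z:
  assumes m: "m \<in> M"
  shows "trace m \<in> Z"
proof (rule Z_I)
  show "trace m \<in> M" unfolding trace_def using m H_Gal by (intro finsum_subring[OF M_subring]) auto
  fix \<tau> assume t: "\<tau> \<in> H"
  have "bij_betw (\<lambda>\<sigma>. \<tau> \<star> \<sigma>) H H"
  proof (rule bij_betwI[of _ _ _ "\<lambda>\<sigma>. inv\<^sub>G \<tau> \<star> \<sigma>"])
    interpret G: group Gal by (rule group_Gal)
    show "inv\<^sub>G \<tau> \<star> (\<tau> \<star> \<sigma>) = \<sigma>" "\<tau> \<star> (inv\<^sub>G \<tau> \<star> \<sigma>) = \<sigma>" if "\<sigma> \<in> H" for \<sigma>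
      using that t H_Gal by (simp_all add: G.m_assoc[symmetric])
  qed (use t H_closed in auto)
  then have "(\<Oplus>\<sigma>\<in>H. (\<tau> \<star> \<sigma>) m) = trace m"
    unfolding trace_def using m H_Gal by (intro finsum_bij[where f = "\<lambda>\<sigma>. \<sigma> m"]) auto
  moreover have "\<tau> (trace m) = (\<Oplus>\<sigma>\<in>H. \<tau> (\<sigma> m))"
    unfolding trace_def using m t H_Gal by (intro Gal_finsum) auto
  moreover have "\<dots> = (\<Oplus>\<sigma>\<in>H. (\<tau> \<star> \<sigma>) m)"
    using m t H_Gal by (intro finsum_eq) (auto simp: Gal_mult_apply)
  ultimately show "\<tau> (trace m) = trace m" by simp
qed

lemma trace_inv:
  assumes m: "m \<in> M"
  shows "(\<Oplus>\<sigma>\<in>H. (inv\<^sub>G \<sigma>) m) = trace m"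
proof -
  interpret G: group Gal by (rule group_Gal)
  have "bij_betw (m_inv Gal) H H"
    by (rule bij_betwI[of _ _ _ "m_inv Gal"]) (use H_closed H_Gal in auto)
  then show ?thesis unfolding trace_def using m H_Gal by (intro finsum_bij[where f = "\<lambda>\<sigma>. \<sigma> m"]) auto
qed

lemma C_carrier: "a \<in> C \<Longrightarrow> a \<in> carrier R" by (auto simp: C_def centralizer_def)
lemma C_comm: "\<lbrakk> a \<in> C; z \<in> Z \<rbrakk> \<Longrightarrow> a \<otimes> z = z \<otimes> a" by (auto simp: C_def centralizer_def)
lemma Z_carrier: "Z \<subseteq> carrier R" using Z_M by auto

lemma subring_C: "subring C R"
  unfolding C_def using centralizer_subring[OF Z_carrier] .

lemma M_C: "M \<subseteq> C"
  using M_comm Z_M by (auto simp: C_def centralizer_def)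

lemma twist_C:
  assumes "w \<in> twist \<sigma>" "\<sigma> \<in> H" shows "w \<in> C"
  using twistD(1)[OF assms(1)] twistD(2)[OF assms(1) Z_M] Z_fixed[OF _ assms(2)] by (simp add: C_def centralizer_def)

lemma inv_v_C: "\<sigma> \<in> H \<Longrightarrow> inv (v \<sigma>) \<in> C"
  using centralizer_Units_inv[OF _ v(2)[OF H_Gal] Z_carrier] twist_C[OF v(1)[OF H_Gal]] unfolding C_def by blast

end

text \<open>Galois coordinates of \<open>M\<close> over \<open>Z\<close>: the separability idempotent of \<open>M \<otimes>\<^sub>Z M\<close>.\<close>

locale galois_coordinates = galois_subgroup +
  fixes I :: "bool list set" and x y :: "bool list \<Rightarrow> 'a"
  assumes finite_I: "finite I"
    and xM: "i \<in> I \<Longrightarrow> x i \<in> M" and yM: "i \<in> I \<Longrightarrow> y i \<in> M"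
    and orth: "\<sigma> \<in> H \<Longrightarrow> (\<Oplus>i\<in>I. x i \<otimes> \<sigma> (y i)) = (if \<sigma> = \<one>\<^sub>G then \<one> else \<zero>)"
begin

text \<open>
  The orthogonality relations pick the summand \<open>\<sigma> = 1\<close> out of the trace.
\<close>

lemma trace_expansion:
  assumes m: "m \<in> M"
  shows "(\<Oplus>i\<in>I. x i \<otimes> trace (y i \<otimes> m)) = m"
proof -
  have "(\<Oplus>i\<in>I. x i \<otimes> trace (y i \<otimes> m)) = (\<Oplus>i\<in>I. \<Oplus>\<sigma>\<in>H. x i \<otimes> \<sigma> (y i) \<otimes> \<sigma> m)"
  proof (intro finsum_eq)
    fix i assume i: "i \<in> I"
    have "x i \<otimes> trace (y i \<otimes> m) = (\<Oplus>\<sigma>\<in>H. x i \<otimes> \<sigma> (y i \<otimes> m))"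
      unfolding trace_def using i xM yM m H_Gal finite_H by (intro finsum_cmult) auto
    also have "\<dots> = (\<Oplus>\<sigma>\<in>H. x i \<otimes> \<sigma> (y i) \<otimes> \<sigma> m)"
    proof (intro finsum_eq)
      fix \<sigma> assume s: "\<sigma> \<in> H"
      note M = xM[OF i] Gal_closed[OF H_Gal[OF s] yM[OF i]] Gal_closed[OF H_Gal[OF s] m]
      show "x i \<otimes> \<sigma> (y i \<otimes> m) = x i \<otimes> \<sigma> (y i) \<otimes> \<sigma> m"
        using M aut_groupD(5)[OF H_Gal[OF s] yM[OF i] m] by (simp add: m_assoc)
    qed
    finally show "x i \<otimes> trace (y i \<otimes> m) = (\<Oplus>\<sigma>\<in>H. x i \<otimes> \<sigma> (y i) \<otimes> \<sigma> m)" .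
  qed
  also have "\<dots> = (\<Oplus>\<sigma>\<in>H. \<Oplus>i\<in>I. x i \<otimes> \<sigma> (y i) \<otimes> \<sigma> m)"
    using finite_I finite_H xM yM m H_Gal by (intro finsum_swap) auto
  also have "\<dots> = (\<Oplus>\<sigma>\<in>H. if \<sigma> = \<one>\<^sub>G then \<sigma> m else \<zero>)"
  proof (intro finsum_eq)
    fix \<sigma> assume s: "\<sigma> \<in> H"
    have "(\<Oplus>i\<in>I. x i \<otimes> \<sigma> (y i) \<otimes> \<sigma> m) = (\<Oplus>i\<in>I. x i \<otimes> \<sigma> (y i)) \<otimes> \<sigma> m"
      using finite_I s xM yM m H_Gal by (intro finsum_cmult[symmetric]) auto
    then show "(\<Oplus>i\<in>I. x i \<otimes> \<sigma> (y i) \<otimes> \<sigma> m) = (if \<sigma> = \<one>\<^sub>G then \<sigma> m else \<zero>)"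
      using orth[OF s] s m H_Gal by auto
  qed
  also have "\<dots> = \<one>\<^sub>G m" using finite_H H_closed(3) m H_Gal by (intro finsum_delta) auto
  finally show ?thesis using m by (simp add: Gal_one_apply)
qed

text \<open>The projection of \<open>C\<close> onto \<open>M\<close> that the idempotent defines.\<close>

definition P :: "'a \<Rightarrow> 'a" where "P a = (\<Oplus>i\<in>I. x i \<otimes> a \<otimes> y i)"

lemma P_carrier: "a \<in> carrier R \<Longrightarrow> P a \<in> carrier R"
  unfolding P_def using xM yM by (intro finsum_closed) auto

text \<open>
  If \<open>y j \<cdot> m\<close> is expanded in the \<open>x k\<close>, the coefficients lie in \<open>Z\<close> and can be moved across \<open>a\<close>. They are
  symmetric in \<open>j\<close> and \<open>k\<close>, so this gives \<open>P a \<cdot> m = m \<cdot> P' a\<close>, where \<open>P'\<close> is \<open>P\<close> with \<open>x\<close> and \<open>y\<close> exchanged.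
  With \<open>m = 1\<close> it follows that \<open>P a = P' a\<close> commutes with \<open>M\<close>.
\<close>

lemma P_M:
  assumes a: "a \<in> C"
  shows "P a \<in> M"
proof -
  note aR = C_carrier[OF a]
  define P' where "P' = (\<Oplus>k\<in>I. y k \<otimes> a \<otimes> x k)"
  have P'R: "P' \<in> carrier R" unfolding P'_def using xM yM aR by (intro finsum_closed) auto
  have PP': "P a \<otimes> m = m \<otimes> P'" if m: "m \<in> M" for m
  proof -
    define z where "z k j = trace (y k \<otimes> (y j \<otimes> m))" for k j
    have z: "z k j \<in> Z" if "k \<in> I" "j \<in> I" for k j using that yM m unfolding z_def by (intro trace_Z) auto
    note zM = Z_M[OF z]
    have zsym: "z k j = trace (y j \<otimes> (y k \<otimes> m))" if "k \<in> I" "j \<in> I" for k j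
    proof -
      have "y k \<otimes> (y j \<otimes> m) = y j \<otimes> (y k \<otimes> m)"
        using that yM m M_comm[OF yM[OF that(1)] yM[OF that(2)]] by (simp add: m_assoc[symmetric])
      then show ?thesis by (simp add: z_def)
    qed
    have "P a \<otimes> m = (\<Oplus>j\<in>I. x j \<otimes> a \<otimes> y j \<otimes> m)"
      unfolding P_def using finite_I xM yM aR m by (intro finsum_cmult) auto
    also have "\<dots> = (\<Oplus>j\<in>I. \<Oplus>k\<in>I. x j \<otimes> z k j \<otimes> a \<otimes> x k)"
    proof (intro finsum_eq)
      fix j assume j: "j \<in> I"
      have "x j \<otimes> a \<otimes> y j \<otimes> m = x j \<otimes> a \<otimes> (\<Oplus>k\<in>I. x k \<otimes> z k j)"
        using j xM yM aR m trace_expansion[of "y j \<otimes> m"] by (simp add: z_def m_assoc)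
      also have "\<dots> = (\<Oplus>k\<in>I. x j \<otimes> a \<otimes> (x k \<otimes> z k j))"
        using finite_I j xM zM aR by (intro finsum_cmult) auto
      also have "\<dots> = (\<Oplus>k\<in>I. x j \<otimes> z k j \<otimes> a \<otimes> x k)"
      proof (intro finsum_eq)
        fix k assume k: "k \<in> I"
        note c = xM[OF j, THEN M_carrier] xM[OF k, THEN M_carrier] zM[OF k j, THEN M_carrier] aR
        have "x j \<otimes> a \<otimes> (x k \<otimes> z k j) = x j \<otimes> a \<otimes> (z k j \<otimes> x k)"
          using M_comm[OF xM[OF k] zM[OF k j]] by simp
        also have "\<dots> = x j \<otimes> (a \<otimes> z k j) \<otimes> x k" using c by (simp add: m_assoc)
        also have "\<dots> = x j \<otimes> z k j \<otimes> a \<otimes> x k" using C_comm[OF a z[OF k j]] c by (simp add: m_assoc)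
        finally show "x j \<otimes> a \<otimes> (x k \<otimes> z k j) = x j \<otimes> z k j \<otimes> a \<otimes> x k" .
      qed
      finally show "x j \<otimes> a \<otimes> y j \<otimes> m = (\<Oplus>k\<in>I. x j \<otimes> z k j \<otimes> a \<otimes> x k)" .
    qed
    also have "\<dots> = (\<Oplus>k\<in>I. \<Oplus>j\<in>I. x j \<otimes> z k j \<otimes> a \<otimes> x k)"
      using finite_I xM zM aR by (intro finsum_swap) auto
    also have "\<dots> = (\<Oplus>k\<in>I. m \<otimes> (y k \<otimes> a \<otimes> x k))"
    proof (intro finsum_eq)
      fix k assume k: "k \<in> I"
      have "(\<Oplus>j\<in>I. x j \<otimes> z k j \<otimes> a \<otimes> x k) = (\<Oplus>j\<in>I. x j \<otimes> z k j \<otimes> (a \<otimes> x k))"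
        using k xM zM aR by (intro finsum_eq) (auto simp: m_assoc)
      also have "\<dots> = (\<Oplus>j\<in>I. x j \<otimes> z k j) \<otimes> (a \<otimes> x k)"
        using k finite_I xM zM aR by (intro finsum_cmult[symmetric]) auto
      also have "(\<Oplus>j\<in>I. x j \<otimes> z k j) = (\<Oplus>j\<in>I. x j \<otimes> trace (y j \<otimes> (y k \<otimes> m)))"
        using k by (intro finsum_eq) (simp add: zsym)
      also have "\<dots> = y k \<otimes> m" using k yM m by (intro trace_expansion) auto
      also have "y k \<otimes> m = m \<otimes> y k" using M_comm yM k m by auto
      finally show "(\<Oplus>j\<in>I. x j \<otimes> z k j \<otimes> a \<otimes> x k) = m \<otimes> (y k \<otimes> a \<otimes> x k)"
        using k m xM yM aR by (simp add: m_assoc)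
    qed
    also have "\<dots> = m \<otimes> P'"
      unfolding P'_def using finite_I m xM yM aR by (intro finsum_cmult[symmetric]) auto
    finally show ?thesis .
  qed
  have "P a = P'" using PP'[of \<one>] P_carrier[OF aR] P'R by auto
  then have "P a \<in> centralizer R M" unfolding centralizer_def using PP' P'R by auto
  then show ?thesis using centralizer_M by simp
qed

text \<open>
  Moving \<open>v \<sigma>\<close> to the left turns the summand of \<open>\<sigma>\<close> into \<open>\<Sum> x i \<cdot> a \<cdot> \<sigma>' (y i)\<close> with \<open>\<sigma>'\<close> inverse to \<open>\<sigma>\<close>.
  Summation over \<open>\<sigma>\<close> gives traces of the \<open>y i\<close>, which commute with \<open>a\<close>.
\<close>

lemma C_expansion:
  assumes a: "a \<in> C"
  shows "(\<Oplus>\<sigma>\<in>H. P (a \<otimes> inv (v \<sigma>)) \<otimes> v \<sigma>) = a"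
proof -
  note aR = C_carrier[OF a]
  have "(\<Oplus>\<sigma>\<in>H. P (a \<otimes> inv (v \<sigma>)) \<otimes> v \<sigma>) = (\<Oplus>\<sigma>\<in>H. \<Oplus>i\<in>I. x i \<otimes> a \<otimes> (inv\<^sub>G \<sigma>) (y i))"
  proof (intro finsum_eq)
    fix \<sigma> assume s: "\<sigma> \<in> H"
    have iM: "(inv\<^sub>G \<sigma>) (y i) \<in> M" if "i \<in> I" for i using that yM H_Gal H_closed s by auto
    have "P (a \<otimes> inv (v \<sigma>)) \<otimes> v \<sigma> = (\<Oplus>i\<in>I. x i \<otimes> (a \<otimes> inv (v \<sigma>)) \<otimes> y i \<otimes> v \<sigma>)"
      unfolding P_def using finite_I xM yM v(3,4)[OF H_Gal[OF s]] aR by (intro finsum_cmult) auto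
    also have "\<dots> = (\<Oplus>i\<in>I. x i \<otimes> a \<otimes> (inv\<^sub>G \<sigma>) (y i))"
    proof (intro finsum_eq)
      fix i assume i: "i \<in> I"
      note c = xM[OF i, THEN M_carrier] yM[OF i, THEN M_carrier] iM[OF i, THEN M_carrier] v(3,4)[OF H_Gal[OF s]] aR
      have "x i \<otimes> (a \<otimes> inv (v \<sigma>)) \<otimes> y i \<otimes> v \<sigma> = x i \<otimes> a \<otimes> (inv (v \<sigma>) \<otimes> y i) \<otimes> v \<sigma>"
        using c by (simp add: m_assoc)
      also have "inv (v \<sigma>) \<otimes> y i = (inv\<^sub>G \<sigma>) (y i) \<otimes> inv (v \<sigma>)"
        using twistD(2)[OF twist_inv[OF v(1,2)[OF H_Gal[OF s]] H_Gal[OF s]] yM[OF i]] .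
      also have "x i \<otimes> a \<otimes> ((inv\<^sub>G \<sigma>) (y i) \<otimes> inv (v \<sigma>)) \<otimes> v \<sigma> = x i \<otimes> a \<otimes> (inv\<^sub>G \<sigma>) (y i)"
        using c v(2)[OF H_Gal[OF s]] by (simp add: m_assoc)
      finally show "x i \<otimes> (a \<otimes> inv (v \<sigma>)) \<otimes> y i \<otimes> v \<sigma> = x i \<otimes> a \<otimes> (inv\<^sub>G \<sigma>) (y i)" .
    qed
    finally show "P (a \<otimes> inv (v \<sigma>)) \<otimes> v \<sigma> = (\<Oplus>i\<in>I. x i \<otimes> a \<otimes> (inv\<^sub>G \<sigma>) (y i))" .
  qed
  also have "\<dots> = (\<Oplus>i\<in>I. \<Oplus>\<sigma>\<in>H. x i \<otimes> a \<otimes> (inv\<^sub>G \<sigma>) (y i))"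
    using finite_I finite_H xM yM aR H_Gal by (intro finsum_swap) auto
  also have "\<dots> = (\<Oplus>i\<in>I. x i \<otimes> trace (y i \<otimes> \<one>) \<otimes> a)"
  proof (intro finsum_eq)
    fix i assume i: "i \<in> I"
    note t = trace_Z[OF yM[OF i]] Z_M[OF trace_Z[OF yM[OF i]]]
    have "(\<Oplus>\<sigma>\<in>H. x i \<otimes> a \<otimes> (inv\<^sub>G \<sigma>) (y i)) = x i \<otimes> a \<otimes> (\<Oplus>\<sigma>\<in>H. (inv\<^sub>G \<sigma>) (y i))"
      using i finite_H xM yM aR H_Gal by (intro finsum_cmult[symmetric]) auto
    then show "(\<Oplus>\<sigma>\<in>H. x i \<otimes> a \<otimes> (inv\<^sub>G \<sigma>) (y i)) = x i \<otimes> trace (y i \<otimes> \<one>) \<otimes> a"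
      using i xM yM aR t C_comm[OF a t(1)] trace_inv[OF yM[OF i]] by (simp add: m_assoc)
  qed
  also have "\<dots> = (\<Oplus>i\<in>I. x i \<otimes> trace (y i \<otimes> \<one>)) \<otimes> a"
    using finite_I xM yM aR Z_M[OF trace_Z] by (intro finsum_cmult[symmetric]) auto
  also have "\<dots> = a" using trace_expansion[of \<one>] aR by simp
  finally show ?thesis .
qed

end

context galois_subgroup
begin

lemma ex_galois_coordinates: "\<exists>I x y. galois_coordinates R K M n H I x y"
proof -
  have "\<exists>(I::bool list set) x y. finite I \<and> (\<forall>i\<in>I. x i \<in> M \<and> y i \<in> M) \<and>
    (\<Oplus>i\<in>I. x i \<otimes> y i) = \<one> \<and> (\<forall>\<sigma>\<in>H - {\<one>\<^sub>G}. (\<Oplus>i\<in>I. x i \<otimes> \<sigma> (y i)) = \<zero>)"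
    using finite_H H_Gal by (intro ex_separating_pairs) auto
  then obtain I :: "bool list set" and x y where *: "finite I" "\<And>i. i \<in> I \<Longrightarrow> x i \<in> M" "\<And>i. i \<in> I \<Longrightarrow> y i \<in> M"
    "(\<Oplus>i\<in>I. x i \<otimes> y i) = \<one>" "\<And>\<sigma>. \<sigma> \<in> H - {\<one>\<^sub>G} \<Longrightarrow> (\<Oplus>i\<in>I. x i \<otimes> \<sigma> (y i)) = \<zero>" by blast
  have "(\<Oplus>i\<in>I. x i \<otimes> \<one>\<^sub>G (y i)) = (\<Oplus>i\<in>I. x i \<otimes> y i)"
    using * by (intro finsum_eq) (auto simp: Gal_one_apply)
  then have "galois_coordinates R K M n H I x y"
    using * by unfold_locales auto
  then show ?thesis by blast
qed

end

context galois_coordinates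
begin

lemma basis_C: "is_basis M C v H"
  unfolding is_basis_def
proof (intro conjI ballI)
  show "finite H" by (rule finite_H)
  show "v \<sigma> \<in> C" if "\<sigma> \<in> H" for \<sigma> using twist_C v(1) H_Gal that by blast
  show "lin_indep M v H"
    unfolding lin_indep_def
  proof (intro allI impI ballI)
    fix c \<sigma> assume c: "\<forall>i\<in>H. c i \<in> M" "(\<Oplus>i\<in>H. c i \<otimes> v i) = \<zero>" and s: "\<sigma> \<in> H"
    have tw: "c \<tau> \<otimes> v \<tau> \<in> twist \<tau>" if "\<tau> \<in> H" for \<tau>
      using that c v(1) H_Gal by (intro twist_smult) auto
    have "c \<sigma> \<otimes> v \<sigma> = \<zero>"
    proof (rule eigenvectors_sum_zero[of H M "\<lambda>\<tau>. c \<tau> \<otimes> v \<tau>" "\<lambda>\<tau>. \<tau>"])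
      show "\<exists>z\<in>M. \<rho> z \<noteq> \<tau> z" if "\<rho> \<in> H" "\<tau> \<in> H" "\<rho> \<noteq> \<tau>" for \<rho> \<tau>
        using distinct_Gal that H_Gal by blast
    qed (use finite_H tw twistD H_Gal c s in auto)
    then show "c \<sigma> = \<zero>" using c(1) s v(3)[OF H_Gal[OF s]] Units_r_cancel[OF v(2)[OF H_Gal[OF s]], of "c \<sigma>" \<zero>] by simp
  qed
  fix a assume a: "a \<in> C"
  have "P (a \<otimes> inv (v \<sigma>)) \<in> M" if "\<sigma> \<in> H" for \<sigma>
    using a inv_v_C[OF that] subringE(6)[OF subring_C] by (intro P_M) auto
  moreover have "a = (\<Oplus>\<sigma>\<in>H. P (a \<otimes> inv (v \<sigma>)) \<otimes> v \<sigma>)" using C_expansion[OF a] by simp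
  ultimately show "\<exists>c. (\<forall>\<sigma>\<in>H. c \<sigma> \<in> M) \<and> a = (\<Oplus>\<sigma>\<in>H. c \<sigma> \<otimes> v \<sigma>)"
    by (intro exI[of _ "\<lambda>\<sigma>. P (a \<otimes> inv (v \<sigma>))"] conjI ballI)
qed

text \<open>
  Artin's argument: if \<open>c\<close> solves \<open>\<Sum> c i \<cdot> \<sigma> (e i) = 0\<close> for all \<open>\<sigma>\<close>, then so do its multiples and its
  conjugates, hence \<open>\<Sum> trace (y \<cdot> c i) \<cdot> e i = 0\<close>, where the coefficients are in \<open>Z\<close>. So the dimension is
  at most \<open>card H\<close>. It is not smaller because the orthogonality relations make the automorphisms in
  \<open>H\<close> linearly independent over \<open>M\<close>.
\<close>

lemma dim_M_over_Z: "dimension (card H) Z M"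
proof -
  obtain d where d: "dimension d Z M"
    using finite_dimension_larger_field[OF subfield_K subfield_Z K_Z dim_M] Z_M by blast
  obtain e where e: "is_basis Z M e {..<d}" using dimension_imp_basis[OF subfield_Z d] by auto
  have eM: "i < d \<Longrightarrow> e i \<in> M" for i using e by (auto simp: is_basis_def)
  have "\<not> card H < d"
  proof
    assume "card H < d"
    then have "\<exists>c. (\<forall>i\<in>{..<d}. c i \<in> M) \<and> (\<exists>i\<in>{..<d}. c i \<noteq> \<zero>) \<and>
        (\<forall>\<sigma>\<in>H. (\<Oplus>i\<in>{..<d}. c i \<otimes> \<sigma> (e i)) = \<zero>)"
      using finite_H eM H_Gal by (intro underdetermined_system[OF subfield_M]) auto
    then obtain c where c: "\<And>i. i < d \<Longrightarrow> c i \<in> M" "\<exists>i<d. c i \<noteq> \<zero>"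
        "\<And>\<sigma>. \<sigma> \<in> H \<Longrightarrow> (\<Oplus>i\<in>{..<d}. c i \<otimes> \<sigma> (e i)) = \<zero>" by (metis lessThan_iff)
    have tr: "trace (y \<otimes> c i) = \<zero>" if y: "y \<in> M" and i: "i < d" for y i
    proof -
      have conj: "(\<Oplus>i\<in>{..<d}. \<rho> (y \<otimes> c i) \<otimes> e i) = \<zero>" if r: "\<rho> \<in> H" for \<rho>
      proof -
        let ?\<rho>' = "inv\<^sub>G \<rho>"
        have r': "?\<rho>' \<in> H" "?\<rho>' \<in> carrier Gal" "\<rho> \<in> carrier Gal" using r H_closed H_Gal by auto
        have "\<zero> = y \<otimes> (\<Oplus>i\<in>{..<d}. c i \<otimes> ?\<rho>' (e i))" using c(3)[OF r'(1)] y by simp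
        also have "\<dots> = (\<Oplus>i\<in>{..<d}. y \<otimes> (c i \<otimes> ?\<rho>' (e i)))"
          using y c eM r' by (intro finsum_cmult) auto
        finally have "\<rho> (\<Oplus>i\<in>{..<d}. y \<otimes> (c i \<otimes> ?\<rho>' (e i))) = \<zero>" using Gal_zero[OF r'(3)] by simp
        moreover have "\<rho> (\<Oplus>i\<in>{..<d}. y \<otimes> (c i \<otimes> ?\<rho>' (e i))) = (\<Oplus>i\<in>{..<d}. \<rho> (y \<otimes> (c i \<otimes> ?\<rho>' (e i))))"
          using y c eM r' by (intro Gal_finsum) auto
        moreover have "\<dots> = (\<Oplus>i\<in>{..<d}. \<rho> (y \<otimes> c i) \<otimes> e i)"
        proof (intro finsum_eq)
          fix i assume i: "i \<in> {..<d}"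
          have M: "y \<otimes> c i \<in> M" "?\<rho>' (e i) \<in> M" "c i \<in> M" using i y c eM r' by auto
          have "y \<otimes> (c i \<otimes> ?\<rho>' (e i)) = y \<otimes> c i \<otimes> ?\<rho>' (e i)" using M y by (simp add: m_assoc)
          then show "\<rho> (y \<otimes> (c i \<otimes> ?\<rho>' (e i))) = \<rho> (y \<otimes> c i) \<otimes> e i"
            using aut_groupD(5)[OF r'(3) M(1,2)] Gal_inv_apply(2)[OF r'(3) eM] i by simp
        qed
        ultimately show ?thesis by simp
      qed
      have "(\<Oplus>i\<in>{..<d}. trace (y \<otimes> c i) \<otimes> e i) = (\<Oplus>i\<in>{..<d}. \<Oplus>\<rho>\<in>H. \<rho> (y \<otimes> c i) \<otimes> e i)"
        unfolding trace_def using y c eM H_Gal finite_H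
        by (intro finsum_eq finsum_cmult) (auto intro!: finsum_closed)
      also have "\<dots> = (\<Oplus>\<rho>\<in>H. \<Oplus>i\<in>{..<d}. \<rho> (y \<otimes> c i) \<otimes> e i)"
        using y c eM H_Gal finite_H by (intro finsum_swap) auto
      also have "\<dots> = \<zero>" by (rule finsum_zeroI) (rule conj)
      finally show ?thesis
        using e y c i trace_Z unfolding is_basis_def
        by (intro lin_indepD[of Z e "{..<d}" "\<lambda>i. trace (y \<otimes> c i)" i]) auto
    qed
    have "c i = \<zero>" if i: "i < d" for i
    proof -
      have "(\<Oplus>j\<in>I. x j \<otimes> trace (y j \<otimes> c i)) = \<zero>"
        using tr[OF yM i] xM by (intro finsum_zeroI) auto
      then show ?thesis using trace_expansion[OF c(1)[OF i]] by simp
    qed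
    with c(2) show False by blast
  qed
  moreover have "\<not> d < card H"
  proof
    assume "d < card H"
    then have "\<exists>c. (\<forall>\<sigma>\<in>H. c \<sigma> \<in> M) \<and> (\<exists>\<sigma>\<in>H. c \<sigma> \<noteq> \<zero>) \<and>
        (\<forall>i\<in>{..<d}. (\<Oplus>\<sigma>\<in>H. c \<sigma> \<otimes> \<sigma> (e i)) = \<zero>)"
      using finite_H eM H_Gal by (intro underdetermined_system[OF subfield_M]) auto
    then obtain c where "\<forall>\<sigma>\<in>H. c \<sigma> \<in> M" "\<exists>\<sigma>\<in>H. c \<sigma> \<noteq> \<zero>"
        "\<forall>i\<in>{..<d}. (\<Oplus>\<sigma>\<in>H. c \<sigma> \<otimes> \<sigma> (e i)) = \<zero>" by blast
    then have c: "\<And>\<sigma>. \<sigma> \<in> H \<Longrightarrow> c \<sigma> \<in> M" "\<exists>\<sigma>\<in>H. c \<sigma> \<noteq> \<zero>"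
        "\<And>i. i < d \<Longrightarrow> (\<Oplus>\<sigma>\<in>H. c \<sigma> \<otimes> \<sigma> (e i)) = \<zero>" by blast+
    have all: "(\<Oplus>\<sigma>\<in>H. c \<sigma> \<otimes> \<sigma> m) = \<zero>" if m: "m \<in> M" for m
    proof -
      obtain z where z': "\<forall>i\<in>{..<d}. z i \<in> Z" "m = (\<Oplus>i\<in>{..<d}. z i \<otimes> e i)"
        using basis_coords[OF e m] by blast
      then have z: "\<And>i. i < d \<Longrightarrow> z i \<in> Z" "m = (\<Oplus>i\<in>{..<d}. z i \<otimes> e i)" by blast+
      note zM = Z_M[OF z(1)]
      have "(\<Oplus>\<sigma>\<in>H. c \<sigma> \<otimes> \<sigma> m) = (\<Oplus>\<sigma>\<in>H. \<Oplus>i\<in>{..<d}. z i \<otimes> (c \<sigma> \<otimes> \<sigma> (e i)))"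
      proof (intro finsum_eq)
        fix \<sigma> assume s: "\<sigma> \<in> H"
        note sG = H_Gal[OF s]
        have "\<sigma> m = (\<Oplus>i\<in>{..<d}. \<sigma> (z i \<otimes> e i))"
          unfolding z(2) using zM eM by (intro Gal_finsum[OF sG]) auto
        also have "\<dots> = (\<Oplus>i\<in>{..<d}. z i \<otimes> \<sigma> (e i))"
          using zM eM sG aut_groupD(5)[OF sG zM eM] Z_fixed[OF z(1) s] by (intro finsum_eq) auto
        finally have "c \<sigma> \<otimes> \<sigma> m = c \<sigma> \<otimes> (\<Oplus>i\<in>{..<d}. z i \<otimes> \<sigma> (e i))" by simp
        also have "\<dots> = (\<Oplus>i\<in>{..<d}. c \<sigma> \<otimes> (z i \<otimes> \<sigma> (e i)))"
          using c s zM eM sG by (intro finsum_cmult) auto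
        also have "\<dots> = (\<Oplus>i\<in>{..<d}. z i \<otimes> (c \<sigma> \<otimes> \<sigma> (e i)))"
        proof (intro finsum_eq)
          fix i assume i: "i \<in> {..<d}"
          have M: "z i \<in> M" "c \<sigma> \<in> M" "\<sigma> (e i) \<in> M" using i zM eM sG c s by auto
          show "c \<sigma> \<otimes> (z i \<otimes> \<sigma> (e i)) = z i \<otimes> (c \<sigma> \<otimes> \<sigma> (e i))"
            using M M_comm[OF M(1,2)] by (simp add: m_assoc[symmetric])
        qed
        finally show "c \<sigma> \<otimes> \<sigma> m = (\<Oplus>i\<in>{..<d}. z i \<otimes> (c \<sigma> \<otimes> \<sigma> (e i)))" .
      qed
      also have "\<dots> = (\<Oplus>i\<in>{..<d}. \<Oplus>\<sigma>\<in>H. z i \<otimes> (c \<sigma> \<otimes> \<sigma> (e i)))"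
        using zM c eM H_Gal finite_H by (intro finsum_swap) auto
      also have "\<dots> = (\<Oplus>i\<in>{..<d}. z i \<otimes> (\<Oplus>\<sigma>\<in>H. c \<sigma> \<otimes> \<sigma> (e i)))"
        using zM c(1) eM H_Gal finite_H by (intro finsum_eq finsum_cmult[symmetric]) (auto intro!: finsum_closed)
      also have "\<dots> = \<zero>" using c(3) zM by (intro finsum_zeroI) auto
      finally show ?thesis .
    qed
    have "c \<rho> = \<zero>" if r: "\<rho> \<in> H" for \<rho>
    proof -
      note rG = H_Gal[OF r]
      interpret G: group Gal by (rule group_Gal)
      have yM': "\<sigma> (y i) \<in> M" "\<rho> (x i) \<in> M" if "\<sigma> \<in> H" "i \<in> I" for \<sigma> i
        using that xM yM H_Gal rG by auto
      have "\<zero> = (\<Oplus>i\<in>I. \<rho> (x i) \<otimes> (\<Oplus>\<sigma>\<in>H. c \<sigma> \<otimes> \<sigma> (y i)))"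
        using all[OF yM] xM rG by (intro finsum_zeroI[symmetric]) auto
      also have "\<dots> = (\<Oplus>i\<in>I. \<Oplus>\<sigma>\<in>H. \<rho> (x i) \<otimes> (c \<sigma> \<otimes> \<sigma> (y i)))"
        using c(1) yM' xM rG H_Gal finite_H
        by (intro finsum_eq finsum_cmult) (auto intro!: finsum_closed)
      also have "\<dots> = (\<Oplus>\<sigma>\<in>H. \<Oplus>i\<in>I. \<rho> (x i) \<otimes> (c \<sigma> \<otimes> \<sigma> (y i)))"
        using c(1) yM' finite_H finite_I by (intro finsum_swap) auto
      also have "\<dots> = (\<Oplus>\<sigma>\<in>H. if \<sigma> = \<rho> then c \<sigma> else \<zero>)"
      proof (intro finsum_eq)
        fix \<sigma> assume s: "\<sigma> \<in> H"
        let ?\<tau> = "inv\<^sub>G \<rho> \<star> \<sigma>"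
        have t: "?\<tau> \<in> H" using s r H_closed by auto
        note tG = H_Gal[OF t] and sG = H_Gal[OF s]
        have "(\<Oplus>i\<in>I. \<rho> (x i) \<otimes> (c \<sigma> \<otimes> \<sigma> (y i))) = (\<Oplus>i\<in>I. c \<sigma> \<otimes> \<rho> (x i \<otimes> ?\<tau> (y i)))"
        proof (intro finsum_eq)
          fix i assume i: "i \<in> I"
          have M: "\<rho> (x i) \<in> M" "c \<sigma> \<in> M" "\<sigma> (y i) \<in> M" "?\<tau> (y i) \<in> M" using i yM yM' s c tG by auto
          have "\<rho> (?\<tau> (y i)) = \<sigma> (y i)"
            using Gal_mult_apply[OF G.inv_closed[OF rG] sG yM[OF i]]
              Gal_inv_apply(2)[OF rG M(3)] by simp
          then have "\<rho> (x i \<otimes> ?\<tau> (y i)) = \<rho> (x i) \<otimes> \<sigma> (y i)"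
            using aut_groupD(5)[OF rG xM[OF i] M(4)] by simp
          then show "\<rho> (x i) \<otimes> (c \<sigma> \<otimes> \<sigma> (y i)) = c \<sigma> \<otimes> \<rho> (x i \<otimes> ?\<tau> (y i))"
            using M M_comm[OF M(1,2)] by (simp add: m_assoc[symmetric])
        qed
        also have "\<dots> = c \<sigma> \<otimes> (\<Oplus>i\<in>I. \<rho> (x i \<otimes> ?\<tau> (y i)))"
          using finite_I s c xM yM rG tG by (intro finsum_cmult[symmetric]) auto
        also have "(\<Oplus>i\<in>I. \<rho> (x i \<otimes> ?\<tau> (y i))) = \<rho> (\<Oplus>i\<in>I. x i \<otimes> ?\<tau> (y i))"
          using xM yM tG by (intro Gal_finsum[symmetric] rG) auto
        also have "(\<Oplus>i\<in>I. x i \<otimes> ?\<tau> (y i)) = (if ?\<tau> = \<one>\<^sub>G then \<one> else \<zero>)" using orth[OF t] .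
        also have "?\<tau> = \<one>\<^sub>G \<longleftrightarrow> \<sigma> = \<rho>"
          using rG sG G.inv_equality[of "inv\<^sub>G \<rho>" \<sigma>] by (metis G.inv_closed G.inv_inv G.l_inv G.inv_comm)
        finally show "(\<Oplus>i\<in>I. \<rho> (x i) \<otimes> (c \<sigma> \<otimes> \<sigma> (y i))) = (if \<sigma> = \<rho> then c \<sigma> else \<zero>)"
          using c(1)[OF s] aut_groupD(7)[OF rG] Gal_zero[OF rG] by auto
      qed
      also have "\<dots> = c \<rho>" using finite_H r c by (intro finsum_delta) auto
      finally show ?thesis by simp
    qed
    with c(2) show False by blast
  qed
  ultimately show ?thesis using d by (metis linorder_neqE_nat)
qed

end

context galois_subgroup
begin

lemma basis_centralizer: "is_basis M C v H"
  using ex_galois_coordinates galois_coordinates.basis_C by metis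

lemma dim_fixed_field: "dimension (card H) Z M"
  using ex_galois_coordinates galois_coordinates.dim_M_over_Z by metis

lemma dim_centralizer: "dimension ((card H)\<^sup>2) Z C"
proof -
  have CR: "C \<subseteq> carrier R" using C_carrier by blast
  have "subalgebra M C R"
    using subring.axioms(1)[OF subring_C] subringE(6)[OF subring_C] M_C
    unfolding subalgebra_def subalgebra_axioms_def by blast
  then obtain d where d: "dimension d M C"
    using subalbegra_incl_imp_finite_dimension[OF subfield_M finite_dimensionI[OF dim_R_over_M] _ CR]
    unfolding finite_dimension_def by blast
  obtain e where e: "is_basis M C e {..<d}" using dimension_imp_basis[OF subfield_M d] by blast
  have "d = card H"
    using basis_card_le[OF subfield_M CR e basis_centralizer] basis_card_le[OF subfield_M CR basis_centralizer e] by simp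
  with d have "dimension (card H) M C" by simp
  from telescopic_base[OF subfield_Z subfield_M dim_fixed_field this]
  show ?thesis by (simp add: power2_eq_square)
qed

text \<open>
  A unit inducing \<open>\<tau>\<close> centralizes \<open>Z\<close>, so it is a combination of units inducing the elements of \<open>H\<close>,
  which is impossible for an eigenvector with a different character.
\<close>

theorem galois_correspondence:
  assumes \<tau>: "\<tau> \<in> carrier Gal" and fixed: "\<And>z. z \<in> Z \<Longrightarrow> \<tau> z = z"
  shows "\<tau> \<in> H"
proof (rule ccontr)
  assume notin: "\<tau> \<notin> H"
  have "v \<tau> \<in> C"
    using twistD(1)[OF v(1)[OF \<tau>]] twistD(2)[OF v(1)[OF \<tau>] Z_M] fixed by (simp add: C_def centralizer_def)
  then obtain c where c: "\<And>\<sigma>. \<sigma> \<in> H \<Longrightarrow> c \<sigma> \<in> M" "v \<tau> = (\<Oplus>\<sigma>\<in>H. c \<sigma> \<otimes> v \<sigma>)"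
    using basis_coords[OF basis_centralizer] by blast
  define w where "w \<sigma> = (if \<sigma> = \<tau> then v \<tau> else (\<ominus> c \<sigma>) \<otimes> v \<sigma>)" for \<sigma>
  have w: "w \<sigma> \<in> twist \<sigma>" if "\<sigma> \<in> insert \<tau> H" for \<sigma>
    using that v(1) c(1) \<tau> H_Gal by (auto simp: w_def intro!: twist_smult)
  have "(\<Oplus>\<sigma>\<in>insert \<tau> H. w \<sigma>) = w \<tau> \<oplus> (\<Oplus>\<sigma>\<in>H. w \<sigma>)"
    using finite_H notin w twistD(1) by (intro finsum_insert) auto
  also have "(\<Oplus>\<sigma>\<in>H. w \<sigma>) = (\<Oplus>\<sigma>\<in>H. \<ominus> (c \<sigma> \<otimes> v \<sigma>))"
    using notin c(1) v(3)[OF H_Gal] by (intro finsum_eq) (auto simp: w_def l_minus)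
  also have "\<dots> = \<ominus> v \<tau>"
    unfolding c(2) using finite_H c(1) v(3)[OF H_Gal] by (intro finsum_uminus[symmetric]) auto
  also have "w \<tau> \<oplus> \<ominus> v \<tau> = \<zero>" using v(3)[OF \<tau>] by (simp add: w_def r_neg)
  finally have sum: "(\<Oplus>\<sigma>\<in>insert \<tau> H. w \<sigma>) = \<zero>" .
  have "w \<tau> = \<zero>"
  proof (rule eigenvectors_sum_zero[of "insert \<tau> H" M w "\<lambda>\<sigma>. \<sigma>"])
    show "\<exists>z\<in>M. \<rho> z \<noteq> \<sigma> z" if "\<rho> \<in> insert \<tau> H" "\<sigma> \<in> insert \<tau> H" "\<rho> \<noteq> \<sigma>" for \<rho> \<sigma>
      using distinct_Gal that H_Gal \<tau> by blast
  qed (use finite_H w twistD H_Gal \<tau> sum in auto)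
  then have "\<one> = \<zero>" using Units_r_inv[OF v(2)[OF \<tau>]] v(4)[OF \<tau>] by (simp add: w_def)
  then show False using one_not_zero by simp
qed

text \<open>
  Some coefficient \<open>P (a \<otimes> inv (v \<sigma>))\<close> of a nonzero \<open>a\<close> is nonzero. It is a sum of two-sided multiples
  of \<open>a\<close> and, being in \<open>M\<close>, a unit.
\<close>

lemma centralizer_simple:
  assumes J: "ideal J (R\<lparr>carrier := C\<rparr>)"
  shows "J = {\<zero>} \<or> J = C"
proof (rule disjCI, rule ccontr)
  assume "J \<noteq> C" and "J \<noteq> {\<zero>}"
  interpret C: ring "R\<lparr>carrier := C\<rparr>" by (rule subring_is_ring[OF subring_C])
  interpret J: ideal J "R\<lparr>carrier := C\<rparr>" by (rule J)
  have JC: "J \<subseteq> C" using J.Icarr by auto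
  have J0: "\<zero> \<in> J" using J.zero_closed by simp
  have J_mult: "c \<otimes> a \<in> J" "a \<otimes> c \<in> J" if "a \<in> J" "c \<in> C" for a c
    using J.I_l_closed[OF that(1)] J.I_r_closed[OF that(1)] that(2) by auto
  have J_add: "a \<oplus> b \<in> J" if "a \<in> J" "b \<in> J" for a b using J.a_closed[OF that] by simp
  obtain a where a: "a \<in> J" "a \<noteq> \<zero>" using \<open>J \<noteq> {\<zero>}\<close> J0 by blast
  obtain I x y where "galois_coordinates R K M n H I x y" using ex_galois_coordinates by blast
  then interpret GC: galois_coordinates R K M n H I x y .
  have exp: "(\<Oplus>\<sigma>\<in>H. GC.P (a \<otimes> inv (v \<sigma>)) \<otimes> v \<sigma>) = a"
    using a JC by (intro GC.C_expansion) auto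
  have "\<exists>\<sigma>\<in>H. GC.P (a \<otimes> inv (v \<sigma>)) \<noteq> \<zero>"
  proof (rule ccontr)
    assume "\<not> ?thesis"
    then have "(\<Oplus>\<sigma>\<in>H. GC.P (a \<otimes> inv (v \<sigma>)) \<otimes> v \<sigma>) = \<zero>"
      using v(3)[OF H_Gal] by (intro finsum_zeroI) auto
    with exp a(2) show False by simp
  qed
  then obtain \<sigma> where s: "\<sigma> \<in> H" "GC.P (a \<otimes> inv (v \<sigma>)) \<noteq> \<zero>" by blast
  have aJ: "a \<otimes> inv (v \<sigma>) \<in> J" using J_mult a inv_v_C[OF s(1)] by blast
  then have pM: "GC.P (a \<otimes> inv (v \<sigma>)) \<in> M" using GC.P_M JC by blast
  have "GC.P (a \<otimes> inv (v \<sigma>)) \<in> J"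
    unfolding GC.P_def
  proof (rule finsum_mem[OF J0 J_add])
    show "J \<subseteq> carrier R" using JC C_carrier by blast
    show "x i \<otimes> (a \<otimes> inv (v \<sigma>)) \<otimes> y i \<in> J" if "i \<in> I" for i
      using J_mult(2)[OF J_mult(1)[OF aJ subsetD[OF M_C GC.xM[OF that]]] subsetD[OF M_C GC.yM[OF that]]] .
  qed
  then have "inv (GC.P (a \<otimes> inv (v \<sigma>))) \<otimes> GC.P (a \<otimes> inv (v \<sigma>)) \<in> J"
    using J_mult M_inv(1)[OF pM s(2)] M_C by blast
  then have "\<one> \<in> J" using M_inv(3)[OF pM s(2)] by simp
  then have "J = C" using J_mult(1)[of \<one>] JC C_carrier by force
  with \<open>J \<noteq> C\<close> show False ..
qed

lemma centralizer_center: "centralizer (R\<lparr>carrier := C\<rparr>) C = Z"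
proof
  show "Z \<subseteq> centralizer (R\<lparr>carrier := C\<rparr>) C"
    using C_comm Z_M M_C by (force simp: centralizer_def)
  show "centralizer (R\<lparr>carrier := C\<rparr>) C \<subseteq> Z"
  proof
    fix a assume "a \<in> centralizer (R\<lparr>carrier := C\<rparr>) C"
    then have a: "a \<in> C" "\<And>b. b \<in> C \<Longrightarrow> a \<otimes> b = b \<otimes> a" by (auto simp: centralizer_def)
    then have "a \<in> centralizer R M" using M_C C_carrier by (auto simp: centralizer_def)
    then have aM: "a \<in> M" using centralizer_M by simp
    show "a \<in> Z"
    proof (rule Z_I[OF aM])
      fix \<sigma> assume s: "\<sigma> \<in> H"
      note sG = H_Gal[OF s]
      have "\<sigma> a \<otimes> v \<sigma> = a \<otimes> v \<sigma>"
        using a(2)[OF twist_C[OF v(1)[OF sG] s]] twistD(2)[OF v(1)[OF sG] aM] by simp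
      then show "\<sigma> a = a"
        by (rule Units_r_cancel[OF v(2)[OF sG] M_carrier[OF Gal_closed[OF sG aM]] M_carrier[OF aM]])
    qed
  qed
qed

theorem centralizer_crossed_product: "crossed_product_algebra (R\<lparr>carrier := C\<rparr>) Z M H"
proof -
  let ?C = "R\<lparr>carrier := C\<rparr>"
  interpret C: ring ?C by (rule subring_is_ring[OF subring_C])
  have ZC: "Z \<subseteq> C" using Z_M M_C by blast
  have sub: "subfield Z ?C" "subfield M ?C"
    using subfield_in_subring[OF subring_C] subfield_Z subfield_M ZC M_C by auto
  have "central_simple_algebra_of_degree ?C Z (card H)"
    unfolding central_simple_algebra_of_degree_def
    using C.ring_axioms sub(1) centralizer_center centralizer_simple
      dimension_in_subring[OF subring_C subfield_Z dim_centralizer] by auto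
  moreover have aut: "carrier (aut_group ?C Z M) = H"
  proof
    have eq: "aut_group ?C Z M = aut_group R Z M" by (simp add: aut_group_def)
    show "carrier (aut_group ?C Z M) \<subseteq> H"
    proof
      fix f assume "f \<in> carrier (aut_group ?C Z M)"
      then have f: "f \<in> carrier (aut_group R Z M)" using eq by simp
      then have "f \<in> carrier Gal" using K_Z by (auto simp: aut_group_def)
      then show "f \<in> H" using galois_correspondence aut_groupD(8)[OF f] by blast
    qed
    show "H \<subseteq> carrier (aut_group ?C Z M)"
      using H_Gal Z_fixed unfolding eq by (auto simp: aut_group_def)
  qed
  moreover have "galois_extension_of_degree ?C Z M (card H)"
    unfolding galois_extension_of_degree_def field_extension_of_degree_def aut
    using sub dimension_in_subring[OF subring_C subfield_Z dim_fixed_field M_C] Z_M by (auto simp: Z_def)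
  ultimately show ?thesis unfolding crossed_product_algebra_def by blast
qed

end

section \<open>Cyclic extensions as quotients of twisted polynomial rings\<close>

lemma (in ring) finsum_in_subring:
  assumes B: "subring B R" and f: "\<And>i. i \<in> I \<Longrightarrow> f i \<in> B"
  shows "finsum (R\<lparr>carrier := B\<rparr>) f I = finsum R f I"
proof -
  interpret B: ring "R\<lparr>carrier := B\<rparr>" by (rule subring_is_ring[OF B])
  note BR = subsetD[OF subringE(1)[OF B]]
  show ?thesis
    using f
  proof (induct I rule: infinite_finite_induct)
    case (insert x I)
    then show ?case using BR by (simp add: Pi_def)
  qed auto
qed

lemma (in ring) uminus_in_subring:
  assumes B: "subring B R" and b: "b \<in> B"
  shows "\<ominus>\<^bsub>R\<lparr>carrier := B\<rparr>\<^esub> b = \<ominus> b"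
proof -
  interpret B: ring "R\<lparr>carrier := B\<rparr>" by (rule subring_is_ring[OF B])
  show ?thesis
    using B.minus_equality[of "\<ominus> b" b] b subringE(1,5)[OF B] by (auto simp: l_neg)
qed

text \<open>
  The data needed to evaluate a twisted polynomial over \<open>B\<close> at \<open>u\<close>, with \<open>t\<close> acting on \<open>B\<close> as conjugation
  by \<open>u\<close>; the last condition makes the evaluation injective in degrees below \<open>q\<close>.
\<close>

locale twisted_evaluation = ring R for R (structure) +
  fixes B :: "'a set" and \<tau> :: "'a \<Rightarrow> 'a" and u :: 'a and q :: nat
  assumes subring_B: "subring B R" and nontrivial: "\<one> \<noteq> \<zero>"
    and \<tau>_closed [simp, intro]: "b \<in> B \<Longrightarrow> \<tau> b \<in> B"
    and u_Units: "u \<in> Units R" and u_comm: "b \<in> B \<Longrightarrow> u \<otimes> b = \<tau> b \<otimes> u"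
    and q_pos: "q > 0" and u_pow_q: "u [^] q \<in> B"
    and powers_independent: "\<lbrakk> \<And>j. j < q \<Longrightarrow> a j \<in> B; (\<Oplus>j\<in>{..<q}. a j \<otimes> u [^] j) = \<zero>; j < q \<rbrakk> \<Longrightarrow> a j = \<zero>"
begin

lemma u_carrier [simp, intro]: "u \<in> carrier R" using u_Units by auto

lemma B_carrier [simp, intro]: "b \<in> B \<Longrightarrow> b \<in> carrier R" using subringE(1)[OF subring_B] by auto

lemma B_closed [simp, intro]:
  "\<zero> \<in> B" "\<one> \<in> B" "\<lbrakk> x \<in> B; y \<in> B \<rbrakk> \<Longrightarrow> x \<otimes> y \<in> B" "\<lbrakk> x \<in> B; y \<in> B \<rbrakk> \<Longrightarrow> x \<oplus> y \<in> B"
  "x \<in> B \<Longrightarrow> \<ominus> x \<in> B" "\<lbrakk> x \<in> B; y \<in> B \<rbrakk> \<Longrightarrow> x \<ominus> y \<in> B"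
  using subringE[OF subring_B] by (auto simp: a_minus_def)

lemma B_pow_closed [simp, intro]: "b \<in> B \<Longrightarrow> b [^] (k::nat) \<in> B"
  by (induct k) auto

definition "c = u [^] q"

lemma c_B [simp, intro]: "c \<in> B" using u_pow_q by (simp add: c_def)

lemma \<tau>_pow_closed [simp, intro]: "b \<in> B \<Longrightarrow> (\<tau> ^^ k) b \<in> B"
  by (induct k) auto

lemma u_pow_comm: "b \<in> B \<Longrightarrow> u [^] k \<otimes> b = (\<tau> ^^ k) b \<otimes> u [^] k"
proof (induct k)
  case (Suc k)
  have "u [^] Suc k \<otimes> b = u \<otimes> (u [^] k \<otimes> b)"
    using Suc(2) nat_pow_Suc2[OF u_carrier, of k] by (simp add: m_assoc)
  also have "\<dots> = u \<otimes> (\<tau> ^^ k) b \<otimes> u [^] k" using Suc by (simp add: m_assoc)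
  also have "\<dots> = (\<tau> ^^ Suc k) b \<otimes> (u \<otimes> u [^] k)"
    using Suc(2) u_comm[of "(\<tau> ^^ k) b"] by (simp add: m_assoc)
  also have "u \<otimes> u [^] k = u [^] Suc k" using nat_pow_Suc2[OF u_carrier, of k] by simp
  finally show ?case .
qed auto

text \<open>Since \<open>u\<close> is invertible, \<open>\<tau> b\<close> is determined by \<open>u \<otimes> b = \<tau> b \<otimes> u\<close>.\<close>

lemma \<tau>_pow_eqI:
  assumes "b \<in> B" "b' \<in> carrier R" "u [^] k \<otimes> b = b' \<otimes> u [^] k"
  shows "(\<tau> ^^ k) b = b'"
proof -
  have "(\<tau> ^^ k) b \<otimes> u [^] k = b' \<otimes> u [^] k" using assms u_pow_comm[of b k] by simp
  then show ?thesis
    by (rule Units_r_cancel[OF Units_pow_closed[OF u_Units] B_carrier[OF \<tau>_pow_closed[OF assms(1)]] assms(2)])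
qed

lemma \<tau>_pow_one: "(\<tau> ^^ k) \<one> = \<one>" and \<tau>_pow_zero: "(\<tau> ^^ k) \<zero> = \<zero>"
  and \<tau>_pow_c: "(\<tau> ^^ k) (\<ominus> c) = \<ominus> c"
proof -
  show "(\<tau> ^^ k) \<one> = \<one>" "(\<tau> ^^ k) \<zero> = \<zero>" by (rule \<tau>_pow_eqI; simp)+
  have "u [^] k \<otimes> c = c \<otimes> u [^] k"
    unfolding c_def by (simp add: nat_pow_mult add.commute)
  then show "(\<tau> ^^ k) (\<ominus> c) = \<ominus> c" by (intro \<tau>_pow_eqI) (auto simp: l_minus r_minus)
qed

abbreviation "B' \<equiv> R\<lparr>carrier := B\<rparr>"
abbreviation "S \<equiv> twisted_poly_ring B' \<tau>"

lemma ring_B: "ring B'" by (rule subring_is_ring[OF subring_B])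

lemma S_simps [simp]:
  "carrier S = up B'" "\<zero>\<^bsub>S\<^esub> = (\<lambda>n. \<zero>)" "\<one>\<^bsub>S\<^esub> = (\<lambda>n. if n = 0 then \<one> else \<zero>)"
  by (auto simp: twisted_poly_ring_def UP_def)

lemma up_B: "f \<in> up B' \<longleftrightarrow> (\<forall>n. f n \<in> B) \<and> (\<exists>N. \<forall>n>N. f n = \<zero>)"
  by (auto simp: up_def bound_def)

lemma up_B_mem [simp, intro]: "f \<in> up B' \<Longrightarrow> f n \<in> B"
  by (simp add: up_B)

lemma S_coeff: "f \<in> up B' \<Longrightarrow> coeff S f = f"
  by (simp add: twisted_poly_ring_def UP_def)

lemma S_monom: "b \<in> B \<Longrightarrow> monom S b k = (\<lambda>n. if n = k then b else \<zero>)"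
  by (auto simp: twisted_poly_ring_def UP_def)

lemma monom_up: "b \<in> B \<Longrightarrow> (\<lambda>n. if n = k then b else \<zero>) \<in> up B'"
  by (auto simp: up_B intro!: exI[of _ k])

lemma S_add: "\<lbrakk> f \<in> up B'; g \<in> up B' \<rbrakk> \<Longrightarrow> f \<oplus>\<^bsub>S\<^esub> g = (\<lambda>n. f n \<oplus> g n)"
  by (simp add: twisted_poly_ring_def UP_def)

lemma add_up:
  assumes "f \<in> up B'" "g \<in> up B'" shows "(\<lambda>n. f n \<oplus> g n) \<in> up B'"
  using ring.up_add_closed[OF ring_B assms] by simp

lemma S_mult:
  assumes "f \<in> up B'" "g \<in> up B'"
  shows "f \<otimes>\<^bsub>S\<^esub> g = (\<lambda>n. \<Oplus>i\<in>{..n}. f i \<otimes> (\<tau> ^^ i) (g (n - i)))"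
proof
  fix n
  have "(f \<otimes>\<^bsub>S\<^esub> g) n = finsum B' (\<lambda>i. f i \<otimes> (\<tau> ^^ i) (g (n - i))) {..n}"
    using assms by (simp add: twisted_poly_ring_def)
  also have "\<dots> = (\<Oplus>i\<in>{..n}. f i \<otimes> (\<tau> ^^ i) (g (n - i)))"
    using assms by (intro finsum_in_subring[OF subring_B]) auto
  finally show "(f \<otimes>\<^bsub>S\<^esub> g) n = (\<Oplus>i\<in>{..n}. f i \<otimes> (\<tau> ^^ i) (g (n - i)))" .
qed

lemma mult_zero_above:
  assumes f: "f \<in> up B'" "\<And>n. n > N \<Longrightarrow> f n = \<zero>" and g: "g \<in> up B'" "\<And>n. n > L \<Longrightarrow> g n = \<zero>"
    and n: "n > N + L"
  shows "(f \<otimes>\<^bsub>S\<^esub> g) n = \<zero>"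
  unfolding S_mult[OF f(1) g(1)]
proof (rule finsum_zeroI)
  fix i
  show "f i \<otimes> (\<tau> ^^ i) (g (n - i)) = \<zero>"
  proof (cases "i > N")
    case False
    then have "g (n - i) = \<zero>" using n by (intro g(2)) auto
    then show ?thesis using f(1) \<tau>_pow_zero by simp
  qed (use f(2) g(1) in simp)
qed

lemma mult_up:
  assumes f: "f \<in> up B'" and g: "g \<in> up B'"
  shows "f \<otimes>\<^bsub>S\<^esub> g \<in> up B'"
proof -
  obtain N where N: "\<And>n. n > N \<Longrightarrow> f n = \<zero>" using f by (auto simp: up_B)
  obtain L where L: "\<And>n. n > L \<Longrightarrow> g n = \<zero>" using g by (auto simp: up_B)
  have "(f \<otimes>\<^bsub>S\<^esub> g) n \<in> B" for n
    unfolding S_mult[OF f g] using f g by (intro finsum_subring[OF subring_B]) auto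
  then show ?thesis using mult_zero_above[OF f N g L] unfolding up_B by blast
qed

text \<open>The sum runs over the support, so that it does not depend on a degree bound.\<close>

definition ev :: "(nat \<Rightarrow> 'a) \<Rightarrow> 'a" where
  "ev f = (\<Oplus>i\<in>{i. f i \<noteq> \<zero>}. f i \<otimes> u [^] i)"

lemma ev_eq:
  assumes "f \<in> up B'" "finite J" "\<And>i. i \<notin> J \<Longrightarrow> f i = \<zero>"
  shows "ev f = (\<Oplus>i\<in>J. f i \<otimes> u [^] i)"
  unfolding ev_def using assms
  by (intro add.finprod_mono_neutral_cong_left) auto

lemma ev_atMost:
  assumes "f \<in> up B'" "\<And>n. n > N \<Longrightarrow> f n = \<zero>"
  shows "ev f = (\<Oplus>i\<in>{..N}. f i \<otimes> u [^] i)"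
  using assms by (intro ev_eq) auto

lemma ev_monom: "b \<in> B \<Longrightarrow> ev (\<lambda>n. if n = k then b else \<zero>) = b \<otimes> u [^] k"
  using ev_eq[OF monom_up, of b "{k}" k] by simp

lemma ev_add:
  assumes f: "f \<in> up B'" and g: "g \<in> up B'"
  shows "ev (\<lambda>n. f n \<oplus> g n) = ev f \<oplus> ev g"
proof -
  obtain N where N: "\<And>n. n > N \<Longrightarrow> f n = \<zero>" using f by (auto simp: up_B)
  obtain L where L: "\<And>n. n > L \<Longrightarrow> g n = \<zero>" using g by (auto simp: up_B)
  have "ev (\<lambda>n. f n \<oplus> g n) = (\<Oplus>i\<in>{..N+L}. (f i \<oplus> g i) \<otimes> u [^] i)"
    using N L by (intro ev_atMost add_up f g) auto
  also have "\<dots> = (\<Oplus>i\<in>{..N+L}. f i \<otimes> u [^] i \<oplus> g i \<otimes> u [^] i)"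
    using f g by (intro finsum_eq) (auto simp: l_distr)
  also have "\<dots> = (\<Oplus>i\<in>{..N+L}. f i \<otimes> u [^] i) \<oplus> (\<Oplus>i\<in>{..N+L}. g i \<otimes> u [^] i)"
    using f g by (intro finsum_addf) auto
  also have "(\<Oplus>i\<in>{..N+L}. f i \<otimes> u [^] i) = ev f" using N by (intro ev_atMost[symmetric] f) auto
  also have "(\<Oplus>i\<in>{..N+L}. g i \<otimes> u [^] i) = ev g" using L by (intro ev_atMost[symmetric] g) auto
  finally show ?thesis .
qed

lemma ev_carrier: "f \<in> up B' \<Longrightarrow> ev f \<in> carrier R"
  unfolding ev_def by (intro finsum_closed) auto

text \<open>Evaluation respects the twisted product because \<open>u [^] i \<otimes> b = (\<tau> ^^ i) b \<otimes> u [^] i\<close>.\<close>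

lemma ev_mult:
  assumes f: "f \<in> up B'" and g: "g \<in> up B'"
  shows "ev (f \<otimes>\<^bsub>S\<^esub> g) = ev f \<otimes> ev g"
proof -
  obtain N where N: "\<And>n. n > N \<Longrightarrow> f n = \<zero>" using f by (auto simp: up_B)
  obtain L where L: "\<And>n. n > L \<Longrightarrow> g n = \<zero>" using g by (auto simp: up_B)
  let ?K = "N + L"
  define h where "h i n = (if i \<le> n then f i \<otimes> (\<tau> ^^ i) (g (n - i)) \<otimes> u [^] n else \<zero>)" for i n
  have hR: "h i n \<in> carrier R" for i n using f g by (auto simp: h_def)
  have "ev (f \<otimes>\<^bsub>S\<^esub> g) = (\<Oplus>n\<in>{..?K}. (f \<otimes>\<^bsub>S\<^esub> g) n \<otimes> u [^] n)"
    using mult_zero_above[OF f N g L] by (intro ev_atMost mult_up f g) auto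
  also have "\<dots> = (\<Oplus>n\<in>{..?K}. \<Oplus>i\<in>{..?K}. h i n)"
  proof (intro finsum_eq)
    fix n assume n: "n \<in> {..?K}"
    have "(f \<otimes>\<^bsub>S\<^esub> g) n \<otimes> u [^] n = (\<Oplus>i\<in>{..n}. f i \<otimes> (\<tau> ^^ i) (g (n - i)) \<otimes> u [^] n)"
      unfolding S_mult[OF f g] using f g by (intro finsum_cmult) auto
    also have "\<dots> = (\<Oplus>i\<in>{..n}. h i n)" using f g by (intro finsum_eq) (auto simp: h_def)
    also have "\<dots> = (\<Oplus>i\<in>{..?K}. h i n)"
      using n hR by (intro add.finprod_mono_neutral_cong_left) (auto simp: h_def)
    finally show "(f \<otimes>\<^bsub>S\<^esub> g) n \<otimes> u [^] n = (\<Oplus>i\<in>{..?K}. h i n)" .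
  qed
  also have "\<dots> = (\<Oplus>i\<in>{..?K}. \<Oplus>n\<in>{..?K}. h i n)"
    using hR by (intro finsum_swap) auto
  also have "\<dots> = (\<Oplus>i\<in>{..?K}. f i \<otimes> u [^] i \<otimes> ev g)"
  proof (intro finsum_eq)
    fix i assume i: "i \<in> {..?K}"
    show "(\<Oplus>n\<in>{..?K}. h i n) = f i \<otimes> u [^] i \<otimes> ev g"
    proof (cases "i > N")
      case True
      then have "(\<Oplus>n\<in>{..?K}. h i n) = \<zero>" using N g by (intro finsum_zeroI) (auto simp: h_def)
      then show ?thesis using True N g ev_carrier by simp
    next
      case False
      have img: "(+) i ` {..?K - i} = {i..?K}"
      proof (intro subset_antisym subsetI)
        fix n assume "n \<in> {i..?K}"
        then have "n = i + (n - i)" "n - i \<in> {..?K - i}" by auto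
        then show "n \<in> (+) i ` {..?K - i}" by (rule image_eqI)
      qed (use i in auto)
      have "(\<Oplus>n\<in>{..?K}. h i n) = (\<Oplus>n\<in>{i..?K}. h i n)"
        using hR by (intro add.finprod_mono_neutral_cong_left[symmetric]) (auto simp: h_def)
      also have "\<dots> = (\<Oplus>n\<in>(+) i ` {..?K - i}. h i n)" by (simp only: img)
      also have "\<dots> = (\<Oplus>j\<in>{..?K - i}. h i (i + j))"
        using hR by (intro finsum_reindex) auto
      also have "\<dots> = (\<Oplus>j\<in>{..?K - i}. f i \<otimes> u [^] i \<otimes> (g j \<otimes> u [^] j))"
      proof (intro finsum_eq)
        fix j
        have "f i \<otimes> u [^] i \<otimes> (g j \<otimes> u [^] j) = f i \<otimes> (u [^] i \<otimes> g j) \<otimes> u [^] j"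
          using f g by (simp add: m_assoc)
        also have "\<dots> = f i \<otimes> (\<tau> ^^ i) (g j) \<otimes> (u [^] i \<otimes> u [^] j)"
          using f g u_pow_comm[of "g j" i] by (simp add: m_assoc)
        finally show "h i (i + j) = f i \<otimes> u [^] i \<otimes> (g j \<otimes> u [^] j)"
          by (simp add: h_def nat_pow_mult)
      qed
      also have "\<dots> = f i \<otimes> u [^] i \<otimes> (\<Oplus>j\<in>{..?K - i}. g j \<otimes> u [^] j)"
        using f g by (intro finsum_cmult[symmetric]) auto
      also have "(\<Oplus>j\<in>{..?K - i}. g j \<otimes> u [^] j) = ev g"
        using L False by (intro ev_atMost[symmetric] g) auto
      finally show ?thesis .
    qed
  qed
  also have "\<dots> = (\<Oplus>i\<in>{..?K}. f i \<otimes> u [^] i) \<otimes> ev g"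
    using f g ev_carrier by (intro finsum_cmult[symmetric]) auto
  also have "(\<Oplus>i\<in>{..?K}. f i \<otimes> u [^] i) = ev f"
    using N by (intro ev_atMost[symmetric] f) auto
  finally show ?thesis .
qed

abbreviation "p \<equiv> pure_poly B' \<tau> q c"

lemma pure_poly_eq: "p = (\<lambda>n. if n = q then \<one> else if n = 0 then \<ominus> c else \<zero>)"
proof -
  have car: "carrier (UP B') = up B'" and coeff: "\<And>f. f \<in> up B' \<Longrightarrow> coeff (UP B') f = f"
    by (simp_all add: UP_def)
  interpret UB: UP_ring B' "UP B'"
    by (intro UP_ring.intro ring_B) (simp add: UP_def)
  let ?m = "\<lambda>n. if n = 0 then c else \<zero>"
  have m: "?m \<in> up B'" using monom_up[OF c_B, of 0] .
  have inv_eq: "\<ominus>\<^bsub>S\<^esub> ?m = \<ominus>\<^bsub>UP B'\<^esub> ?m"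
  proof -
    have "add_monoid S = add_monoid (UP B')" by (simp add: twisted_poly_ring_def)
    then show ?thesis unfolding a_inv_def by (rule arg_cong)
  qed
  have mP: "?m \<in> carrier (UP B')" using m unfolding car .
  have iP: "\<ominus>\<^bsub>UP B'\<^esub> ?m \<in> up B'" using UB.P.a_inv_closed[OF mP] by (simp only: car)
  have "(\<ominus>\<^bsub>UP B'\<^esub> ?m) n = \<ominus>\<^bsub>B'\<^esub> (?m n)" for n
    using UB.coeff_a_inv[OF mP, of n] unfolding coeff[OF iP] coeff[OF m] .
  then have i: "(\<ominus>\<^bsub>S\<^esub> ?m) n = (if n = 0 then \<ominus> c else \<zero>)" for n
    unfolding inv_eq using uminus_in_subring[OF subring_B] by auto
  have "p = (\<lambda>n. if n = q then \<one> else \<zero>) \<oplus>\<^bsub>S\<^esub> (\<ominus>\<^bsub>S\<^esub> ?m)"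
    by (simp add: pure_poly_def a_minus_def S_monom)
  also have "\<dots> = (\<lambda>n. (if n = q then \<one> else \<zero>) \<oplus> (\<ominus>\<^bsub>S\<^esub> ?m) n)"
    using monom_up[of \<one> q] iP inv_eq by (intro S_add) auto
  also have "\<dots> = (\<lambda>n. if n = q then \<one> else if n = 0 then \<ominus> c else \<zero>)"
    using q_pos by (auto simp: i)
  finally show ?thesis .
qed

lemma p_up: "p \<in> up B'"
  unfolding pure_poly_eq up_B by (auto intro!: exI[of _ q])

lemma ev_p: "ev p = \<zero>"
proof -
  have "ev p = (\<Oplus>i\<in>{0, q}. p i \<otimes> u [^] i)"
    by (intro ev_eq p_up) (auto simp: pure_poly_eq)
  also have "\<dots> = \<ominus> c \<oplus> u [^] q" using q_pos by (simp add: pure_poly_eq)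
  finally show ?thesis by (simp add: c_def l_neg)
qed

lemma deg_p: "deg B' p = q"
proof -
  have c: "coeff (UP B') p = p" using p_up by (simp add: UP_def)
  show ?thesis
    unfolding deg_def c
  proof (rule Least_equality)
    show "bound \<zero>\<^bsub>B'\<^esub> q p" by (auto simp: pure_poly_eq)
    show "q \<le> y" if "bound \<zero>\<^bsub>B'\<^esub> y p" for y
      using bound_below[OF that, of q] nontrivial by (simp add: pure_poly_eq)
  qed
qed

lemma polys_below_iff: "f \<in> polys_below B' \<tau> p \<longleftrightarrow> f \<in> up B' \<and> (\<forall>i\<ge>q. f i = \<zero>)"
  unfolding polys_below_def deg_p using S_coeff by auto

lemma ev_below: "f \<in> polys_below B' \<tau> p \<Longrightarrow> ev f = (\<Oplus>i\<in>{..<q}. f i \<otimes> u [^] i)"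
  by (intro ev_eq) (auto simp: polys_below_iff)

lemma ev_inj: "inj_on ev (polys_below B' \<tau> p)"
proof (rule inj_onI, rule ext)
  fix f g n assume f: "f \<in> polys_below B' \<tau> p" and g: "g \<in> polys_below B' \<tau> p" and eq: "ev f = ev g"
  have fB: "f i \<in> B" "g i \<in> B" for i using f g by (auto simp: polys_below_iff)
  have "(\<Oplus>i\<in>{..<q}. (f i \<ominus> g i) \<otimes> u [^] i) = (\<Oplus>i\<in>{..<q}. f i \<otimes> u [^] i \<ominus> g i \<otimes> u [^] i)"
    using fB by (intro finsum_eq) (auto simp: a_minus_def l_distr l_minus)
  also have "\<dots> = (\<Oplus>i\<in>{..<q}. f i \<otimes> u [^] i) \<ominus> (\<Oplus>i\<in>{..<q}. g i \<otimes> u [^] i)"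
    using fB by (intro finsum_minus) auto
  also have "\<dots> = ev g \<ominus> ev g" using eq ev_below[OF f] ev_below[OF g] by simp
  also have "\<dots> = \<zero>" using ev_carrier[of g] g by (simp add: polys_below_iff)
  finally have s: "(\<Oplus>i\<in>{..<q}. (f i \<ominus> g i) \<otimes> u [^] i) = \<zero>" .
  show "f n = g n"
  proof (cases "n < q")
    case True
    have "f n \<ominus> g n = \<zero>" using powers_independent[of "\<lambda>i. f i \<ominus> g i" n] s True fB by auto
    then show ?thesis using fB minus_eq_zero_iff by auto
  next
    case False
    then show ?thesis using f g by (simp add: polys_below_iff)
  qed
qed

text \<open>
  Dividing by \<open>t\<^sup>q - c\<close> amounts to solving \<open>s (n - q) - s n \<cdot> c = g n\<close> for \<open>n \<ge> q\<close> from the top, so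
  the quotient is \<open>s n = g (n + q) + g (n + 2 q) \<cdot> c + g (n + 3 q) \<cdot> c\<^sup>2 + \<dots>\<close>.
\<close>

lemma division_exists:
  assumes g: "g \<in> up B'"
  shows "\<exists>r\<in>polys_below B' \<tau> p. \<exists>s\<in>up B'. g = (s \<otimes>\<^bsub>S\<^esub> p) \<oplus>\<^bsub>S\<^esub> r"
proof -
  obtain N where N: "\<And>n. n > N \<Longrightarrow> g n = \<zero>" using g by (auto simp: up_B)
  define s where "s n = (\<Oplus>l\<in>{..N}. g (n + Suc l * q) \<otimes> c [^] l)" for n
  \<comment> \<open>The summands with \<open>l > N\<close> vanish because \<open>N\<close> bounds the degree of \<open>g\<close>.\<close>
  have sB: "s n \<in> B" for n unfolding s_def using g by (intro finsum_subring[OF subring_B]) auto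
  have "s n = \<zero>" if "n > N" for n
    unfolding s_def using that by (intro finsum_zeroI) (auto simp: N)
  then have s: "s \<in> up B'" using sB unfolding up_B by blast
  define r where "r n = g n \<ominus> (s \<otimes>\<^bsub>S\<^esub> p) n" for n
  have sp: "s \<otimes>\<^bsub>S\<^esub> p \<in> up B'" using mult_up[OF s p_up] .
  obtain L where L: "\<And>n. n > L \<Longrightarrow> (s \<otimes>\<^bsub>S\<^esub> p) n = \<zero>" using sp by (auto simp: up_B)
  have "\<forall>n>N + L. r n = \<zero>" using N L by (auto simp: r_def a_minus_def)
  then have r: "r \<in> up B'" using g sp unfolding up_B r_def by blast
  have "r n = \<zero>" if n: "n \<ge> q" for n
  proof -
    let ?h = "\<lambda>l. g (n + l * q) \<otimes> c [^] l"
    have hR: "?h l \<in> carrier R" for l using g by auto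
    have "(s \<otimes>\<^bsub>S\<^esub> p) n = (\<Oplus>i\<in>{..n}. s i \<otimes> (\<tau> ^^ i) (p (n - i)))" by (simp add: S_mult[OF s p_up])
    also have "\<dots> = (\<Oplus>i\<in>{n - q, n}. s i \<otimes> (\<tau> ^^ i) (p (n - i)))"
      using sB p_up by (intro add.finprod_mono_neutral_cong_right)
        (auto simp: pure_poly_eq \<tau>_pow_zero)
    also have "\<dots> = s (n - q) \<oplus> s n \<otimes> (\<ominus> c)"
      using n q_pos sB by (simp add: pure_poly_eq \<tau>_pow_one \<tau>_pow_c)
    also have "\<dots> = s (n - q) \<ominus> s n \<otimes> c" using sB by (simp add: a_minus_def r_minus)
    also have "s (n - q) = (\<Oplus>l\<in>{..N}. ?h l)"
      unfolding s_def using n g by (intro finsum_eq) auto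
    also have "s n \<otimes> c = (\<Oplus>l\<in>{..N}. g (n + Suc l * q) \<otimes> c [^] l \<otimes> c)"
      unfolding s_def using g by (intro finsum_cmult) auto
    also have "\<dots> = (\<Oplus>l\<in>{..N}. ?h (Suc l))"
      using g by (intro finsum_eq) (auto simp: m_assoc)
    also have "(\<Oplus>l\<in>{..N}. ?h l) = (\<Oplus>l\<in>{..N}. ?h (Suc l)) \<oplus> g n"
    proof -
      have "N < n + Suc N * q" using q_pos by (cases q) auto
      then have "(\<Oplus>l\<in>{..Suc N}. ?h l) = (\<Oplus>l\<in>{..N}. ?h l)"
        using hR N by (simp add: Pi_def)
      moreover have "(\<Oplus>l\<in>{..Suc N}. ?h l) = (\<Oplus>l\<in>{..N}. ?h (Suc l)) \<oplus> ?h 0"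
        using hR by (intro finsum_Suc2) auto
      ultimately show ?thesis using g by simp
    qed
    finally have "(s \<otimes>\<^bsub>S\<^esub> p) n = (\<Oplus>l\<in>{..N}. ?h (Suc l)) \<oplus> g n \<ominus> (\<Oplus>l\<in>{..N}. ?h (Suc l))" .
    moreover have "(\<Oplus>l\<in>{..N}. ?h (Suc l)) \<in> carrier R" using g by (intro finsum_closed) auto
    ultimately have "(s \<otimes>\<^bsub>S\<^esub> p) n = g n"
      using g by (simp add: a_minus_def a_comm[of _ "g n"] a_assoc r_neg)
    then show ?thesis using g by (simp add: r_def)
  qed
  then have "r \<in> polys_below B' \<tau> p" using r by (simp add: polys_below_iff)
  moreover have "g = (s \<otimes>\<^bsub>S\<^esub> p) \<oplus>\<^bsub>S\<^esub> r"
  proof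
    fix n
    have "(s \<otimes>\<^bsub>S\<^esub> p) n \<in> carrier R" "g n \<in> carrier R" using sp g by auto
    then have "(s \<otimes>\<^bsub>S\<^esub> p) n \<oplus> r n = g n"
      by (simp add: r_def a_minus_def a_comm[of "g n"] a_assoc[symmetric] r_neg)
    then show "g n = ((s \<otimes>\<^bsub>S\<^esub> p) \<oplus>\<^bsub>S\<^esub> r) n" by (simp add: S_add[OF sp r])
  qed
  ultimately show ?thesis using s by blast
qed

lemma ev_remainder:
  assumes "r \<in> polys_below B' \<tau> p" "s \<in> up B'"
  shows "ev ((s \<otimes>\<^bsub>S\<^esub> p) \<oplus>\<^bsub>S\<^esub> r) = ev r"
  using assms p_up by (simp add: S_add mult_up polys_below_iff ev_add ev_mult ev_p ev_carrier)

text \<open>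
  Evaluation kills the multiples of \<open>p\<close> and is injective below degree \<open>q\<close>, so the remainder is unique
  and has the same value at \<open>u\<close> as the dividend.
\<close>

lemma right_remainder:
  assumes g: "g \<in> up B'"
  shows "right_remainder B' \<tau> p g \<in> polys_below B' \<tau> p" "ev (right_remainder B' \<tau> p g) = ev g"
proof -
  obtain r s where rs: "r \<in> polys_below B' \<tau> p" "s \<in> up B'" "g = (s \<otimes>\<^bsub>S\<^esub> p) \<oplus>\<^bsub>S\<^esub> r"
    using division_exists[OF g] by blast
  have er: "ev r = ev g" using rs ev_remainder by simp
  have "right_remainder B' \<tau> p g = r"
    unfolding right_remainder_def
  proof (rule the_equality)
    fix r' assume r': "r' \<in> polys_below B' \<tau> p \<and> (\<exists>s\<in>carrier S. g = s \<otimes>\<^bsub>S\<^esub> p \<oplus>\<^bsub>S\<^esub> r')"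
    then have "ev r' = ev g" using ev_remainder by auto
    then show "r' = r" using er r' rs(1) inj_onD[OF ev_inj] by auto
  qed (use rs in auto)
  then show "right_remainder B' \<tau> p g \<in> polys_below B' \<tau> p" "ev (right_remainder B' \<tau> p g) = ev g"
    using rs er by auto
qed

text \<open>
  The isomorphism is the inverse of evaluation at \<open>u\<close> on the polynomials of degree below \<open>q\<close>.
\<close>

theorem iso_twisted_poly_quotient:
  assumes C: "subring C R" "B \<subseteq> C" "u \<in> C" and Z: "Z \<subseteq> B"
    and span: "\<And>x. x \<in> C \<Longrightarrow> \<exists>a. (\<forall>j<q. a j \<in> B) \<and> x = (\<Oplus>j\<in>{..<q}. a j \<otimes> u [^] j)"
  shows "iso_twisted_poly_quotient Z (R\<lparr>carrier := C\<rparr>) B' \<tau> q (u [^] q)"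
proof -
  let ?D = "polys_below B' \<tau> p"
  have uC: "u [^] k \<in> C" for k :: nat using subringE(3,6)[OF C(1)] C(3) by (induct k) auto
  have ev_C: "ev f \<in> C" if "f \<in> ?D" for f
    unfolding ev_below[OF that] using that uC subringE(6)[OF C(1)] C(2)
    by (intro finsum_subring[OF C(1)]) (auto simp: polys_below_iff subset_iff)
  have bij: "bij_betw ev ?D C"
    unfolding bij_betw_def
  proof (intro conjI ev_inj subset_antisym subsetI)
    fix x assume "x \<in> C"
    then obtain a where a: "\<forall>j<q. a j \<in> B" "x = (\<Oplus>j\<in>{..<q}. a j \<otimes> u [^] j)" using span by blast
    let ?f = "\<lambda>j. if j < q then a j else \<zero>"
    have f: "?f \<in> ?D" using a(1) by (auto simp: polys_below_iff up_B intro!: exI[of _ q])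
    have "ev ?f = (\<Oplus>j\<in>{..<q}. a j \<otimes> u [^] j)"
      unfolding ev_below[OF f] using a(1) by (intro finsum_eq) auto
    with a(2) have "x = ev ?f" by metis
    then show "x \<in> ev ` ?D" using imageI[OF f, of ev] by (simp only:)
  qed (use ev_C in auto)
  let ?\<phi> = "inv_into ?D ev"
  have \<phi>_mem: "?\<phi> x \<in> ?D" "ev (?\<phi> x) = x" if "x \<in> C" for x
    using bij that by (auto simp: bij_betw_def inv_into_into f_inv_into_f)
  have \<phi>_eqI: "?\<phi> x = f" if "f \<in> ?D" "ev f = x" for f x
    using that ev_inj by (auto simp: inv_into_f_f)
  have up: "f \<in> up B'" if "f \<in> ?D" for f using that by (simp add: polys_below_iff)
  have monom: "monom S z 0 \<in> ?D" "ev (monom S z 0) = z" if "z \<in> B" for z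
    using that monom_up[OF that, of 0] q_pos ev_monom[OF that, of 0] by (auto simp: S_monom polys_below_iff)
  have one_S: "\<one>\<^bsub>S\<^esub> = monom S \<one> 0" by (auto simp: S_monom)
  have "?\<phi> \<in> ring_iso (R\<lparr>carrier := C\<rparr>) (twisted_poly_quotient B' \<tau> p)"
    unfolding ring_iso_def
  proof (intro CollectI conjI ring_hom_memI)
    show "bij_betw ?\<phi> (carrier (R\<lparr>carrier := C\<rparr>)) (carrier (twisted_poly_quotient B' \<tau> p))"
      using bij_betw_inv_into[OF bij] by (simp add: twisted_poly_quotient_def)
    show "?\<phi> \<one>\<^bsub>R\<lparr>carrier := C\<rparr>\<^esub> = \<one>\<^bsub>twisted_poly_quotient B' \<tau> p\<^esub>"
      using \<phi>_eqI[OF monom[of \<one>]] one_S by (simp add: twisted_poly_quotient_def)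
  next
    fix x assume "x \<in> carrier (R\<lparr>carrier := C\<rparr>)"
    then show "?\<phi> x \<in> carrier (twisted_poly_quotient B' \<tau> p)"
      using \<phi>_mem by (simp add: twisted_poly_quotient_def)
  next
    fix x y assume "x \<in> carrier (R\<lparr>carrier := C\<rparr>)" "y \<in> carrier (R\<lparr>carrier := C\<rparr>)"
    then have xy: "x \<in> C" "y \<in> C" by auto
    note x = \<phi>_mem[OF xy(1)] and y = \<phi>_mem[OF xy(2)]
    note ux = up[OF x(1)] and uy = up[OF y(1)]
    have "?\<phi> (x \<otimes> y) = right_remainder B' \<tau> p (?\<phi> x \<otimes>\<^bsub>S\<^esub> ?\<phi> y)"
      using right_remainder[OF mult_up[OF ux uy]] ev_mult[OF ux uy] x y by (intro \<phi>_eqI) auto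
    then show "?\<phi> (x \<otimes>\<^bsub>R\<lparr>carrier := C\<rparr>\<^esub> y) = ?\<phi> x \<otimes>\<^bsub>twisted_poly_quotient B' \<tau> p\<^esub> ?\<phi> y"
      by (simp add: twisted_poly_quotient_def)
    have "?\<phi> (x \<oplus> y) = ?\<phi> x \<oplus>\<^bsub>S\<^esub> ?\<phi> y"
      unfolding S_add[OF ux uy] using ev_add[OF ux uy] add_up[OF ux uy] x y
      by (intro \<phi>_eqI) (auto simp: polys_below_iff)
    then show "?\<phi> (x \<oplus>\<^bsub>R\<lparr>carrier := C\<rparr>\<^esub> y) = ?\<phi> x \<oplus>\<^bsub>twisted_poly_quotient B' \<tau> p\<^esub> ?\<phi> y"
      by (simp add: twisted_poly_quotient_def)
  qed
  moreover have "\<forall>z\<in>Z. ?\<phi> z = monom S z 0" using Z by (auto intro!: \<phi>_eqI monom)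
  ultimately show ?thesis unfolding iso_twisted_poly_quotient_def c_def[symmetric] by blast
qed

end

section \<open>One cyclic step\<close>

text \<open>
  The coset of \<open>s\<close> generates the quotient, so it has order \<open>q\<close> and its powers are all the cosets.
\<close>

lemma (in group) cyclic_step_powers:
  assumes N: "subgroup N G" and H: "subgroup H G" and step: "cyclic_step G N H q s" and q: "q > 0"
  shows "N \<subseteq> H" "s \<in> H" "s [^] q \<in> N" "\<And>m. \<lbrakk> 0 < m; m < q \<rbrakk> \<Longrightarrow> s [^] m \<notin> N"
    "\<And>h. h \<in> H \<Longrightarrow> \<exists>l<q. \<exists>g\<in>N. h = g \<otimes> s [^] l"
    "\<And>g. g \<in> N \<Longrightarrow> s \<otimes> g \<otimes> inv s \<in> N" "\<And>g. g \<in> N \<Longrightarrow> inv s \<otimes> g \<otimes> s \<in> N"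
proof -
  let ?H = "G\<lparr>carrier := H\<rparr>"
  let ?Q = "?H Mod N"
  let ?x = "N #> s"
  have nrm: "N \<lhd> ?H" and ord: "order ?Q = q" and sH: "s \<in> H"
    and gen: "generate ?Q {?x} = carrier ?Q"
    using step by (auto simp: cyclic_step_def)
  interpret HG: group ?H using subgroup.subgroup_is_group[OF H is_group] .
  interpret N: normal N ?H by (rule nrm)
  interpret Q: group ?Q by (rule N.factorgroup_is_group)
  have NH: "subgroup N ?H" by (rule N.subgroup_axioms)
  show "N \<subseteq> H" using N.subset by simp
  show "s \<in> H" by (rule sH)
  have HG: "h \<in> H \<Longrightarrow> h \<in> carrier G" for h using subgroup.subset[OF H] by auto
  show "s \<otimes> g \<otimes> inv s \<in> N" "inv s \<otimes> g \<otimes> s \<in> N" if "g \<in> N" for g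
    using N.inv_op_closed2[of s g] N.inv_op_closed1[of s g] that sH m_inv_consistent[OF H sH] by auto
  have pow: "s [^]\<^bsub>?H\<^esub> k = s [^] k" for k :: nat using nat_pow_consistent by simp
  have powH: "s [^] k \<in> H" for k :: nat using HG.nat_pow_closed[of s k] sH pow by simp
  have xQ: "?x \<in> carrier ?Q" using sH by (auto simp: FactGroup_def RCOSETS_def)
  have xpow: "?x [^]\<^bsub>?Q\<^esub> k = N #> s [^] k" for k :: nat
    using N.FactGroup_pow[of s k] sH pow by simp
  have ordx: "Q.ord ?x = q"
    using Q.generate_pow_card[OF xQ] gen ord by (simp add: order_def)
  have coset_N: "N #> h = N \<longleftrightarrow> h \<in> N" if "h \<in> H" for h
    using HG.coset_join1[of N h] N.rcos_const[OF HG.is_group, of h] NH that by auto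
  show "s [^] q \<in> N"
    using Q.pow_ord_eq_1[OF xQ] ordx xpow coset_N[OF powH] by simp
  show "s [^] m \<notin> N" if "0 < m" "m < q" for m
    using Q.pow_eq_id[OF xQ, of m] ordx that coset_N[OF powH, of m] xpow by (auto dest: dvd_imp_le)
  show "\<exists>l<q. \<exists>g\<in>N. h = g \<otimes> s [^] l" if h: "h \<in> H" for h
  proof -
    have "N #> h \<in> carrier ?Q" using h by (auto simp: FactGroup_def RCOSETS_def)
    then have "N #> h \<in> generate ?Q {?x}" using gen by simp
    then obtain k :: nat where k: "N #> h = ?x [^]\<^bsub>?Q\<^esub> k"
      using Q.generate_pow_nat[OF xQ] ordx q by auto
    have "?x [^]\<^bsub>?Q\<^esub> k = ?x [^]\<^bsub>?Q\<^esub> (q * (k div q) + k mod q)" by simp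
    also have "\<dots> = (?x [^]\<^bsub>?Q\<^esub> q) [^]\<^bsub>?Q\<^esub> (k div q) \<otimes>\<^bsub>?Q\<^esub> ?x [^]\<^bsub>?Q\<^esub> (k mod q)"
      using xQ by (simp only: Q.nat_pow_mult[symmetric] Q.nat_pow_pow)
    also have "\<dots> = ?x [^]\<^bsub>?Q\<^esub> (k mod q)"
      using Q.pow_ord_eq_1[OF xQ] ordx Q.nat_pow_closed[OF xQ] Q.l_one Q.nat_pow_one by metis
    finally have "N #> h = N #> s [^] (k mod q)" using k xpow by simp
    moreover have "h \<in> N #> h" using HG.rcos_self[of h N] h NH by simp
    ultimately have "h \<in> N #> s [^] (k mod q)" by simp
    then obtain g where "g \<in> N" "h = g \<otimes> s [^] (k mod q)" by (auto simp: r_coset_def)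
    moreover have "k mod q < q" using q by simp
    ultimately show ?thesis by blast
  qed
qed

context central_simple_with_subfield
begin

lemma twist_pow:
  assumes "u \<in> twist \<sigma>" "\<sigma> \<in> carrier Gal"
  shows "u [^] (k::nat) \<in> twist (\<sigma> [^]\<^sub>G k)"
proof (induct k)
  case 0
  show ?case by (auto simp: twist_def Gal_one_apply)
next
  case (Suc k)
  interpret G: group Gal by (rule group_Gal)
  show ?case using twist_mult[OF Suc assms(1)] assms(2) by simp
qed

end

context galois_subgroup
begin

lemma normalizer_stabilizes_Z:
  assumes \<sigma>: "\<sigma> \<in> carrier Gal" and norm: "\<And>\<tau>. \<tau> \<in> H \<Longrightarrow> inv\<^sub>G \<sigma> \<star> \<tau> \<star> \<sigma> \<in> H" and z: "z \<in> Z"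
  shows "\<sigma> z \<in> Z"
proof (rule Z_I)
  note zM = Z_M[OF z]
  show sz: "\<sigma> z \<in> M" using zM \<sigma> by auto
  fix \<tau> assume t: "\<tau> \<in> H"
  note tG = H_Gal[OF t]
  have "(inv\<^sub>G \<sigma>) (\<tau> (\<sigma> z)) = (inv\<^sub>G \<sigma> \<star> \<tau> \<star> \<sigma>) z"
    using \<sigma> tG zM sz by (simp add: Gal_mult_apply)
  also have "\<dots> = z" using Z_fixed[OF z norm[OF t]] .
  finally have "\<sigma> ((inv\<^sub>G \<sigma>) (\<tau> (\<sigma> z))) = \<sigma> z" by simp
  then show "\<tau> (\<sigma> z) = \<sigma> z" using Gal_inv_apply(2)[OF \<sigma>] tG sz by simp
qed

text \<open>
  Moving \<open>z\<close> in \<open>Z\<close> across \<open>inv u\<close> replaces it by its preimage under \<open>\<sigma>\<close>. This is again in \<open>Z\<close>, since \<open>\<sigma>\<close>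
  normalizes \<open>H\<close>, and so commutes with \<open>b\<close>.
\<close>

lemma normalizer_conjugation:
  assumes u: "u \<in> twist \<sigma>" "u \<in> Units R" and \<sigma>: "\<sigma> \<in> carrier Gal"
    and norm: "\<And>\<tau>. \<tau> \<in> H \<Longrightarrow> \<sigma> \<star> \<tau> \<star> inv\<^sub>G \<sigma> \<in> H" and b: "b \<in> C"
  shows "u \<otimes> b \<otimes> inv u \<in> C"
  unfolding C_def centralizer_def
proof (intro CollectI conjI ballI)
  interpret G: group Gal by (rule group_Gal)
  have R: "u \<in> carrier R" "inv u \<in> carrier R" "b \<in> carrier R"
    using Units_closed[OF u(2)] Units_inv_closed[OF u(2)] C_carrier[OF b] by this+
  then show "u \<otimes> b \<otimes> inv u \<in> carrier R" by simp
  fix z assume z: "z \<in> Z"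
  note zM = Z_M[OF z]
  let ?z = "(inv\<^sub>G \<sigma>) z"
  have z': "?z \<in> Z"
  proof (rule normalizer_stabilizes_Z[OF G.inv_closed[OF \<sigma>] _ z])
    show "inv\<^sub>G (inv\<^sub>G \<sigma>) \<star> \<tau> \<star> inv\<^sub>G \<sigma> \<in> H" if "\<tau> \<in> H" for \<tau>
      using norm[OF that] G.inv_inv[OF \<sigma>] by (simp only:)
  qed
  note z'M = Z_M[OF z']
  have "u \<otimes> b \<otimes> inv u \<otimes> z = u \<otimes> b \<otimes> (inv u \<otimes> z)" using R zM by (simp add: m_assoc)
  also have "\<dots> = u \<otimes> (b \<otimes> ?z) \<otimes> inv u"
    using twistD(2)[OF twist_inv[OF u \<sigma>] zM] R z'M by (simp add: m_assoc)
  also have "\<dots> = u \<otimes> ?z \<otimes> b \<otimes> inv u" using C_comm[OF b z'] R z'M by (simp add: m_assoc)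
  also have "u \<otimes> ?z = z \<otimes> u" using twistD(2)[OF u(1) z'M] Gal_inv_apply(2)[OF \<sigma> zM] by simp
  finally show "u \<otimes> b \<otimes> inv u \<otimes> z = z \<otimes> (u \<otimes> b \<otimes> inv u)" using R zM by (simp add: m_assoc)
qed

end

context central_simple_with_subfield
begin

text \<open>
  Let \<open>u\<close> be a unit inducing \<open>s\<close>, \<open>\<tau>\<close> the conjugation by \<open>u\<close> and \<open>c = u [^] q\<close>. As \<open>s [^] q\<close> is in \<open>N\<close>, \<open>c\<close>
  centralizes the fixed field of \<open>N\<close>. That field is the centre of \<open>B\<close>, and \<open>s [^] m\<close> moves one of its
  elements for \<open>0 < m < q\<close>. So \<open>\<tau> ^^ m\<close> is not inner, and the spaces \<open>B \<cdot> u [^] j\<close> with \<open>j < q\<close> belong to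
  different characters of this field, which makes their sum direct. The sum is \<open>C\<close> because each
  element of \<open>H\<close> is an element of \<open>N\<close> times one of the powers \<open>s [^] j\<close>.
\<close>

theorem cyclic_step_extension:
  assumes N: "subgroup N Gal" and H: "subgroup H Gal" and finite: "finite N" "finite H"
    and step: "cyclic_step Gal N H q s" and q: "q > 1"
    and B_def: "B = centralizer R (fixed_points N M)" and C_def: "C = centralizer R (fixed_points H M)"
  shows "B \<subset> C"
    and "\<exists>\<tau> c. iso_twisted_poly_quotient (fixed_points H M) (R\<lparr>carrier := C\<rparr>) (R\<lparr>carrier := B\<rparr>) \<tau> q c \<and>
      \<tau> \<in> carrier (aut_group R K B) \<and> has_inner_order (R\<lparr>carrier := B\<rparr>) \<tau> q \<and> restrict \<tau> M = s \<and>
      c \<in> fixed_points {\<tau>} B \<and> c \<in> Units (R\<lparr>carrier := B\<rparr>)"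
proof -
  interpret G: group Gal by (rule group_Gal)
  interpret N: galois_subgroup R K M n N
    by (intro galois_subgroup.intro central_simple_with_subfield_axioms galois_subgroup_axioms.intro N finite)
  interpret H: galois_subgroup R K M n H
    by (intro galois_subgroup.intro central_simple_with_subfield_axioms galois_subgroup_axioms.intro H finite)
  have B: "B = N.C" and C: "C = H.C" by (simp_all add: B_def C_def N.C_def H.C_def N.Z_def H.Z_def)
  have q0: "q > 0" using q by simp
  note pw = G.cyclic_step_powers[OF N H step q0]
  have sG: "s \<in> carrier Gal" using H.H_Gal pw(2) .
  note iG = G.inv_closed[OF sG]
  obtain u where u: "u \<in> Units R" "u \<in> twist s" using ex_twist_unit[OF sG] by blast
  note uR = Units_closed[OF u(1)] Units_inv_closed[OF u(1)]
  have BR: "b \<in> B \<Longrightarrow> b \<in> carrier R" for b using N.C_carrier B by blast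
  have BC: "B \<subseteq> C"
    using pw(1) unfolding B C N.C_def H.C_def centralizer_def N.Z_def H.Z_def fixed_points_def by blast
  have uC: "u \<in> C" using H.twist_C[OF u(2) pw(2)] C by simp
  have moves: "\<exists>z\<in>N.Z. (s [^]\<^sub>G m) z \<noteq> z" if "0 < m" "m < q" for m
  proof (rule ccontr)
    assume "\<not> ?thesis"
    then have "s [^]\<^sub>G m \<in> N" using sG by (intro N.galois_correspondence) auto
    then show False using pw(4) that by blast
  qed
  have "u \<notin> B"
  proof
    assume "u \<in> B"
    obtain z where z: "z \<in> N.Z" "s z \<noteq> z" using moves[of 1] q sG by auto
    note zM = N.Z_M[OF z(1)]
    have "s z \<otimes> u = z \<otimes> u" using N.C_comm[of u z] \<open>u \<in> B\<close> B z twistD(2)[OF u(2) zM] by simp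
    then have "s z = z"
      by (rule Units_r_cancel[OF u(1) M_carrier[OF Gal_closed[OF sG zM]] M_carrier[OF zM]])
    with z(2) show False ..
  qed
  then show "B \<subset> C" using BC uC by blast
  define \<tau> where "\<tau> = (\<lambda>b\<in>B. u \<otimes> b \<otimes> inv u)"
  define \<tau>' where "\<tau>' = (\<lambda>b\<in>B. inv u \<otimes> b \<otimes> u)"
  have \<tau>B: "\<tau> b \<in> B" if "b \<in> B" for b
    using N.normalizer_conjugation[OF u(2,1) sG pw(6)] that B unfolding \<tau>_def by simp
  have \<tau>'B: "\<tau>' b \<in> B" if "b \<in> B" for b
    using N.normalizer_conjugation[OF twist_inv[OF u(2,1) sG] Units_inv_Units[OF u(1)] iG]
      that pw(7) u(1) sG B unfolding \<tau>'_def by simp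
  have inv: "\<tau>' (\<tau> b) = b" "\<tau> (\<tau>' b) = b" if b: "b \<in> B" for b
  proof -
    have "inv u \<otimes> (u \<otimes> b \<otimes> inv u) \<otimes> u = (inv u \<otimes> u) \<otimes> b \<otimes> (inv u \<otimes> u)"
      using uR BR[OF b] by (simp only: m_assoc m_closed)
    then show "\<tau>' (\<tau> b) = b" using \<tau>B[OF b] b u BR[OF b] by (simp add: \<tau>_def \<tau>'_def)
    have "u \<otimes> (inv u \<otimes> b \<otimes> u) \<otimes> inv u = (u \<otimes> inv u) \<otimes> b \<otimes> (u \<otimes> inv u)"
      using uR BR[OF b] by (simp only: m_assoc m_closed)
    then show "\<tau> (\<tau>' b) = b" using \<tau>'B[OF b] b u BR[OF b] by (simp add: \<tau>_def \<tau>'_def)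
  qed
  have \<tau>_comm: "u \<otimes> b = \<tau> b \<otimes> u" if "b \<in> B" for b
    using that u uR BR by (simp add: \<tau>_def m_assoc)
  have upow: "u [^] k \<in> twist (s [^]\<^sub>G k)" "u [^] k \<in> Units R" "u [^] k \<in> carrier R" for k :: nat
    using twist_pow[OF u(2) sG] uR u(1) by (auto intro: Units_pow_closed)
  note spow = G.nat_pow_closed[OF sG]
  have cB: "u [^] q \<in> B" using N.twist_C[OF upow(1) pw(3)] B by simp
  have subB: "subring B R" using N.subring_C B by simp
  \<comment> \<open>Otherwise \<open>s [^] (j - i)\<close> would fix the fixed field of \<open>N\<close> pointwise and so be in \<open>N\<close>.\<close>
  have distinct: "\<exists>z\<in>N.Z. (s [^]\<^sub>G i) z \<noteq> (s [^]\<^sub>G j) z" if ij: "i < q" "j < q" "i < j" for i j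
  proof -
    have "0 < j - i" "j - i < q" using ij by linarith+
    then obtain z where z: "z \<in> N.Z" "(s [^]\<^sub>G (j - i)) z \<noteq> z" using moves by blast
    note zM = N.Z_M[OF z(1)]
    have "s [^]\<^sub>G j = s [^]\<^sub>G i \<star> s [^]\<^sub>G (j - i)"
      using sG that by (simp add: G.nat_pow_mult)
    then have "(s [^]\<^sub>G j) z = (s [^]\<^sub>G i) ((s [^]\<^sub>G (j - i)) z)"
      using Gal_mult_apply[OF spow spow zM] by simp
    then show ?thesis using z zM aut_groupD(9)[OF spow[of i] _ zM] Gal_closed[OF spow zM] by metis
  qed
  have pow_Z: "(s [^]\<^sub>G (i::nat)) z \<in> N.Z" if "z \<in> N.Z" for i z
    using that
  proof (induct i arbitrary: z)
    case (Suc i)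
    then show ?case
      using N.normalizer_stabilizes_Z[OF sG pw(7)] Gal_mult_apply[OF spow sG N.Z_M] by simp
  qed (simp add: Gal_one_apply N.Z_M)
  interpret T: twisted_evaluation R B \<tau> u q
  proof (intro twisted_evaluation.intro ring_axioms twisted_evaluation_axioms.intro)
    fix a j assume a: "\<And>j. j < q \<Longrightarrow> a j \<in> B" and sum: "(\<Oplus>j\<in>{..<q}. a j \<otimes> u [^] j) = \<zero>" and j: "j < q"
    have "a j \<otimes> u [^] j = \<zero>"
    proof (rule eigenvectors_sum_zero[of "{..<q}" N.Z "\<lambda>j. a j \<otimes> u [^] j" "\<lambda>j. s [^]\<^sub>G j"])
      fix i z assume i: "i \<in> {..<q}" and z: "z \<in> N.Z"
      note zM = N.Z_M[OF z]
      let ?z = "(s [^]\<^sub>G i) z"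
      have aC: "a i \<in> N.C" using a i B by simp
      have z': "?z \<in> N.Z" by (rule pow_Z[OF z])
      then show z'M: "?z \<in> M" by (rule N.Z_M)
      have R: "a i \<in> carrier R" "z \<in> carrier R" "?z \<in> carrier R" using a i BR zM z'M by auto
      have "a i \<otimes> u [^] i \<otimes> z = a i \<otimes> ?z \<otimes> u [^] i"
        using twistD(2)[OF upow(1) zM, of i] R upow(3) by (simp add: m_assoc)
      also have "a i \<otimes> ?z = ?z \<otimes> a i" using N.C_comm[OF aC z'] .
      finally show "a i \<otimes> u [^] i \<otimes> z = ?z \<otimes> (a i \<otimes> u [^] i)" using R upow(3) by (simp add: m_assoc)
    next
      fix i j assume "i \<in> {..<q}" "j \<in> {..<q}" "i \<noteq> j"
      then have "i < q" "j < q" "i < j \<or> j < i" by auto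
      then show "\<exists>z\<in>N.Z. (s [^]\<^sub>G i) z \<noteq> (s [^]\<^sub>G j) z"
        using distinct[of i j] distinct[of j i] by metis
    qed (use N.Z_carrier a BR upow(3) sum j in auto)
    then show "a j = \<zero>" using Units_r_cancel[OF upow(2) BR[OF a[OF j]] zero_closed] upow(3) by simp
  qed (use subB one_not_zero \<tau>B u \<tau>_comm q0 cB in auto)
  have span: "\<exists>a. (\<forall>j<q. a j \<in> B) \<and> x = (\<Oplus>j\<in>{..<q}. a j \<otimes> u [^] j)" if x: "x \<in> C" for x
  proof -
    \<comment> \<open>If \<open>\<sigma>\<close> is an element \<open>g\<close> of \<open>N\<close> times \<open>s [^] l\<close>, division of \<open>v \<sigma>\<close> by \<open>u [^] l\<close> leaves an element
      that induces \<open>g\<close> and is therefore in \<open>B\<close>.\<close>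
    define E where "E = {(\<Oplus>j\<in>{..<q}. a j \<otimes> u [^] j) | a. \<forall>j<q. a j \<in> B}"
    have sum_E: "(\<Oplus>j\<in>{..<q}. a j \<otimes> u [^] j) \<in> E" if "\<And>j. j < q \<Longrightarrow> a j \<in> B" for a
      unfolding E_def using that by blast
    have E_I: "b \<otimes> u [^] l \<in> E" if "b \<in> B" "l < q" for b l
    proof -
      have "(\<Oplus>j\<in>{..<q}. (if j = l then b else \<zero>) \<otimes> u [^] j) = (\<Oplus>j\<in>{..<q}. if j = l then b \<otimes> u [^] j else \<zero>)"
        using that by (intro finsum_eq) auto
      also have "\<dots> = b \<otimes> u [^] l" using that by (intro finsum_delta) auto
      finally show ?thesis
        using sum_E[of "\<lambda>j. if j = l then b else \<zero>"] that by simp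
    qed
    have E_add: "y \<oplus> z \<in> E" if yz: "y \<in> E" "z \<in> E" for y z
    proof -
      from yz(1) obtain a where a: "y = (\<Oplus>j\<in>{..<q}. a j \<otimes> u [^] j)" "\<forall>j<q. a j \<in> B"
        unfolding E_def by blast
      from yz(2) obtain a' where a': "z = (\<Oplus>j\<in>{..<q}. a' j \<otimes> u [^] j)" "\<forall>j<q. a' j \<in> B"
        unfolding E_def by blast
      have "y \<oplus> z = (\<Oplus>j\<in>{..<q}. a j \<otimes> u [^] j \<oplus> a' j \<otimes> u [^] j)"
        unfolding a(1) a'(1) using a(2) a'(2) by (intro finsum_addf[symmetric]) auto
      also have "\<dots> = (\<Oplus>j\<in>{..<q}. (a j \<oplus> a' j) \<otimes> u [^] j)"
        using a(2) a'(2) by (intro finsum_eq) (auto simp: l_distr)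
      finally show ?thesis using sum_E[of "\<lambda>j. a j \<oplus> a' j"] a(2) a'(2) by simp
    qed
    have E0: "\<zero> \<in> E" using E_I[of \<zero> 0] q0 by simp
    have ER: "E \<subseteq> carrier R" unfolding E_def by (auto intro!: finsum_closed)
    obtain c where c: "\<forall>\<sigma>\<in>H. c \<sigma> \<in> M" "x = (\<Oplus>\<sigma>\<in>H. c \<sigma> \<otimes> v \<sigma>)"
      using basis_coords[OF H.basis_centralizer] x C by blast
    have "c \<sigma> \<otimes> v \<sigma> \<in> E" if s: "\<sigma> \<in> H" for \<sigma>
    proof -
      obtain l g where lg: "l < q" "g \<in> N" "\<sigma> = g \<star> s [^]\<^sub>G l" using pw(5)[OF s] by blast
      note gG = N.H_Gal[OF lg(2)] and \<sigma>G = H.H_Gal[OF s]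
      have w: "c \<sigma> \<otimes> v \<sigma> \<in> twist \<sigma>" using c(1) s v(1) \<sigma>G by (intro twist_smult) auto
      note wR = twistD(1)[OF w]
      have "c \<sigma> \<otimes> v \<sigma> \<otimes> inv (u [^] l) \<in> twist (\<sigma> \<star> inv\<^sub>G (s [^]\<^sub>G l))"
        using twist_mult[OF w twist_inv[OF upow(1,2) spow]] \<sigma>G spow by blast
      also have "\<sigma> \<star> inv\<^sub>G (s [^]\<^sub>G l) = g"
        using lg(3) gG spow by (simp add: G.m_assoc)
      finally have "c \<sigma> \<otimes> v \<sigma> \<otimes> inv (u [^] l) \<in> B" using N.twist_C lg(2) B by blast
      then have "c \<sigma> \<otimes> v \<sigma> \<otimes> inv (u [^] l) \<otimes> u [^] l \<in> E" using E_I lg(1) by blast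
      then show ?thesis using wR upow(2,3)[of l] by (simp add: m_assoc)
    qed
    then have "x \<in> E" unfolding c(2) using E0 E_add ER by (intro finsum_mem) auto
    then show ?thesis unfolding E_def by blast
  qed
  let ?B = "R\<lparr>carrier := B\<rparr>"
  interpret B': ring ?B by (rule T.ring_B)
  have "fixed_points H M \<subseteq> B" using H.Z_M N.M_C B unfolding H.Z_def by blast
  then have iso: "iso_twisted_poly_quotient (fixed_points H M) (R\<lparr>carrier := C\<rparr>) ?B \<tau> q (u [^] q)"
    using T.iso_twisted_poly_quotient[OF _ BC uC _ span] H.subring_C C by blast
  have Bmult: "x \<in> B \<Longrightarrow> y \<in> B \<Longrightarrow> x \<otimes> y \<in> B" for x y by simp
  have aut: "\<tau> \<in> carrier (aut_group R K B)"
  proof (rule aut_groupI)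
    show "\<tau> \<in> extensional B" by (simp add: \<tau>_def)
    show "bij_betw \<tau> B B" by (rule bij_betwI[of _ _ _ \<tau>']) (use \<tau>B \<tau>'B inv in auto)
    show "\<tau> (x \<otimes> y) = \<tau> x \<otimes> \<tau> y" if "x \<in> B" "y \<in> B" for x y
    proof -
      have R: "x \<in> carrier R" "y \<in> carrier R" using that BR by auto
      have "u \<otimes> x \<otimes> inv u \<otimes> (u \<otimes> y \<otimes> inv u) = u \<otimes> x \<otimes> (inv u \<otimes> u) \<otimes> y \<otimes> inv u"
        using R uR by (simp only: m_assoc m_closed)
      then show ?thesis using that R u uR by (simp add: \<tau>_def m_assoc)
    qed
    show "\<tau> (x \<oplus> y) = \<tau> x \<oplus> \<tau> y" if "x \<in> B" "y \<in> B" for x y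
      using that BR[OF that(1)] BR[OF that(2)] uR by (simp add: \<tau>_def l_distr r_distr)
    show "\<tau> \<one> = \<one>" using u uR by (simp add: \<tau>_def)
    show "\<tau> x = x" if "x \<in> K" for x
    proof -
      have "x \<in> B" using that K_M N.M_C B by blast
      then show ?thesis using K_comm[OF that uR(1)] K_carrier[OF that] u uR
        by (simp add: \<tau>_def m_assoc flip: K_comm[OF that uR(1)])
    qed
  qed
  have res: "restrict \<tau> M = s"
  proof
    fix m
    show "restrict \<tau> M m = s m"
    proof (cases "m \<in> M")
      case True
      then have "m \<in> B" using N.M_C B by blast
      then show ?thesis using True twistD(2)[OF u(2) True] u uR sG by (simp add: \<tau>_def m_assoc)
    next
      case False
      then show ?thesis using aut_groupD(3)[OF sG] by (simp add: extensional_def)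
    qed
  qed
  have ic: "inv (u [^] q) \<in> B"
    using centralizer_Units_inv[OF _ upow(2) N.Z_carrier] cB unfolding B N.C_def by blast
  have cU: "u [^] q \<in> Units ?B"
    using cB ic Units_l_inv[OF upow(2)] Units_r_inv[OF upow(2)] by (auto simp: Units_def)
  have c_fix: "u [^] q \<in> fixed_points {\<tau>} B"
  proof -
    have "u \<otimes> u [^] q = u [^] q \<otimes> u" using uR nat_pow_Suc2[of u q] by simp
    then have "\<tau> (u [^] q) = u [^] q"
      using cB u uR upow(3)[of q] by (simp add: \<tau>_def m_assoc)
    then show ?thesis using cB by (simp add: fixed_points_def)
  qed
  have \<tau>pow: "(\<tau> ^^ k) b = u [^] k \<otimes> b \<otimes> inv (u [^] k)" if b: "b \<in> B" for k b
    using T.u_pow_comm[OF b, of k] BR[OF b] BR[OF T.\<tau>_pow_closed[OF b, of k]] upow(2,3)[of k]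
    by (simp add: m_assoc)
  have "inner_automorphism ?B (\<tau> ^^ q)"
  proof -
    have "inv\<^bsub>?B\<^esub> (u [^] q) = inv (u [^] q)"
      using cB ic upow(2)[of q] by (intro B'.inv_char) auto
    then have "\<forall>x\<in>carrier ?B. (\<tau> ^^ q) x = u [^] q \<otimes>\<^bsub>?B\<^esub> x \<otimes>\<^bsub>?B\<^esub> inv\<^bsub>?B\<^esub> (u [^] q)"
      using \<tau>pow by simp
    then show ?thesis unfolding inner_automorphism_def using cU by blast
  qed
  moreover have "\<not> inner_automorphism ?B (\<tau> ^^ m)" if m: "0 < m" "m < q" for m
  proof
    assume "inner_automorphism ?B (\<tau> ^^ m)"
    then obtain w where w: "w \<in> Units ?B" "\<And>x. x \<in> B \<Longrightarrow> (\<tau> ^^ m) x = w \<otimes> x \<otimes> inv\<^bsub>?B\<^esub> w"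
      unfolding inner_automorphism_def by auto
    note wB = B'.Units_closed[OF w(1)] B'.Units_inv_closed[OF w(1)] B'.Units_r_inv[OF w(1)]
    obtain z where z: "z \<in> N.Z" "(s [^]\<^sub>G m) z \<noteq> z" using moves m by blast
    note zM = N.Z_M[OF z(1)]
    have zB: "z \<in> B" using zM N.M_C B by blast
    have "(\<tau> ^^ m) z = z \<otimes> w \<otimes> inv\<^bsub>?B\<^esub> w"
      using w(2)[OF zB] N.C_comm[of w z] wB(1) B z by simp
    also have "\<dots> = z" using wB BR[of w] BR[of "inv\<^bsub>?B\<^esub> w"] zM by (simp add: m_assoc)
    finally have "u [^] m \<otimes> z \<otimes> inv (u [^] m) = z" using \<tau>pow[OF zB] by simp
    then have "(s [^]\<^sub>G m) z = z"
      using twistD(2)[OF upow(1) zM, of m] Gal_closed[OF spow zM, of m] upow(2,3)[of m] by (simp add: m_assoc)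
    with z(2) show False by simp
  qed
  ultimately have "has_inner_order ?B \<tau> q" unfolding has_inner_order_def using q0 by blast
  with iso aut res c_fix cU
  show "\<exists>\<tau> c. iso_twisted_poly_quotient (fixed_points H M) (R\<lparr>carrier := C\<rparr>) ?B \<tau> q c \<and>
      \<tau> \<in> carrier (aut_group R K B) \<and> has_inner_order ?B \<tau> q \<and> restrict \<tau> M = s \<and>
      c \<in> fixed_points {\<tau>} B \<and> c \<in> Units ?B" by blast
qed

end

section \<open>The chain of crossed products\<close>

theorem theorem8p7:
  fixes A :: "('a, 'b) ring_scheme"
    and F M :: "'a set"
    and G :: "('a \<Rightarrow> 'a) monoid"
    and Gs :: "nat \<Rightarrow> ('a \<Rightarrow> 'a) set"
    and \<sigma> :: "nat \<Rightarrow> 'a \<Rightarrow> 'a"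
    and q :: "nat \<Rightarrow> nat"
    and n k :: nat
  assumes csa: "central_simple_algebra_of_degree A F n"
    and ext: "field_extension_of_degree A F M n"
    and max: "maximal_subfield A M"
    and G: "G = aut_group A F M"
    and nontrivial: "carrier G \<noteq> {\<one>\<^bsub>G\<^esub>}"
    and solvable: "solvable G"
    and bottom: "Gs 0 = {\<one>\<^bsub>G\<^esub>}"
    and top: "Gs k = carrier G"
    and subgroups: "\<And>j. j \<le> k \<Longrightarrow> subgroup (Gs j) G"
    and strict: "\<And>j. j < k \<Longrightarrow> Gs j \<subset> Gs (Suc j)"
    and prime: "\<And>j. j < k \<Longrightarrow> prime (q j)"
    and step: "\<And>j. j < k \<Longrightarrow> cyclic_step G (Gs j) (Gs (Suc j)) (q j) (\<sigma> (Suc j))"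
  shows "\<exists>As \<tau> c.
      As 0 = M \<and>
      As k = centralizer A (fixed_points (carrier G) M) \<and>
      As k \<subseteq> carrier A \<and>
      (\<forall>i<k. As i \<subset> As (Suc i)) \<and>
      (\<forall>i\<le>k. subring (As i) A \<and> F \<subseteq> As i \<and>
        crossed_product_algebra (A\<lparr>carrier := As i\<rparr>) (fixed_points (Gs i) M) M (Gs i)) \<and>
      (\<forall>i<k. iso_twisted_poly_quotient (fixed_points (Gs (Suc i)) M)
          (A\<lparr>carrier := As (Suc i)\<rparr>) (A\<lparr>carrier := As i\<rparr>) (\<tau> i) (q i) (c i)) \<and>
      (\<forall>i<k.
        (prime (q i) \<and> order (G\<lparr>carrier := Gs (Suc i)\<rparr> Mod Gs i) = q i) \<and>
        (\<tau> i \<in> carrier (aut_group A F (As i)) \<and>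
         has_inner_order (A\<lparr>carrier := As i\<rparr>) (\<tau> i) (q i) \<and>
         restrict (\<tau> i) M = \<sigma> (Suc i) \<and>
         cyclic_step G (Gs i) (Gs (Suc i)) (q i) (\<sigma> (Suc i))) \<and>
        (c i \<in> fixed_points {\<tau> i} (As i) \<and> c i \<in> Units (A\<lparr>carrier := As i\<rparr>)))"
proof -
  interpret A: ring A using csa by (simp add: central_simple_algebra_of_degree_def)
  note csa' = csa[unfolded central_simple_algebra_of_degree_def]
    and ext' = ext[unfolded field_extension_of_degree_def]
  interpret A: central_simple_with_subfield A F M n
  proof (intro central_simple_with_subfield.intro central_simple.intro A.ring_axioms
      central_simple_axioms.intro central_simple_with_subfield_axioms.intro)
    show "I = {\<zero>\<^bsub>A\<^esub>} \<or> I = carrier A" if "ideal I A" for I using csa' that by blast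
  qed (use csa' ext' in blast)+
  interpret G: group G unfolding G by (rule A.group_Gal)
  have finite: "finite (Gs j)" if "j \<le> k" for j
    using that
  proof (induct j)
    case 0 then show ?case using bottom by simp
  next
    case (Suc j)
    have "q j > 0" using prime[of j] Suc(2) prime_gt_0_nat by auto
    note pw = G.cyclic_step_powers[OF subgroups[of j] subgroups[of "Suc j"] step[of j] this]
    have "Gs (Suc j) \<subseteq> (\<lambda>(g, l). g \<otimes>\<^bsub>G\<^esub> \<sigma> (Suc j) [^]\<^bsub>G\<^esub> l) ` (Gs j \<times> {..<q j})"
    proof
      fix h assume "h \<in> Gs (Suc j)"
      then obtain l g where "l < q j" "g \<in> Gs j" "h = g \<otimes>\<^bsub>G\<^esub> \<sigma> (Suc j) [^]\<^bsub>G\<^esub> l"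
        using pw(5) Suc(2) by (metis Suc_le_lessD less_or_eq_imp_le)
      then show "h \<in> (\<lambda>(g, l). g \<otimes>\<^bsub>G\<^esub> \<sigma> (Suc j) [^]\<^bsub>G\<^esub> l) ` (Gs j \<times> {..<q j})" by force
    qed
    then show ?case using Suc by (meson Suc_leD finite_SigmaI finite_imageI finite_lessThan finite_subset)
  qed
  have gs: "galois_subgroup A F M n (Gs i)" if "i \<le> k" for i
    using subgroups[OF that] finite[OF that] unfolding G
    by (intro galois_subgroup.intro A.central_simple_with_subfield_axioms galois_subgroup_axioms.intro)
  define As where "As i = centralizer A (fixed_points (Gs i) M)" for i
  have "fixed_points (Gs 0) M = M" unfolding bottom G aut_group_one by (auto simp: fixed_points_def)
  then have As0: "As 0 = M" using A.centralizer_M by (simp add: As_def)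
  have each: "subring (As i) A \<and> F \<subseteq> As i \<and>
        crossed_product_algebra (A\<lparr>carrier := As i\<rparr>) (fixed_points (Gs i) M) M (Gs i)" if i: "i \<le> k" for i
  proof -
    interpret Gi: galois_subgroup A F M n "Gs i" by (rule gs[OF i])
    have As: "As i = Gi.C" by (simp add: As_def Gi.C_def Gi.Z_def)
    show ?thesis
      unfolding As using Gi.subring_C Gi.centralizer_crossed_product A.K_M Gi.M_C by (auto simp: Gi.Z_def)
  qed
  define P where "P i \<tau> c \<longleftrightarrow>
      iso_twisted_poly_quotient (fixed_points (Gs (Suc i)) M)
        (A\<lparr>carrier := As (Suc i)\<rparr>) (A\<lparr>carrier := As i\<rparr>) \<tau> (q i) c \<and>
      \<tau> \<in> carrier (aut_group A F (As i)) \<and> has_inner_order (A\<lparr>carrier := As i\<rparr>) \<tau> (q i) \<and>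
      restrict \<tau> M = \<sigma> (Suc i) \<and> c \<in> fixed_points {\<tau>} (As i) \<and> c \<in> Units (A\<lparr>carrier := As i\<rparr>)" for i \<tau> c
  have ext_i: "As i \<subset> As (Suc i)" "\<exists>\<tau> c. P i \<tau> c" if i: "i < k" for i
  proof -
    have le: "i \<le> k" "Suc i \<le> k" using i by auto
    note * = A.cyclic_step_extension[OF subgroups[OF le(1), unfolded G] subgroups[OF le(2), unfolded G]
        finite[OF le(1)] finite[OF le(2)] step[OF i, unfolded G] prime_gt_1_nat[OF prime[OF i]]
        As_def As_def]
    show "As i \<subset> As (Suc i)" by (rule *(1))
    show "\<exists>\<tau> c. P i \<tau> c" unfolding P_def by (rule *(2))
  qed
  then have "\<forall>i. \<exists>\<tau> c. i < k \<longrightarrow> P i \<tau> c" by blast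
  then obtain \<tau> c where \<tau>c: "\<And>i. i < k \<Longrightarrow> P i (\<tau> i) (c i)" by metis
  show ?thesis
  proof (intro exI[of _ As] exI[of _ \<tau>] exI[of _ c] conjI allI impI)
    show "As k = centralizer A (fixed_points (carrier G) M)" using top by (simp add: As_def)
    show "As k \<subseteq> carrier A" by (auto simp: As_def centralizer_def)
    show "order (G\<lparr>carrier := Gs (Suc i)\<rparr> Mod Gs i) = q i" if "i < k" for i
      using step[OF that] by (simp add: cyclic_step_def)
  qed (use As0 each ext_i(1) \<tau>c[unfolded P_def] prime step in simp_all)
qed

end
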